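(* Let $(X_0,a_0),\dots,(X_n,a_n)$ be a sample from a controlled Markov chain with finite state space $\mathcal S=\{1,\dots,d\}$, finite action space $\mathcal A=\{1,\dots,k\}$ and transition probabilities $M^{(l)}_{s,t}$, under a logging policy for which the following three conditions hold. (1) For all $(s,l)\in\mathcal S\times\mathcal A$ there exist $0<\beta<1$ and a deterministic sequence $(T_i)_{i\ge1}$ with $T_i=O(i^{\beta})$ such that for all $i\ge1$, $\mathbb E\big[\tau^{(i)}_{s,l}\mid\mathcal F_{\sum_{p=1}^{i-1}\tau^{(p)}_{s,l}}\big]\le T_i$ almost surely. (2) There exists a constant $C_\Delta>1$ independent of $n$ such that $\|\Delta_n\|:=\max_{1\le i\le n}\big(1+\bar\eta_{i,i+1}(n)+\dots+\bar\eta_{i,n}(n)\big)\le C_\Delta$ for all $n$. (3) For every $(s,l)$ the limit $p_s^{(l)}=\lim_{n\to\infty}\frac1n\sum_{i=0}^{n-1}\mathbb P(X_i=s,a_i=l)$ exists, and $\min_{s,l}p_s^{(l)}>0$. Let $0<\alpha<1$ be the discount factor, and let $\Pi_{opt}$ and $\hat\Pi_{opt}$ be the block-diagonal matrices of the optimal policies $\pi_{opt}$ and $\hat\pi_{opt}$ under the true and the estimated transition matrices $\mathbf M$ and $\hat{\mathbf M}$. Assume that for any $\epsilon>0$ and any policy $\pi'$ with $\|\Pi_{opt}-\Pi'\|_\infty>\epsilon$, the value functions corresponding to $\pi_{opt}$ and $\pi'$ satisfy $$\inf_{s\in\mathcal S}\{V_{\Pi_{opt}}(s)-V_{\Pi'}(s)\}>0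 .$$ Then $\hat\Pi_{opt}\overset{p}{\rightarrow}\Pi_{opt}$ and $$\sqrt n\,\big(\hat V_{\hat\Pi_{opt}}-V_{\Pi_{opt}}\big)\overset{d}{\rightarrow}\mathcal N\big(0,\Sigma_V^{\Pi_{opt}}\big),$$ where, for a policy matrix $\Pi$, $$\Sigma_V^\Pi=\alpha^2\big[(I-\alpha\Pi\mathbf M)^{-1}\Pi\otimes V_\Pi^\top\big]\bar\Lambda\big[\Pi^\top(I-\alpha\mathbf M^\top\Pi^\top)^{-1}\otimes V_\Pi\big],$$ and $\bar\Lambda$ is the $d^2k\times d^2k$ matrix whose entry in row $(s-1)dk+(l-1)d+t$ and column $(s'-1)dk+(l'-1)d+t'$ is $$\bar\lambda_{slt,s'l't'}=\frac{\mathbb 1[(s,l)=(s',l')]\big(\mathbb 1[t=t']M^{(l)}_{s,t}-M^{(l)}_{s,t}M^{(l')}_{s',t'}\big)}{\sqrt{p_s^{(l)}p_{s'}^{(l')}}}.$$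
   Context: Controlled Markov chain (CMC): let $\mathcal F_j=\sigma(X_0,a_0,\dots,X_j,a_j)$. A CMC is a process $\{(X_i,a_i)\}_{i\ge0}$ with values in $\mathcal S\times\mathcal A$ such that for all times $i$ and all histories $(s_0,l_0,\dots,s_i,l_i)$ of positive probability, $\mathbb P(X_{i+1}=t\mid X_0=s_0,a_0=l_0,\dots,X_i=s_i,a_i=l_i)=\mathbb P(X_{i+1}=t\mid X_i=s_i,a_i=l_i)=M^{(l_i)}_{s_i,t}$, with $M^{(l)}_{s,t}$ not depending on $i$. The law of $a_i$ given $(X_0,a_0,\dots,X_{i-1},a_{i-1},X_i)$ (the logging policy) may be history-dependent and time-inhomogeneous. Estimator: $N_s^{(l)}=\sum_{i=0}^{n-1}\mathbb 1[X_i=s,a_i=l]$, $N_{s,t}^{(l)}=\sum_{i=0}^{n-1}\mathbb 1[X_i=s,X_{i+1}=t,a_i=l]$, $\hat M^{(l)}_{s,t}=N^{(l)}_{s,t}/N^{(l)}_s$ (set to $0$ when $N_s^{(l)}=0$). $\mathbf M$ is the $dk\times d$ matrix whose $((s-1)k+l,\,t)$ entry is $M^{(l)}_{s,t}$; $\hat{\mathbf M}$ is the same with $\hat M^{(l)}_{s,t}$. Return times: $\tau^{(1)}_{s,l}=\min\{i>0:X_i=s,a_i=l\}$ and, for $i\ge2$, $\tau^{(i)}_{s,l}=\min\{m>0: X_{\sum_{j=1}^{i-1}\tau^{(j)}_{s,l}+m}=s,\ a_{\sum_{j=1}^{i-1}\tau^{(j)}_{s,l}+m}=l\}$. $\mathcal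 F_{\sum_{p=1}^{i-1}\tau^{(p)}_{s,l}}$ is the $\sigma$-algebra of the corresponding stopping time. Weak mixing coefficients: for $i<j\le n$, $\bar\eta_{i,j}(n)=\sup\big|\mathbb P((X_j,a_j,\dots,X_n,a_n)\in\mathcal T\mid X_i=s_1,a_i=l_1,\mathcal H_0^{i-1}=h)-\mathbb P((X_j,a_j,\dots,X_n,a_n)\in\mathcal T\mid X_i=s_2,a_i=l_2,\mathcal H_0^{i-1}=h)\big|$, where $\mathcal H_0^{i-1}=((X_0,a_0),\dots,(X_{i-1},a_{i-1}))$ and the supremum is over $\mathcal T\subseteq(\mathcal S\times\mathcal A)^{n-j+1}$, $s_1,s_2\in\mathcal S$, $l_1,l_2\in\mathcal A$, $h\in(\mathcal S\times\mathcal A)^i$ such that both conditioning events have positive probability. Policy quantities: a (stationary) policy is a map $\pi:\mathcal S\to\Delta(\mathcal A)$, with $\Delta(\mathcal A)$ the probability simplex over $\mathcal A$. For each $s$, $\pi_s=[\pi(s,1),\dots,\pi(s,k)]$ (row vector), and $\Pi=\operatorname{diag}(\pi_1,\dots,\pi_d)$ is the $d\times dk$ block-diagonal matrix of $\pi$ (likewise $\Pi'$ for $\pi'$). Given a fixed reward vector $\tilde g=(\tilde g(x,a))_{(x,a)\in\mathcal S\times\mathcal A}$, the policy $\pi$ has expected reward $g(x)=\sum_a\pi(x,a)\tilde g(x,a)$, $g\in\mathbb R^d$ (depending on $\pi$), value function $V_\Pi=(I-\alpha\Pi\mathbf M)^{-1}g$ and plug-in estimate $\hat V_\Pi=(I-\alpha\Pi\hat{\mathbf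 M})^{-1}g$. The optimal policy $\pi_{opt}$ maximizes $V_\Pi(s)$ over stationary policies, simultaneously for all $s\in\mathcal S$; $\hat\pi_{opt}$ likewise maximizes $\hat V_\Pi(s)$ for all $s$. $\|\cdot\|_\infty$ is a sup-norm on matrices (the condition is insensitive to which norm is used, since it is imposed for all $\epsilon>0$). $\otimes$ is the Kronecker product; ordinary matrix products are performed before $\otimes$.
   Formalization: In condition (2) the maximum defining ‖Δ_n‖ is taken over 0≤i≤n instead of 1≤i≤n; without the row i=0 the claim fails, e.g. when the actions are drawn i.i.d. from a law that depends on X_0. *)

theory Defs
  imports "HOL-Probability.Probability"
begin

section \<open>Controlled Markov chains\<close>

text \<open>States are the elements of a finite type \<open>'d\<close>, actions those of a finite type \<open>'k\<close>. A matrix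
  whose rows are enumerated as \<open>(s - 1) k + l\<close> is indexed by \<open>'d \<times> 'k\<close>, one whose rows are
  enumerated as \<open>(s - 1) d k + (l - 1) d + t\<close> by \<open>('d \<times> 'k) \<times> 'd\<close>; the entry \<open>M $ (s, l) $ t\<close> is
  the probability of moving from \<open>s\<close> to \<open>t\<close> under the action \<open>l\<close>.\<close>

definition controlled_markov_chain ::
  "'w measure \<Rightarrow> (nat \<Rightarrow> 'w \<Rightarrow> 'd::finite) \<Rightarrow> (nat \<Rightarrow> 'w \<Rightarrow> 'k::finite) \<Rightarrow> real^'d^('d \<times> 'k) \<Rightarrow> bool"
where
  "controlled_markov_chain P X a M \<longleftrightarrow>
     prob_space P \<and>
     (\<forall>i. X i \<in> P \<rightarrow>\<^sub>M count_space UNIV) \<and>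
     (\<forall>i. a i \<in> P \<rightarrow>\<^sub>M count_space UNIV) \<and>
     (\<forall>s l t. 0 \<le> M $ (s, l) $ t) \<and>
     (\<forall>s l. (\<Sum>t\<in>UNIV. M $ (s, l) $ t) = 1) \<and>
     (\<forall>i s l t. 0 < \<P>(\<omega> in P. \<forall>j\<le>i. X j \<omega> = s j \<and> a j \<omega> = l j) \<longrightarrow>
        \<P>(\<omega> in P. X (Suc i) \<omega> = t \<bar> \<forall>j\<le>i. X j \<omega> = s j \<and> a j \<omega> = l j)
          = \<P>(\<omega> in P. X (Suc i) \<omega> = t \<bar> X i \<omega> = s i \<and> a i \<omega> = l i) \<and>
        \<P>(\<omega> in P. X (Suc i) \<omega> = t \<bar> X i \<omega> = s i \<and> a i \<omega> = l i) = M $ (s i, l i) $ t)"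

definition visits ::
  "(nat \<Rightarrow> 'w \<Rightarrow> 'd) \<Rightarrow> (nat \<Rightarrow> 'w \<Rightarrow> 'k) \<Rightarrow> nat \<Rightarrow> 'd \<Rightarrow> 'k \<Rightarrow> 'w \<Rightarrow> real" where
  "visits X a n s l \<omega> = (\<Sum>i<n. of_bool (X i \<omega> = s \<and> a i \<omega> = l))"

definition transitions ::
  "(nat \<Rightarrow> 'w \<Rightarrow> 'd) \<Rightarrow> (nat \<Rightarrow> 'w \<Rightarrow> 'k) \<Rightarrow> nat \<Rightarrow> 'd \<Rightarrow> 'k \<Rightarrow> 'd \<Rightarrow> 'w \<Rightarrow> real" where
  "transitions X a n s l t \<omega> = (\<Sum>i<n. of_bool (X i \<omega> = s \<and> X (Suc i) \<omega> = t \<and> a i \<omega> = l))"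

text \<open>An unvisited pair gets a zero row, because \<open>x / 0 = 0\<close>.\<close>

definition M_hat ::
  "(nat \<Rightarrow> 'w \<Rightarrow> 'd::finite) \<Rightarrow> (nat \<Rightarrow> 'w \<Rightarrow> 'k::finite) \<Rightarrow> nat \<Rightarrow> 'w \<Rightarrow> real^'d^('d \<times> 'k)" where
  "M_hat X a n \<omega> = (\<chi> sl t. transitions X a n (fst sl) (snd sl) t \<omega> / visits X a n (fst sl) (snd sl) \<omega>)"


section \<open>Return times\<close>

text \<open>\<open>history_sigma P X a t\<close> is generated by the pairs \<open>(X j, a j)\<close> with \<open>j \<le> t\<close>. The time index
  includes \<open>\<infinity>\<close> because the return times below may be infinite on a null set.\<close>

definition history_sigma ::
  "'w measure \<Rightarrow> (nat \<Rightarrow> 'w \<Rightarrow> 'd) \<Rightarrow> (nat \<Rightarrow> 'w \<Rightarrow> 'k) \<Rightarrow> enat \<Rightarrow> 'w measure" where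
  "history_sigma P X a t =
     sigma (space P) {(\<lambda>\<omega>. (X j \<omega>, a j \<omega>)) -` B \<inter> space P | j B. enat j \<le> t}"

text \<open>Gap between consecutive visits; for \<open>i = 1\<close> the sum is empty, so that the search starts
  after time \<open>0\<close>. The infimum of the empty set is \<open>\<infinity>\<close>.\<close>

fun return_time ::
  "(nat \<Rightarrow> 'w \<Rightarrow> 'd) \<Rightarrow> (nat \<Rightarrow> 'w \<Rightarrow> 'k) \<Rightarrow> 'd \<Rightarrow> 'k \<Rightarrow> nat \<Rightarrow> 'w \<Rightarrow> enat" where
  "return_time X a s l i \<omega> =
     Inf {enat m | m q. 0 < m \<and> enat q = (\<Sum>j = 1..<i. return_time X a s l j \<omega>) \<and>
                        X (q + m) \<omega> = s \<and> a (q + m) \<omega> = l}"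

declare return_time.simps [simp del]

definition return_sigma ::
  "'w measure \<Rightarrow> (nat \<Rightarrow> 'w \<Rightarrow> 'd) \<Rightarrow> (nat \<Rightarrow> 'w \<Rightarrow> 'k) \<Rightarrow> 'd \<Rightarrow> 'k \<Rightarrow> nat \<Rightarrow> 'w measure" where
  "return_sigma P X a s l i =
     filtration.pre_sigma (space P) (history_sigma P X a) (\<lambda>\<omega>. \<Sum>p = 1..<i. return_time X a s l p \<omega>)"


section \<open>Weak mixing coefficients\<close>

text \<open>\<open>trajectory X a i j\<close> is the segment of the sample at the times \<open>i, \<dots>, j - 1\<close>.\<close>

definition trajectory ::
  "(nat \<Rightarrow> 'w \<Rightarrow> 'd) \<Rightarrow> (nat \<Rightarrow> 'w \<Rightarrow> 'k) \<Rightarrow> nat \<Rightarrow> nat \<Rightarrow> 'w \<Rightarrow> ('d \<times> 'k) list" where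
  "trajectory X a i j \<omega> = map (\<lambda>m. (X m \<omega>, a m \<omega>)) [i..<j]"

definition eta_bar ::
  "'w measure \<Rightarrow> (nat \<Rightarrow> 'w \<Rightarrow> 'd) \<Rightarrow> (nat \<Rightarrow> 'w \<Rightarrow> 'k) \<Rightarrow> nat \<Rightarrow> nat \<Rightarrow> nat \<Rightarrow> real" where
  "eta_bar P X a n i j =
     Sup {\<bar>\<P>(\<omega> in P. trajectory X a j (Suc n) \<omega> \<in> T \<bar> X i \<omega> = s1 \<and> a i \<omega> = l1 \<and> trajectory X a 0 i \<omega> = h)
           - \<P>(\<omega> in P. trajectory X a j (Suc n) \<omega> \<in> T \<bar> X i \<omega> = s2 \<and> a i \<omega> = l2 \<and> trajectory X a 0 i \<omega> = h)\<bar>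
          | T s1 s2 l1 l2 h.
            T \<subseteq> {xs. length xs = n - j + 1} \<and> length h = i \<and>
            0 < \<P>(\<omega> in P. X i \<omega> = s1 \<and> a i \<omega> = l1 \<and> trajectory X a 0 i \<omega> = h) \<and>
            0 < \<P>(\<omega> in P. X i \<omega> = s2 \<and> a i \<omega> = l2 \<and> trajectory X a 0 i \<omega> = h)}"

text \<open>The maximum runs over all sampling times, the initial time \<open>0\<close> included: without the row
  \<open>i = 0\<close> the initial pair could select the logging policy for all later times, and the visit
  frequencies would have a random limit.\<close>

definition Delta_norm ::
  "'w measure \<Rightarrow> (nat \<Rightarrow> 'w \<Rightarrow> 'd) \<Rightarrow> (nat \<Rightarrow> 'w \<Rightarrow> 'k) \<Rightarrow> nat \<Rightarrow> real" where
  "Delta_norm P X a n = (MAX i\<in>{0..n}. 1 + (\<Sum>j = i + 1..n. eta_bar P X a n i j))"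


section \<open>Policies and value functions\<close>

text \<open>A stationary policy is a map \<open>'d \<Rightarrow> 'k pmf\<close>.\<close>

definition policy_matrix :: "('d::finite \<Rightarrow> 'k::finite pmf) \<Rightarrow> real^('d \<times> 'k)^'d" where
  "policy_matrix \<pi> = (\<chi> s sl. if fst sl = s then pmf (\<pi> s) (snd sl) else 0)"

definition expected_reward ::
  "real^('d::finite \<times> 'k::finite) \<Rightarrow> ('d \<Rightarrow> 'k pmf) \<Rightarrow> real^'d" where
  "expected_reward gt \<pi> = (\<chi> x. \<Sum>l\<in>UNIV. pmf (\<pi> x) l * gt $ (x, l))"

definition value_fun ::
  "real \<Rightarrow> real^('d \<times> 'k) \<Rightarrow> real^'d^('d \<times> 'k) \<Rightarrow> ('d::finite \<Rightarrow> 'k::finite pmf) \<Rightarrow> real^'d" where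
  "value_fun \<alpha> gt M \<pi> =
     matrix_inv (mat 1 - \<alpha> *\<^sub>R (policy_matrix \<pi> ** M)) *v expected_reward gt \<pi>"

definition optimal_policy ::
  "real \<Rightarrow> real^('d \<times> 'k) \<Rightarrow> real^'d^('d \<times> 'k) \<Rightarrow> ('d::finite \<Rightarrow> 'k::finite pmf) \<Rightarrow> bool" where
  "optimal_policy \<alpha> gt M \<pi> \<longleftrightarrow> (\<forall>\<pi>' s. value_fun \<alpha> gt M \<pi>' $ s \<le> value_fun \<alpha> gt M \<pi> $ s)"


section \<open>Asymptotic covariance\<close>

definition kronecker ::
  "real^'n^'m \<Rightarrow> real^'q^'p \<Rightarrow> real^('n::finite \<times> 'q::finite)^('m::finite \<times> 'p::finite)" where
  "kronecker A B = (\<chi> i j. A $ fst i $ fst j * B $ snd i $ snd j)"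

definition Lambda_bar ::
  "real^'d^('d \<times> 'k) \<Rightarrow> ('d \<times> 'k \<Rightarrow> real)
     \<Rightarrow> real^(('d::finite \<times> 'k::finite) \<times> 'd)^(('d \<times> 'k) \<times> 'd)" where
  "Lambda_bar M p =
     (\<chi> i j. case i of (sl, t) \<Rightarrow> case j of (sl', t') \<Rightarrow>
        of_bool (sl = sl') * (of_bool (t = t') * M $ sl $ t - M $ sl $ t * M $ sl' $ t')
          / sqrt (p sl * p sl'))"

text \<open>The triple product is a matrix over \<open>'d \<times> 1\<close>, since the second Kronecker factors are the row
  vector and the column vector of the value function; the outer \<open>\<chi>\<close> only drops the trivial index.\<close>

definition Sigma_V ::
  "real \<Rightarrow> real^('d \<times> 'k) \<Rightarrow> real^'d^('d \<times> 'k) \<Rightarrow> ('d \<times> 'k \<Rightarrow> real)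
     \<Rightarrow> ('d::finite \<Rightarrow> 'k::finite pmf) \<Rightarrow> real^'d^'d" where
  "Sigma_V \<alpha> gt M p \<pi> =
     (let Pol = policy_matrix \<pi>;
          V = value_fun \<alpha> gt M \<pi>;
          L = kronecker (matrix_inv (mat 1 - \<alpha> *\<^sub>R (Pol ** M)) ** Pol) (rowvector V :: real^'d^1);
          R = kronecker (transpose Pol ** matrix_inv (mat 1 - \<alpha> *\<^sub>R (transpose M ** transpose Pol)))
                (columnvector V :: real^1^'d);
          S = \<alpha>\<^sup>2 *\<^sub>R (L ** Lambda_bar M p ** R)
      in (\<chi> s s'. S $ (s, 1) $ (s', 1)))"


section \<open>Modes of convergence\<close>

definition converges_in_prob ::
  "'w measure \<Rightarrow> (nat \<Rightarrow> 'w \<Rightarrow> 'b::{metric_space, second_countable_topology}) \<Rightarrow> 'b \<Rightarrow> bool" where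
  "converges_in_prob P Y c \<longleftrightarrow>
     (\<forall>n. Y n \<in> borel_measurable P) \<and>
     (\<forall>\<epsilon>>0. (\<lambda>n. \<P>(\<omega> in P. \<epsilon> < dist (Y n \<omega>) c)) \<longlonglongrightarrow> 0)"

definition converges_in_distribution ::
  "'w measure \<Rightarrow> (nat \<Rightarrow> 'w \<Rightarrow> 'b::topological_space) \<Rightarrow> 'b measure \<Rightarrow> bool" where
  "converges_in_distribution P Y N \<longleftrightarrow>
     (\<forall>n. Y n \<in> borel_measurable P) \<and>
     (\<forall>f :: 'b \<Rightarrow> real. continuous_on UNIV f \<and> bounded (range f) \<longrightarrow>
        (\<lambda>n. \<integral>\<omega>. f (Y n \<omega>) \<partial>P) \<longlonglongrightarrow> (\<integral>y. f y \<partial>N))"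

text \<open>The law of \<open>\<mu> + A Z\<close> for a standard normal vector \<open>Z\<close> and any \<open>A\<close> with \<open>A A\<^sup>T = S\<close>; the
  covariance matrix \<open>S\<close> may be singular.\<close>

definition multivariate_normal :: "real^'n \<Rightarrow> real^'n^'n \<Rightarrow> (real^'n::finite) measure \<Rightarrow> bool" where
  "multivariate_normal \<mu> S N \<longleftrightarrow>
     (\<exists>A :: real^'n^'n. A ** transpose A = S \<and>
        N = distr (\<Pi>\<^sub>M i\<in>UNIV. density lborel (\<lambda>x. ennreal (std_normal_density x))) borel
              (\<lambda>z. \<mu> + A *v (\<chi> i. z i)))"

end

theory Submission
  imports Defs "HOL-Real_Asymp.Real_Asymp"
begin

text \<open>The visit count of a pair differs from its mean by the sum of the increments of its Doob
  martingale. Each increment compares two histories that differ only in the present pair, so it is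
  bounded by the norm of the matrix of mixing coefficients; hence the variance is \<open>O(n)\<close> and visit
  frequencies converge to \<open>p\<close> in \<open>L\<^sup>1\<close>. Sums of \<open>h (X i, a i) (X (i + 1))\<close> with \<open>h\<close> centred under \<open>M\<close>
  then satisfy a central limit theorem, because their conditional variances depend on visit
  frequencies only; this covers the linearisation of \<open>\<surd>n (M_hat - M)\<close>.

  The value of the estimated optimal policy is sandwiched: it is at least the estimated value of
  the true optimal policy, and it exceeds the true optimal value by at most the estimation error for
  the estimated policy. Both bounds have the same first-order term
  \<open>\<alpha> (I - \<alpha> \<Pi> M)\<^sup>-\<^sup>1 \<Pi> (M_hat - M) V\<close>, provided the estimated policy converges to the optimal one,
  which follows from separation by compactness of the set of policies.\<close>

section \<open>Discounted values of policies\<close>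

text \<open>The logging policy may depend on the whole past, so the pairs \<open>(X i, a i)\<close>
  need not form a Markov chain. What survives is that the next state, given the whole history,
  follows a row of \<open>M\<close>; hence centred transition sums are martingales whatever the
  policy. Histories of a given length are finite in number, so conditioning reduces to finite sums
  over lists. The maximising policy is not a differentiable function of the transition matrix. As in
  the envelope theorem only the value is expanded, with a remainder of order
  \<open>norm (M' - M)\<close> times the sum of the policy distance and
  \<open>norm (M' - M)\<close>. After scaling by the square root of \<open>n\<close> the first
  factor is stochastically bounded and the second tends to 0 in probability, so consistency of the
  policy suffices, without a rate. Limits in law are tested on all bounded continuous functions.
  They are reached from characteristic functions by trigonometric approximation together with
  tightness, which comes from second moments. A linear functional of the error is a scalar
  martingale sum, so a scalar central limit theorem is enough.\<close>

lemma norm_matrix_vector_mult_le: "norm (A *v x) \<le> norm A * norm x" for A :: "real^'n^'m"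
proof -
  have "norm (A *v x) = L2_set (\<lambda>i. \<bar>A $ i \<bullet> x\<bar>) UNIV"
    by (simp add: norm_vec_def matrix_mult_dot)
  also have "\<dots> \<le> L2_set (\<lambda>i. norm (A $ i) * norm x) UNIV"
    by (intro L2_set_mono Cauchy_Schwarz_ineq2) auto
  also have "\<dots> = norm A * norm x"
    by (simp add: norm_vec_def[of A] L2_set_left_distrib)
  finally show ?thesis .
qed

lemma norm_matrix_le_card:
  fixes A :: "real^'n^'m"
  assumes "\<And>i j. \<bar>A $ i $ j\<bar> \<le> 1"
  shows "norm A \<le> CARD('m) * CARD('n)"
proof -
  have "norm (A $ i) \<le> (\<Sum>j\<in>(UNIV::'n set). 1)" for i
    by (rule order_trans[OF norm_le_l1_cart]) (intro sum_mono assms)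
  then have "L2_set (\<lambda>i. norm (A $ i)) UNIV \<le> (\<Sum>i\<in>(UNIV::'m set). real CARD('n))"
    by (intro order_trans[OF L2_set_le_sum] sum_mono) auto
  then show ?thesis by (simp add: norm_vec_def)
qed

text \<open>Row sums are only bounded by 1 because the estimate has a zero row for every pair not
  yet visited.\<close>

definition substochastic :: "real^'n^'m \<Rightarrow> bool" where
  "substochastic A \<longleftrightarrow> (\<forall>i j. 0 \<le> A $ i $ j) \<and> (\<forall>i. (\<Sum>j\<in>UNIV. A $ i $ j) \<le> 1)"

lemma substochastic_nth_le: 
  assumes "substochastic A" shows "\<bar>A $ i $ j\<bar> \<le> 1"
proof -
  have "A $ i $ j \<le> (\<Sum>j\<in>UNIV. A $ i $ j)"
    using assms by (intro member_le_sum) (auto simp: substochastic_def)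
  with assms show ?thesis by (auto simp: substochastic_def intro: order_trans)
qed

lemma substochastic_mult_vec_le:
  assumes A: "substochastic A" and x: "\<And>j. \<bar>x $ j\<bar> \<le> c" and c: "0 \<le> c"
  shows "\<bar>(A *v x) $ i\<bar> \<le> c"
proof -
  have "\<bar>(A *v x) $ i\<bar> \<le> (\<Sum>j\<in>UNIV. A $ i $ j * \<bar>x $ j\<bar>)"
    using A unfolding matrix_vector_mult_def substochastic_def
    by (auto intro!: order_trans[OF sum_abs] sum_mono simp: abs_mult)
  also have "\<dots> \<le> (\<Sum>j\<in>UNIV. A $ i $ j * c)"
    using A x by (intro sum_mono mult_left_mono) (auto simp: substochastic_def)
  also have "\<dots> \<le> 1 * c"
    unfolding sum_distrib_right[symmetric] using A c
    by (intro mult_right_mono) (auto simp: substochastic_def)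
  finally show ?thesis by simp
qed

section \<open>Policy matrices as a compact set\<close>

lemma sum_fiber_fst:
  fixes f :: "'d::finite \<times> 'k::finite \<Rightarrow> 'b::comm_monoid_add"
  shows "(\<Sum>sl\<in>UNIV. if fst sl = s then f sl else 0) = (\<Sum>l\<in>UNIV. f (s, l))"
proof -
  have "(\<Sum>sl\<in>UNIV. if fst sl = s then f sl else 0) = (\<Sum>sl\<in>{sl. fst sl = s}. f sl)"
    by (simp add: sum.If_cases)
  also have "\<dots> = (\<Sum>l\<in>UNIV. f (s, l))"
    by (rule sum.reindex_bij_witness[of _ "\<lambda>l. (s, l)" snd]) auto
  finally show ?thesis .
qed

lemma sum_pmf_UNIV: "(\<Sum>l\<in>UNIV. pmf q l) = 1" for q :: "'k::finite pmf"
  by (rule sum_pmf_eq_1) auto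

text \<open>Describes the policies by finitely many linear equations and inequalities between matrix
  entries, from which closedness can be read off.\<close>

lemma range_policy_matrix:
  "range policy_matrix = {Q :: real^('d::finite \<times> 'k::finite)^'d.
     (\<forall>s sl. 0 \<le> Q $ s $ sl \<and> (fst sl \<noteq> s \<longrightarrow> Q $ s $ sl = 0)) \<and> (\<forall>s. (\<Sum>sl\<in>UNIV. Q $ s $ sl) = 1)}"
  (is "_ = ?R")
proof (intro equalityI subsetI)
  fix Q :: "real^('d \<times> 'k)^'d" assume "Q \<in> range policy_matrix"
  then obtain \<pi> where "Q = policy_matrix \<pi>" by auto
  then show "Q \<in> ?R"
    by (auto simp: policy_matrix_def sum_fiber_fst sum_pmf_UNIV)
next
  fix Q :: "real^('d \<times> 'k)^'d" assume Q: "Q \<in> ?R"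
  have sum1: "(\<Sum>l\<in>UNIV. Q $ s $ (s, l)) = 1" for s
  proof -
    have "(\<Sum>sl\<in>UNIV. Q $ s $ sl) = (\<Sum>sl\<in>UNIV. if fst sl = s then Q $ s $ sl else 0)"
      using Q by (intro sum.cong) auto
    also have "\<dots> = (\<Sum>l\<in>UNIV. Q $ s $ (s, l))" by (rule sum_fiber_fst)
    finally show ?thesis using Q by simp
  qed
  define \<pi> where "\<pi> s = embed_pmf (\<lambda>l. Q $ s $ (s, l))" for s
  have "pmf (\<pi> s) l = Q $ s $ (s, l)" for s l
    unfolding \<pi>_def
  proof (rule pmf_embed_pmf)
    show "(\<integral>\<^sup>+ l. ennreal (Q $ s $ (s, l)) \<partial>count_space UNIV) = 1"
      using Q sum1[of s] by (subst nn_integral_count_space_finite) (auto simp: sum_ennreal)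
  qed (use Q in auto)
  then have "Q = policy_matrix \<pi>"
    using Q by (auto simp: policy_matrix_def vec_eq_iff)
  then show "Q \<in> range policy_matrix" by auto
qed

lemma substochastic_policy_matrix: "substochastic (policy_matrix \<pi>)"
  by (auto simp: substochastic_def policy_matrix_def sum_fiber_fst sum_pmf_UNIV)

lemma norm_policy_matrix_le:
  "norm (policy_matrix \<pi> :: real^('d::finite \<times> 'k::finite)^'d) \<le> CARD('d) * CARD('d \<times> 'k)"
  by (intro norm_matrix_le_card substochastic_nth_le substochastic_policy_matrix)

lemma compact_range_policy_matrix:
  "compact (range policy_matrix :: (real^('d::finite \<times> 'k::finite)^'d) set)"
  unfolding compact_eq_bounded_closed
proof
  show "bounded (range policy_matrix :: (real^('d \<times> 'k)^'d) set)"
    unfolding bounded_iff using norm_policy_matrix_le by (intro exI) auto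
  \<comment> \<open>The premise does not involve \<open>Q\<close>, so the set is either everything
    or a coordinate hyperplane.\<close>
  have 1: "closed {Q :: real^('d \<times> 'k)^'d. fst sl \<noteq> s \<longrightarrow> Q $ s $ sl = 0}" for s sl
    by (cases "fst sl = s") (auto intro!: closed_Collect_eq continuous_intros)
  show "closed (range policy_matrix :: (real^('d \<times> 'k)^'d) set)"
    unfolding range_policy_matrix
    by (intro closed_Collect_conj closed_Collect_all closed_Collect_le closed_Collect_eq
        continuous_intros 1)
qed

section \<open>The discounted fixed-point equation\<close>

lemma expected_reward_eq: "expected_reward gt \<pi> = policy_matrix \<pi> *v gt"
proof -
  have "(\<Sum>l\<in>UNIV. pmf (\<pi> x) l * gt $ (x, l)) = (\<Sum>sl\<in>UNIV. policy_matrix \<pi> $ x $ sl * gt $ sl)" for x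
    using sum_fiber_fst[of x "\<lambda>sl. pmf (\<pi> x) (snd sl) * gt $ sl"]
    by (simp add: policy_matrix_def if_distrib[of "\<lambda>x. x * _"] cong: if_cong)
  then show ?thesis by (simp add: expected_reward_def matrix_vector_mult_def vec_eq_iff)
qed

text \<open>At a coordinate where \<open>y\<close> is largest in absolute value, the two
  substochastic factors cannot exceed the maximum \<open>m\<close>, so \<open>m\<close> is at most
  \<open>norm r + \<alpha> * m\<close>. The factor \<open>CARD('d)\<close> pays for passing from the
  maximum to the Euclidean norm.\<close>

lemma discounted_fixpoint_bound:
  fixes Q :: "real^'m^'d" and M :: "real^'d^'m"
  assumes Q: "substochastic Q" and M: "substochastic M" and \<alpha>: "0 \<le> \<alpha>" "\<alpha> < 1"
    and y: "y = r + \<alpha> *\<^sub>R (Q *v (M *v y))"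
  shows "norm y \<le> CARD('d) / (1 - \<alpha>) * norm r"
proof -
  define m where "m = Max (range (\<lambda>s. \<bar>y $ s\<bar>))"
  have le_m: "\<bar>y $ s\<bar> \<le> m" for s unfolding m_def by (intro Max_ge) auto
  have m0: "0 \<le> m" using le_m[of undefined] by linarith
  have "m \<in> range (\<lambda>s. \<bar>y $ s\<bar>)" unfolding m_def by (intro Max_in) auto
  then obtain s where s: "m = \<bar>y $ s\<bar>" by auto
  have "y $ s = r $ s + \<alpha> * (Q *v (M *v y)) $ s" by (subst y) simp
  then have "m \<le> \<bar>r $ s\<bar> + \<alpha> * \<bar>(Q *v (M *v y)) $ s\<bar>"
    using \<alpha> s by (metis abs_mult abs_of_nonneg abs_triangle_ineq)
  also have "\<dots> \<le> norm r + \<alpha> * m"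
    by (intro add_mono mult_left_mono substochastic_mult_vec_le Q M component_le_norm_cart le_m m0 \<alpha>)
  finally have "m * (1 - \<alpha>) \<le> norm r" by (simp add: algebra_simps)
  then have m: "m \<le> norm r / (1 - \<alpha>)" using \<alpha> by (simp add: pos_le_divide_eq)
  have "norm y \<le> (\<Sum>s\<in>(UNIV::'d set). \<bar>y $ s\<bar>)" by (rule norm_le_l1_cart)
  also have "\<dots> \<le> (\<Sum>s\<in>(UNIV::'d set). norm r / (1 - \<alpha>))"
    by (intro sum_mono order_trans[OF le_m m])
  finally show ?thesis by simp
qed

text \<open>A vector in the kernel solves the fixed-point equation with \<open>r = 0\<close>, so the
  preceding bound forces it to vanish.\<close>

lemma invertible_discounted:
  fixes Q :: "real^'m^'d" and M :: "real^'d^'m"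
  assumes Q: "substochastic Q" and M: "substochastic M" and \<alpha>: "0 \<le> \<alpha>" "\<alpha> < 1"
  shows "invertible (mat 1 - \<alpha> *\<^sub>R (Q ** M))"
  unfolding invertible_left_inverse matrix_left_invertible_ker
proof (intro allI impI)
  fix x assume "(mat 1 - \<alpha> *\<^sub>R (Q ** M)) *v x = 0"
  then have "x = 0 + \<alpha> *\<^sub>R (Q *v (M *v x))"
    by (simp add: matrix_vector_mult_diff_rdistrib matrix_vector_mul_assoc scaleR_matrix_vector_assoc)
  from discounted_fixpoint_bound[OF assms this] show "x = 0" by simp
qed

lemma matrix_inv_inverse:
  fixes A :: "real^'n^'n"
  assumes "invertible A"
  shows "A ** matrix_inv A = mat 1" "matrix_inv A ** A = mat 1"
  using someI_ex[OF assms[unfolded invertible_def]] unfolding matrix_inv_def by blast+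

lemma matrix_inv_mult_vec_eq_iff:
  fixes A :: "real^'n^'n"
  assumes "invertible A"
  shows "matrix_inv A *v b = x \<longleftrightarrow> A *v x = b"
proof
  assume "matrix_inv A *v b = x"
  then have "x = matrix_inv A *v b" by simp
  then show "A *v x = b"
    by (simp add: matrix_vector_mul_assoc matrix_inv_inverse[OF assms])
next
  assume "A *v x = b"
  then have "b = A *v x" by simp
  then show "matrix_inv A *v b = x"
    by (simp add: matrix_vector_mul_assoc matrix_inv_inverse[OF assms])
qed

lemma discounted_inverse_fixpoint:
  fixes Q :: "real^'m^'d" and M :: "real^'d^'m"
  assumes "substochastic Q" "substochastic M" "0 \<le> \<alpha>" "\<alpha> < 1"
    and y: "y = matrix_inv (mat 1 - \<alpha> *\<^sub>R (Q ** M)) *v b"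
  shows "y = b + \<alpha> *\<^sub>R (Q *v (M *v y))"
proof -
  have "(mat 1 - \<alpha> *\<^sub>R (Q ** M)) *v y = b"
    using y matrix_inv_mult_vec_eq_iff[OF invertible_discounted[OF assms(1-4)]] by blast
  then show ?thesis
    by (simp add: matrix_vector_mult_diff_rdistrib matrix_vector_mul_assoc scaleR_matrix_vector_assoc
        algebra_simps)
qed

text \<open>The Bellman equation of a fixed policy. Values are compared below by subtracting two
  instances of it and bounding the solution of the resulting fixed-point equation.\<close>

lemma value_fun_fixpoint:
  assumes "substochastic M" "0 \<le> \<alpha>" "\<alpha> < 1"
  shows "value_fun \<alpha> gt M \<pi>
    = policy_matrix \<pi> *v gt + \<alpha> *\<^sub>R (policy_matrix \<pi> *v (M *v value_fun \<alpha> gt M \<pi>))"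
  by (rule discounted_inverse_fixpoint[OF substochastic_policy_matrix assms])
    (simp add: value_fun_def expected_reward_eq)

section \<open>Measurability of value functions\<close>

lemma borel_measurable_vecI:
  fixes f :: "'a \<Rightarrow> 'b::euclidean_space^'n"
  assumes "\<And>i. (\<lambda>x. f x $ i) \<in> borel_measurable M"
  shows "f \<in> borel_measurable M"
  unfolding borel_measurable_euclidean_space[of f]
proof
  fix b :: "'b^'n" assume "b \<in> Basis"
  then obtain i u where "b = axis i u" "u \<in> Basis" by (auto simp: Basis_vec_def)
  then have "(\<lambda>x. f x \<bullet> b) = (\<lambda>x. f x $ i \<bullet> u)" by (simp add: inner_axis)
  then show "(\<lambda>x. f x \<bullet> b) \<in> borel_measurable M"
    using assms[of i] by simp
qed

lemma borel_measurable_matrix_nth: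
  fixes f :: "'a \<Rightarrow> real^'n^'m"
  assumes "f \<in> borel_measurable M"
  shows "(\<lambda>x. f x $ i $ j) \<in> borel_measurable M"
proof -
  have "(\<lambda>A :: real^'n^'m. A $ i $ j) \<in> borel_measurable borel"
    by (intro borel_measurable_continuous_onI continuous_intros)
  from measurable_compose[OF assms this] show ?thesis .
qed

lemma borel_measurable_det:
  fixes A :: "'a \<Rightarrow> real^'n^'n"
  assumes [measurable]: "\<And>i j. (\<lambda>x. A x $ i $ j) \<in> borel_measurable M"
  shows "(\<lambda>x. det (A x)) \<in> borel_measurable M"
  unfolding det_def by measurable

text \<open>Cramer's rule writes each coordinate as a quotient of determinants, which are
  polynomials in the matrix entries; this bypasses measurability of
  \<open>matrix_inv\<close>.\<close>

lemma borel_measurable_value_fun: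
  fixes M' :: "'w \<Rightarrow> real^'d^('d::finite \<times> 'k::finite)"
  assumes Q: "(\<lambda>\<omega>. policy_matrix (\<pi> \<omega>)) \<in> borel_measurable P"
    and M': "M' \<in> borel_measurable P"
    and sub: "\<And>\<omega>. substochastic (M' \<omega>)" and \<alpha>: "0 \<le> \<alpha>" "\<alpha> < 1"
  shows "(\<lambda>\<omega>. value_fun \<alpha> gt (M' \<omega>) (\<pi> \<omega>)) \<in> borel_measurable P"
proof (rule borel_measurable_vecI)
  fix k
  define A where "A \<omega> = mat 1 - \<alpha> *\<^sub>R (policy_matrix (\<pi> \<omega>) ** M' \<omega>)" for \<omega>
  define b where "b \<omega> = policy_matrix (\<pi> \<omega>) *v gt" for \<omega>
  note [measurable] = borel_measurable_matrix_nth[OF Q] borel_measurable_matrix_nth[OF M']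
  have [measurable]: "(\<lambda>\<omega>. A \<omega> $ i $ j) \<in> borel_measurable P" for i j
    unfolding A_def matrix_matrix_mult_def by simp
  have [measurable]: "(\<lambda>\<omega>. b \<omega> $ i) \<in> borel_measurable P" for i
    unfolding b_def matrix_vector_mult_def by simp
  have "value_fun \<alpha> gt (M' \<omega>) (\<pi> \<omega>) $ k
      = det (\<chi> i j. if j = k then b \<omega> $ i else A \<omega> $ i $ j) / det (A \<omega>)" for \<omega>
  proof -
    have inv: "invertible (A \<omega>)"
      unfolding A_def using invertible_discounted substochastic_policy_matrix sub \<alpha> by blast
    have "A \<omega> *v value_fun \<alpha> gt (M' \<omega>) (\<pi> \<omega>) = b \<omega>"
      using matrix_inv_mult_vec_eq_iff[OF inv, of "b \<omega>"]
      unfolding value_fun_def A_def b_def expected_reward_eq by blast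
    moreover have "det (A \<omega>) \<noteq> 0" using inv invertible_det_nz by blast
    ultimately show ?thesis using cramer[of "A \<omega>" _ "b \<omega>"] by simp
  qed
  moreover have "(\<lambda>\<omega>. det (\<chi> i j. if j = k then b \<omega> $ i else A \<omega> $ i $ j)) \<in> borel_measurable P"
    by (rule borel_measurable_det) (simp, measurable)
  moreover have "(\<lambda>\<omega>. det (A \<omega>)) \<in> borel_measurable P" by (rule borel_measurable_det) measurable
  ultimately show "(\<lambda>\<omega>. value_fun \<alpha> gt (M' \<omega>) (\<pi> \<omega>) $ k) \<in> borel_measurable P" by simp
qed

text \<open>Obtained by differentiating the Bellman equation in the transition matrix, in direction
  \<open>D\<close>, with the policy held fixed.\<close>

definition value_derivative ::
  "real \<Rightarrow> real^('d \<times> 'k) \<Rightarrow> real^'d^('d \<times> 'k) \<Rightarrow> ('d::finite \<Rightarrow> 'k::finite pmf)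
     \<Rightarrow> real^'d^('d \<times> 'k) \<Rightarrow> real^'d" where
  "value_derivative \<alpha> gt M \<pi> D =
     matrix_inv (mat 1 - \<alpha> *\<^sub>R (policy_matrix \<pi> ** M))
       *v (\<alpha> *\<^sub>R (policy_matrix \<pi> *v (D *v value_fun \<alpha> gt M \<pi>)))"

lemma linear_value_derivative: "linear (value_derivative \<alpha> gt M \<pi>)"
  by (rule linearI) (simp_all add: value_derivative_def matrix_vector_mult_add_rdistrib
    scaleR_matrix_vector_assoc[symmetric] algebra_simps)

lemma norm_mult_mult_diff_le:
  fixes Q Q' :: "real^'m^'d" and A A' :: "real^'n^'m"
  assumes "norm Q \<le> c" "norm A' \<le> c"
  shows "norm (Q' *v (A' *v x) - Q *v (A *v x)) \<le> c * (norm (Q' - Q) + norm (A' - A)) * norm x"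
proof -
  have "Q' *v (A' *v x) - Q *v (A *v x) = (Q' - Q) *v (A' *v x) + Q *v ((A' - A) *v x)"
    by (simp add: matrix_vector_mult_diff_rdistrib matrix_vector_mult_diff_distrib)
  also have "norm \<dots> \<le> norm (Q' - Q) * (norm A' * norm x) + norm Q * (norm (A' - A) * norm x)"
    by (intro order_trans[OF norm_triangle_ineq] add_mono
        order_trans[OF norm_matrix_vector_mult_le] mult_left_mono norm_matrix_vector_mult_le norm_ge_zero)
  also have "\<dots> \<le> norm (Q' - Q) * (c * norm x) + c * (norm (A' - A) * norm x)"
    using assms by (intro add_mono mult_left_mono mult_right_mono) auto
  finally show ?thesis by (simp add: algebra_simps)
qed

section \<open>Perturbation of values and stability of the optimal policy\<close>

context
  fixes \<alpha> :: real and gt :: "real^('d::finite \<times> 'k::finite)" and M :: "real^'d^('d \<times> 'k)"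
  assumes \<alpha>: "0 \<le> \<alpha>" "\<alpha> < 1" and M: "substochastic M"
begin

text \<open>A single constant dominating the resolvent, policy and transition matrices, reward and
  values, so that estimates become powers of it; the entry 1 makes these powers increasing.\<close>

definition value_bound where "value_bound = Max {1, real CARD('d) / (1 - \<alpha>), CARD('d) * CARD('d \<times> 'k), norm gt,
  CARD('d) / (1 - \<alpha>) * (CARD('d) * CARD('d \<times> 'k)) * norm gt}"

lemma value_bound_ge: "1 \<le> value_bound" "CARD('d) / (1 - \<alpha>) \<le> value_bound" "CARD('d) * CARD('d \<times> 'k) \<le> value_bound" "norm gt \<le> value_bound"
  "CARD('d) / (1 - \<alpha>) * (CARD('d) * CARD('d \<times> 'k)) * norm gt \<le> value_bound"
  unfolding value_bound_def by (rule Max_ge; simp)+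

lemma fixpoint_norm_le:
  fixes M' :: "real^'d^('d \<times> 'k)"
  assumes "substochastic M'" "y = r + \<alpha> *\<^sub>R (policy_matrix \<pi> *v (M' *v y))" "norm r \<le> c"
  shows "norm y \<le> value_bound * c"
  using discounted_fixpoint_bound[OF substochastic_policy_matrix assms(1) \<alpha> assms(2)] value_bound_ge(1,2) assms(3)
  by (smt (verit) mult_mono norm_ge_zero)

lemma norm_policy_transition_le:
  shows "norm (policy_matrix \<pi> :: real^('d \<times> 'k)^'d) \<le> value_bound" and
   "substochastic M' \<Longrightarrow> norm (M' :: real^'d^('d \<times> 'k)) \<le> value_bound"
proof -
  show "norm (policy_matrix \<pi> :: real^('d \<times> 'k)^'d) \<le> value_bound"
    using norm_policy_matrix_le value_bound_ge(3) order_trans by blast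
  show "norm (M' :: real^'d^('d \<times> 'k)) \<le> value_bound" if "substochastic M'"
    using norm_matrix_le_card[of M', OF substochastic_nth_le[OF that]] value_bound_ge(3) by (simp add: mult.commute)
qed

lemma norm_value_fun_le:
  assumes "substochastic M'"
  shows "norm (value_fun \<alpha> gt M' \<pi>) \<le> value_bound"
proof -
  have "norm (policy_matrix \<pi> *v gt) \<le> CARD('d) * CARD('d \<times> 'k) * norm gt"
    by (intro order_trans[OF norm_matrix_vector_mult_le] mult_right_mono norm_policy_matrix_le) auto
  then have "norm (value_fun \<alpha> gt M' \<pi>) \<le> CARD('d) / (1 - \<alpha>) * (CARD('d) * CARD('d \<times> 'k) * norm gt)"
    using \<alpha> by (intro order_trans[OF discounted_fixpoint_bound[OF substochastic_policy_matrix assms \<alpha>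
      value_fun_fixpoint[OF assms \<alpha>]]] mult_left_mono) auto
  also have "\<dots> \<le> value_bound" using value_bound_ge(5) by (simp add: mult.assoc)
  finally show ?thesis .
qed

text \<open>The difference of the values solves the fixed-point equation of \<open>\<pi>'\<close>
  with source \<open>(Q' - Q)\<close> applied to \<open>gt + \<alpha> *\<^sub>R (M *v V)\<close>.
  That vector has norm at most twice the square of \<open>value_bound\<close>, and solving the
  equation costs one more power.\<close>

lemma value_fun_lipschitz_policy:
  "norm (value_fun \<alpha> gt M \<pi>' - value_fun \<alpha> gt M \<pi>)
     \<le> 2 * value_bound ^ 3 * norm (policy_matrix \<pi>' - policy_matrix \<pi> :: real^('d \<times> 'k)^'d)"
proof -
  let ?V = "value_fun \<alpha> gt M \<pi>" and ?V' = "value_fun \<alpha> gt M \<pi>'"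
  let ?Q = "policy_matrix \<pi>" and ?Q' = "policy_matrix \<pi>'"
  let ?r = "(?Q' - ?Q) *v (gt + \<alpha> *\<^sub>R (M *v ?V))"
  have eq: "?V' - ?V = ?r + \<alpha> *\<^sub>R (?Q' *v (M *v (?V' - ?V)))"
    by (subst value_fun_fixpoint[OF M \<alpha>], subst value_fun_fixpoint[OF M \<alpha>, of _ \<pi>])
      (simp add: matrix_vector_mult_diff_rdistrib matrix_vector_mult_diff_distrib
        matrix_vector_right_distrib matrix_vector_mult_scaleR scaleR_diff_right)
  have "norm (gt + \<alpha> *\<^sub>R (M *v ?V)) \<le> norm gt + norm (\<alpha> *\<^sub>R (M *v ?V))" by (rule norm_triangle_ineq)
  also have "norm (\<alpha> *\<^sub>R (M *v ?V)) \<le> 1 * norm (M *v ?V)"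
    unfolding norm_scaleR using \<alpha> by (intro mult_right_mono) auto
  also have "\<dots> \<le> value_bound * value_bound"
    using norm_matrix_vector_mult_le[of M ?V]
      mult_mono[OF norm_policy_transition_le(2)[OF M] norm_value_fun_le[OF M], of \<pi>] value_bound_ge(1) by simp
  finally have "norm (gt + \<alpha> *\<^sub>R (M *v ?V)) \<le> 2 * value_bound ^ 2"
    using value_bound_ge(1,4) mult_left_mono[of 1 value_bound value_bound] unfolding power2_eq_square by linarith
  then have "norm ?r \<le> norm (?Q' - ?Q) * (2 * value_bound ^ 2)"
    by (intro order_trans[OF norm_matrix_vector_mult_le] mult_left_mono) auto
  from fixpoint_norm_le[OF M eq this] show ?thesis by (simp add: power_numeral_reduce algebra_simps)
qed

text \<open>An exact identity: the source is linear in \<open>M' - M\<close> and uses the old value,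
  while the new matrix appears only in the contraction.\<close>

lemma value_fun_diff_fixpoint:
  assumes M': "substochastic M'"
  shows "value_fun \<alpha> gt M' \<pi> - value_fun \<alpha> gt M \<pi>
    = \<alpha> *\<^sub>R (policy_matrix \<pi> *v ((M' - M) *v value_fun \<alpha> gt M \<pi>))
    + \<alpha> *\<^sub>R (policy_matrix \<pi> *v (M' *v (value_fun \<alpha> gt M' \<pi> - value_fun \<alpha> gt M \<pi>)))"
proof -
  define V V' where "V = value_fun \<alpha> gt M \<pi>" and "V' = value_fun \<alpha> gt M' \<pi>"
  have "V' - V = \<alpha> *\<^sub>R (policy_matrix \<pi> *v (M' *v V')) - \<alpha> *\<^sub>R (policy_matrix \<pi> *v (M *v V))"
    using value_fun_fixpoint[OF M \<alpha>, of gt \<pi>] value_fun_fixpoint[OF M' \<alpha>, of gt \<pi>]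
    unfolding V_def[symmetric] V'_def[symmetric] by (metis add_diff_cancel_left)
  also have "\<dots> = \<alpha> *\<^sub>R (policy_matrix \<pi> *v ((M' - M) *v V)) + \<alpha> *\<^sub>R (policy_matrix \<pi> *v (M' *v (V' - V)))"
    by (simp add: matrix_vector_mult_diff_rdistrib matrix_vector_mult_diff_distrib scaleR_diff_right)
  finally show ?thesis unfolding V_def V'_def .
qed

lemma value_fun_lipschitz_transition:
  assumes M': "substochastic M'"
  shows "norm (value_fun \<alpha> gt M' \<pi> - value_fun \<alpha> gt M \<pi>) \<le> value_bound ^ 3 * norm (M' - M)"
proof -
  let ?V = "value_fun \<alpha> gt M \<pi>"
  have "norm (\<alpha> *\<^sub>R (policy_matrix \<pi> *v ((M' - M) *v ?V))) \<le> 1 * (value_bound * (norm (M' - M) * value_bound))"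
    unfolding norm_scaleR using \<alpha> value_bound_ge(1)
    by (intro mult_mono order_trans[OF norm_matrix_vector_mult_le] norm_policy_transition_le norm_value_fun_le M) auto
  from fixpoint_norm_le[OF M' value_fun_diff_fixpoint[OF M'] this]
  show ?thesis by (simp add: power_numeral_reduce algebra_simps)
qed

lemma value_derivative_fixpoint:
  "value_derivative \<alpha> gt M \<pi> D = \<alpha> *\<^sub>R (policy_matrix \<pi> *v (D *v value_fun \<alpha> gt M \<pi>))
    + \<alpha> *\<^sub>R (policy_matrix \<pi> *v (M *v value_derivative \<alpha> gt M \<pi> D))"
  by (rule discounted_inverse_fixpoint[OF substochastic_policy_matrix M \<alpha>]) (simp add: value_derivative_def)

text \<open>The increment is taken at \<open>\<pi>'\<close> but the derivative at
  \<open>\<pi>\<close>. Their difference \<open>y - z\<close> solves the fixed-point equation of the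
  pair \<open>(\<pi>', M')\<close>, with sources \<open>r1\<close>, from the change of policy and
  value in the first-order term, and \<open>r2\<close>, from the change of the contraction acting on
  \<open>z\<close>. Both are products of \<open>norm D\<close> and the total change
  \<open>e\<close>.\<close>

lemma value_fun_expansion_uniform:
  assumes M': "substochastic M'"
  shows "norm (value_fun \<alpha> gt M' \<pi>' - value_fun \<alpha> gt M \<pi>' - value_derivative \<alpha> gt M \<pi> (M' - M))
    \<le> 5 * value_bound ^ 6 * norm (M' - M) * (norm (policy_matrix \<pi>' - policy_matrix \<pi> :: real^('d \<times> 'k)^'d) + norm (M' - M))"
proof -
  define Q where "Q = (policy_matrix \<pi> :: real^('d \<times> 'k)^'d)"
  define Q' where "Q' = (policy_matrix \<pi>' :: real^('d \<times> 'k)^'d)"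
  define V where "V = value_fun \<alpha> gt M \<pi>"
  define V1 where "V1 = value_fun \<alpha> gt M \<pi>'"
  define y where "y = value_fun \<alpha> gt M' \<pi>' - V1"
  define D where "D = M' - M"
  define z where "z = value_derivative \<alpha> gt M \<pi> D"
  define r1 where "r1 = \<alpha> *\<^sub>R (Q' *v (D *v V1) - Q *v (D *v V))"
  define r2 where "r2 = \<alpha> *\<^sub>R (Q' *v (M' *v z) - Q *v (M *v z))"
  define e where "e = norm (Q' - Q) + norm D"
  have ye: "y = \<alpha> *\<^sub>R (Q' *v (D *v V1)) + \<alpha> *\<^sub>R (Q' *v (M' *v y))"
    unfolding y_def V1_def Q'_def D_def by (rule value_fun_diff_fixpoint[OF M'])
  have ze: "z = \<alpha> *\<^sub>R (Q *v (D *v V)) + \<alpha> *\<^sub>R (Q *v (M *v z))"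
    unfolding z_def Q_def V_def by (rule value_derivative_fixpoint)
  have eq: "y - z = (r1 + r2) + \<alpha> *\<^sub>R (Q' *v (M' *v (y - z)))"
    by (subst ye, subst ze)
      (simp add: r1_def r2_def matrix_vector_mult_diff_distrib scaleR_diff_right)
  have \<alpha>le: "norm (\<alpha> *\<^sub>R x) \<le> norm x" for x :: "real^'d"
    using \<alpha> by (simp add: mult_left_le_one_le)
  have l1: "1 \<le> value_bound" by (rule value_bound_ge)
  have nV: "norm V \<le> value_bound" "norm V1 \<le> value_bound" by (simp_all add: V_def V1_def norm_value_fun_le M)
  have nQ: "norm Q \<le> value_bound" "norm Q' \<le> value_bound" by (simp_all add: Q_def Q'_def norm_policy_transition_le)
  have nM: "norm M' \<le> value_bound" using M' by (rule norm_policy_transition_le)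
  have e0: "0 \<le> e" by (simp add: e_def)
  have "norm (\<alpha> *\<^sub>R (Q *v (D *v V))) \<le> value_bound * (norm D * value_bound)"
    by (rule order_trans[OF \<alpha>le], rule order_trans[OF norm_matrix_vector_mult_le], rule mult_mono,
        rule nQ, rule order_trans[OF norm_matrix_vector_mult_le], rule mult_left_mono, rule nV)
      (use l1 in auto)
  from fixpoint_norm_le[OF M ze[unfolded Q_def] this[unfolded Q_def]]
  have nz: "norm z \<le> value_bound ^ 3 * norm D" by (simp add: Q_def power_numeral_reduce algebra_simps)
  have "norm r1 \<le> norm (Q' *v (D *v V1) - Q *v (D *v V))" unfolding r1_def by (rule \<alpha>le)
  also have "Q' *v (D *v V1) - Q *v (D *v V) = (Q' - Q) *v (D *v V1) + Q *v (D *v (V1 - V))"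
    by (simp add: matrix_vector_mult_diff_rdistrib matrix_vector_mult_diff_distrib)
  also have "norm \<dots> \<le> norm (Q' - Q) * (norm D * value_bound) + value_bound * (norm D * (2 * value_bound ^ 3 * norm (Q' - Q)))"
    using value_fun_lipschitz_policy[of \<pi>' \<pi>] l1 nQ nV
    by (intro order_trans[OF norm_triangle_ineq] add_mono order_trans[OF norm_matrix_vector_mult_le]
        mult_mono norm_ge_zero mult_nonneg_nonneg order_refl)
      (auto simp: V_def V1_def Q_def Q'_def)
  also have "\<dots> = (value_bound + 2 * value_bound ^ 4) * (norm D * norm (Q' - Q))"
    by (simp add: power_numeral_reduce algebra_simps)
  \<comment> \<open>Since \<open>value_bound\<close> is at least 1, its first power is absorbed into
    the fourth, giving 1 + 2 = 3.\<close>
  also have "\<dots> \<le> (3 * value_bound ^ 4) * (norm D * e)"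
    using l1 self_le_power[of value_bound 4] unfolding e_def by (intro mult_mono) auto
  finally have r1: "norm r1 \<le> (3 * value_bound ^ 4) * (norm D * e)" .
  have "norm r2 \<le> value_bound * e * norm z"
    unfolding r2_def e_def D_def by (rule order_trans[OF \<alpha>le]) (rule norm_mult_mult_diff_le[OF nQ(1) nM])
  also have "\<dots> \<le> value_bound * e * (value_bound ^ 3 * norm D)"
    using l1 e0 nz by (intro mult_left_mono) auto
  also have "\<dots> = value_bound ^ 4 * (norm D * e)" by (simp add: power_numeral_reduce algebra_simps)
  finally have "norm r2 \<le> value_bound ^ 4 * (norm D * e)" .
  with r1 have "norm (r1 + r2) \<le> 4 * value_bound ^ 4 * (norm D * e)"
    using norm_triangle_ineq[of r1 r2] by simp
  from fixpoint_norm_le[OF M' eq[unfolded Q'_def] this]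
  have "norm (y - z) \<le> 4 * value_bound ^ 5 * (norm D * e)" by (simp add: power_numeral_reduce algebra_simps)
  also have "\<dots> \<le> 5 * value_bound ^ 6 * (norm D * e)"
    using l1 e0 by (intro mult_right_mono mult_mono power_increasing) auto
  finally show ?thesis
    by (simp add: y_def z_def D_def e_def V1_def Q_def Q'_def mult.assoc)
qed

text \<open>Optimality of \<open>\<pi>'\<close> under \<open>M'\<close> gives the lower bound in
  each coordinate and optimality of \<open>\<pi>\<close> under \<open>M\<close> the upper one; both
  sides have the same linear term by the uniform expansion. The constant does not depend on
  \<open>M'\<close> or \<open>\<pi>'\<close>, so it can be used with random arguments.\<close>

lemma value_fun_optimal_expansion:
  assumes opt: "optimal_policy \<alpha> gt M \<pi>"
  shows "\<exists>K\<ge>0. \<forall>M' \<pi>'. substochastic M' \<longrightarrow> optimal_policy \<alpha> gt M' \<pi>' \<longrightarrow>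
    norm (value_fun \<alpha> gt M' \<pi>' - value_fun \<alpha> gt M \<pi> - value_derivative \<alpha> gt M \<pi> (M' - M))
    \<le> K * norm (M' - M) * (norm (policy_matrix \<pi>' - policy_matrix \<pi> :: real^('d \<times> 'k)^'d) + norm (M' - M))"
proof (intro exI[of _ "CARD('d) * (5 * value_bound ^ 6)"] conjI allI impI)
  show "0 \<le> CARD('d) * (5 * value_bound ^ 6)" using value_bound_ge(1) by simp
next
  fix M' \<pi>' assume M': "substochastic M'" and opt': "optimal_policy \<alpha> gt M' \<pi>'"
  define z where "z = value_derivative \<alpha> gt M \<pi> (M' - M)"
  define E where "E = 5 * value_bound ^ 6 * norm (M' - M) *
    (norm (policy_matrix \<pi>' - policy_matrix \<pi> :: real^('d \<times> 'k)^'d) + norm (M' - M))"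
  let ?V = "value_fun \<alpha> gt"
  have "norm (?V M' \<pi> - ?V M \<pi> - z) \<le> 5 * value_bound ^ 6 * norm (M' - M) * (0 + norm (M' - M))"
    using value_fun_expansion_uniform[OF M', of \<pi> \<pi>] by (simp add: z_def)
  also have "\<dots> \<le> E"
    unfolding E_def using value_bound_ge(1) by (intro mult_left_mono) auto
  finally have lower: "norm (?V M' \<pi> - ?V M \<pi> - z) \<le> E" .
  have upper: "norm (?V M' \<pi>' - ?V M \<pi>' - z) \<le> E"
    unfolding E_def z_def by (rule value_fun_expansion_uniform[OF M'])
  have "\<bar>(?V M' \<pi>' - ?V M \<pi> - z) $ s\<bar> \<le> E" for s
  proof -
    have "?V M' \<pi> $ s \<le> ?V M' \<pi>' $ s" using opt' by (simp add: optimal_policy_def)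
    moreover have "?V M \<pi>' $ s \<le> ?V M \<pi> $ s" using opt by (simp add: optimal_policy_def)
    moreover have "\<bar>(?V M' \<pi> - ?V M \<pi> - z) $ s\<bar> \<le> E" "\<bar>(?V M' \<pi>' - ?V M \<pi>' - z) $ s\<bar> \<le> E"
      by (rule order_trans[OF component_le_norm_cart], rule lower upper)+
    ultimately show ?thesis unfolding vector_minus_component by linarith
  qed
  then have "norm (?V M' \<pi>' - ?V M \<pi> - z) \<le> (\<Sum>s\<in>(UNIV::'d set). E)"
    by (intro order_trans[OF norm_le_l1_cart] sum_mono)
  then show "norm (?V M' \<pi>' - ?V M \<pi> - value_derivative \<alpha> gt M \<pi> (M' - M))
    \<le> CARD('d) * (5 * value_bound ^ 6) * norm (M' - M) *
      (norm (policy_matrix \<pi>' - policy_matrix \<pi> :: real^('d \<times> 'k)^'d) + norm (M' - M))"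
    by (simp add: z_def E_def mult.assoc)
qed

text \<open>Policies at distance at least \<open>\<epsilon>\<close> form a compact set, on which the
  value at one state attains its maximum; by strictness this lies a positive gap \<open>g\<close>
  below the optimum. Small changes of the transition matrix cannot bridge the gap.\<close>

lemma optimal_policy_stable:
  assumes strict: "\<And>\<pi>' s. policy_matrix \<pi>' \<noteq> policy_matrix \<pi> \<Longrightarrow>
      value_fun \<alpha> gt M \<pi>' $ s < value_fun \<alpha> gt M \<pi> $ s"
    and \<epsilon>: "0 < \<epsilon>"
  shows "\<exists>\<delta>>0. \<forall>M' \<pi>'. substochastic M' \<longrightarrow> optimal_policy \<alpha> gt M' \<pi>' \<longrightarrow> norm (M' - M) \<le> \<delta> \<longrightarrow>
    norm (policy_matrix \<pi>' - policy_matrix \<pi> :: real^('d \<times> 'k)^'d) < \<epsilon>"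
proof -
  fix s :: 'd
  let ?V = "value_fun \<alpha> gt"
  \<comment> \<open>The value at \<open>s\<close> regarded as a function of the policy matrix. The
    choice of preimage is immaterial: by the Lipschitz bound, equal matrices have equal
    values.\<close>
  define f where "f Q = ?V M (SOME \<pi>'. policy_matrix \<pi>' = Q) $ s" for Q
  have lips: "\<bar>?V M \<pi>1 $ s - ?V M \<pi>2 $ s\<bar> \<le>
      2 * value_bound ^ 3 * norm (policy_matrix \<pi>1 - policy_matrix \<pi>2 :: real^('d \<times> 'k)^'d)" for \<pi>1 \<pi>2
    using order_trans[OF component_le_norm_cart value_fun_lipschitz_policy, of \<pi>1 \<pi>2 s]
    by simp
  have f: "f (policy_matrix \<pi>') = ?V M \<pi>' $ s" for \<pi>'
  proof -
    have "policy_matrix (SOME \<pi>''. policy_matrix \<pi>'' = policy_matrix \<pi>') = policy_matrix \<pi>'"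
      by (rule someI[where x = \<pi>']) simp
    then show ?thesis using lips[of "SOME \<pi>''. policy_matrix \<pi>'' = policy_matrix \<pi>'" \<pi>'] by (simp add: f_def)
  qed
  define S where "S = range policy_matrix \<inter> {Q :: real^('d \<times> 'k)^'d. \<epsilon> \<le> norm (Q - policy_matrix \<pi>)}"
  have "compact S"
    unfolding S_def by (intro compact_Int_closed compact_range_policy_matrix closed_Collect_le continuous_intros)
  have "continuous_on S f"
  proof (rule lipschitz_on_continuous_on)
    show "(2 * value_bound ^ 3)-lipschitz_on S f"
      by (rule lipschitz_onI) (use lips value_bound_ge(1) in \<open>auto simp: S_def f dist_norm\<close>)
  qed
  show ?thesis
  proof (cases "S = {}")
    case True
    then have "policy_matrix \<pi>' \<notin> S" for \<pi>' by simp
    then have "norm (policy_matrix \<pi>' - policy_matrix \<pi> :: real^('d \<times> 'k)^'d) < \<epsilon>" for \<pi>'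
      by (simp add: S_def not_le[symmetric])
    then show ?thesis by (intro exI[of _ 1]) auto
  next
    case False
    from continuous_attains_sup[OF \<open>compact S\<close> False \<open>continuous_on S f\<close>]
    obtain Q where Q: "Q \<in> S" "\<And>Q'. Q' \<in> S \<Longrightarrow> f Q' \<le> f Q" by auto
    obtain \<pi>Q where \<pi>Q: "Q = policy_matrix \<pi>Q" using Q by (auto simp: S_def)
    define g where "g = ?V M \<pi> $ s - f Q"
    have "Q \<noteq> policy_matrix \<pi>" using Q \<epsilon> by (auto simp: S_def)
    then have g: "0 < g" using strict[of \<pi>Q s] by (simp add: g_def \<pi>Q f)
    have l3: "0 < value_bound ^ 3" using value_bound_ge(1) by simp
    \<comment> \<open>Within this radius every value moves by at most \<open>g / 3\<close>. The
      comparison uses two values, one for each policy, so at most \<open>2 * g / 3\<close> of the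
      gap is lost.\<close>
    show ?thesis
    proof (intro exI[of _ "g / (3 * value_bound ^ 3)"] conjI allI impI)
      show "0 < g / (3 * value_bound ^ 3)" using g l3 by simp
    next
      fix M' \<pi>' assume M': "substochastic M'" and opt': "optimal_policy \<alpha> gt M' \<pi>'"
        and close: "norm (M' - M) \<le> g / (3 * value_bound ^ 3)"
      have "value_bound ^ 3 * norm (M' - M) \<le> g / 3"
        using mult_left_mono[OF close, of "value_bound ^ 3"] l3 by simp
      then have d: "\<bar>?V M' \<pi>'' $ s - ?V M \<pi>'' $ s\<bar> \<le> g / 3" for \<pi>''
        using order_trans[OF component_le_norm_cart value_fun_lipschitz_transition[OF M'], of \<pi>'' s]
        by simp
      have "?V M' \<pi> $ s \<le> ?V M' \<pi>' $ s" using opt' by (simp add: optimal_policy_def)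
      then have "f Q < f (policy_matrix \<pi>')"
        using d[of \<pi>, THEN abs_le_D2] d[of \<pi>', THEN abs_le_D1] g unfolding f g_def by argo
      then have "policy_matrix \<pi>' \<notin> S" using Q(2) by (meson not_le)
      then show "norm (policy_matrix \<pi>' - policy_matrix \<pi> :: real^('d \<times> 'k)^'d) < \<epsilon>"
        by (auto simp: S_def)
    qed
  qed
qed

end

section \<open>Convergence in distribution from characteristic functions\<close>

text \<open>The functions whose integrals are linear combinations of real and imaginary parts of
  characteristic functions.\<close>

inductive trig_poly :: "(real^'n \<Rightarrow> real) \<Rightarrow> bool" where
  cos: "trig_poly (\<lambda>x. c * cos (u \<bullet> x))"
| sin: "trig_poly (\<lambda>x. c * sin (u \<bullet> x))"
| add: "trig_poly f \<Longrightarrow> trig_poly g \<Longrightarrow> trig_poly (\<lambda>x. f x + g x)"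

section \<open>Approximation by trigonometric polynomials\<close>

lemma trig_poly_const: "trig_poly (\<lambda>x. c)"
  using trig_poly.cos[of c 0] by simp

lemma trig_poly_sum:
  assumes "finite I" "\<And>i. i \<in> I \<Longrightarrow> trig_poly (f i)"
  shows "trig_poly (\<lambda>x. \<Sum>i\<in>I. f i x)"
  using assms by (induction I rule: finite_induct) (auto intro: trig_poly.add trig_poly_const)

text \<open>The product-to-sum formulas keep the class closed under multiplication, so it is an
  algebra.\<close>

lemma trig_poly_mult_cos: "trig_poly f \<Longrightarrow> trig_poly (\<lambda>x. f x * (c * cos (v \<bullet> x)))"
proof (induction f rule: trig_poly.induct)
  case (cos b u)
  have eq: "(\<lambda>x. b * cos (u \<bullet> x) * (c * cos (v \<bullet> x)))
      = (\<lambda>x. b * c / 2 * cos ((u - v) \<bullet> x) + b * c / 2 * cos ((u + v) \<bullet> x))"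
    by (simp add: inner_diff_left inner_add_left cos_diff cos_add algebra_simps)
  show ?case unfolding eq by (rule trig_poly.add trig_poly.cos trig_poly.sin)+
next
  case (sin b u)
  have eq: "(\<lambda>x. b * sin (u \<bullet> x) * (c * cos (v \<bullet> x)))
      = (\<lambda>x. b * c / 2 * sin ((u + v) \<bullet> x) + b * c / 2 * sin ((u - v) \<bullet> x))"
    by (simp add: inner_diff_left inner_add_left sin_diff sin_add algebra_simps)
  show ?case unfolding eq by (rule trig_poly.add trig_poly.cos trig_poly.sin)+
next
  case (add f g)
  then show ?case by (simp add: distrib_right trig_poly.add)
qed

lemma trig_poly_mult_sin: "trig_poly f \<Longrightarrow> trig_poly (\<lambda>x. f x * (c * sin (v \<bullet> x)))"
proof (induction f rule: trig_poly.induct)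
  case (cos b u)
  have eq: "(\<lambda>x. b * cos (u \<bullet> x) * (c * sin (v \<bullet> x)))
      = (\<lambda>x. b * c / 2 * sin ((u + v) \<bullet> x) + (- (b * c / 2)) * sin ((u - v) \<bullet> x))"
    by (simp add: inner_diff_left inner_add_left sin_diff sin_add algebra_simps)
  show ?case unfolding eq by (rule trig_poly.add trig_poly.cos trig_poly.sin)+
next
  case (sin b u)
  have eq: "(\<lambda>x. b * sin (u \<bullet> x) * (c * sin (v \<bullet> x)))
      = (\<lambda>x. b * c / 2 * cos ((u - v) \<bullet> x) + (- (b * c / 2)) * cos ((u + v) \<bullet> x))"
    by (simp add: inner_diff_left inner_add_left cos_diff cos_add algebra_simps)
  show ?case unfolding eq by (rule trig_poly.add trig_poly.cos trig_poly.sin)+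
next
  case (add f g)
  then show ?case by (simp add: distrib_right trig_poly.add)
qed

lemma trig_poly_mult: "trig_poly g \<Longrightarrow> trig_poly f \<Longrightarrow> trig_poly (\<lambda>x. f x * g x)"
  by (induction g rule: trig_poly.induct)
    (auto simp: distrib_left intro: trig_poly_mult_cos trig_poly_mult_sin trig_poly.add)

text \<open>Each substituted coordinate is itself a sine of a linear form, and the class is an
  algebra.\<close>

lemma trig_poly_polynomial_sin:
  fixes q :: "real^'n \<Rightarrow> real"
  assumes "real_polynomial_function q"
  shows "trig_poly (\<lambda>x. q (\<chi> i. L * sin (x $ i / L)))"
  using assms
proof (induction q rule: real_polynomial_function.induct)
  case (linear f)
  then interpret bounded_linear f .
  have "f (\<chi> i. L * sin (x $ i / L)) = (\<Sum>i\<in>UNIV. f (axis i 1) * L * sin (axis i (1 / L) \<bullet> x))" for x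
    by (subst basis_expansion[symmetric])
      (simp add: sum scaleR scalar_mult_eq_scaleR inner_axis' algebra_simps)
  then show ?case by (auto intro!: trig_poly_sum trig_poly.intros)
qed (auto intro: trig_poly_const trig_poly.add trig_poly_mult)

lemma trig_poly_bounded_continuous:
  "trig_poly g \<Longrightarrow> continuous_on UNIV g \<and> (\<exists>B. \<forall>x. \<bar>g x\<bar> \<le> B)"
proof (induction g rule: trig_poly.induct)
  case (cos c u)
  show ?case by (auto intro!: continuous_intros exI[of _ "\<bar>c\<bar>"] simp: abs_mult mult_left_le)
next
  case (sin c u)
  show ?case by (auto intro!: continuous_intros exI[of _ "\<bar>c\<bar>"] simp: abs_mult mult_left_le)
next
  case (add f g)
  then obtain B C where "\<And>x. \<bar>f x\<bar> \<le> B" "\<And>x. \<bar>g x\<bar> \<le> C" by auto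
  then have "\<bar>f x + g x\<bar> \<le> B + C" for x
    by (intro order_trans[OF abs_triangle_ineq] add_mono)
  with add show ?case by (auto intro!: continuous_intros)
qed

text \<open>The map \<open>x \<mapsto> L sin (x / L)\<close> is nearly the identity on a ball when \<open>L\<close> is large, and it takes values
  in a cube on which \<open>f\<close> is uniformly close to a polynomial; its composition with that polynomial is
  a trigonometric polynomial, close to \<open>f\<close> on the ball and bounded off it.\<close>

lemma continuous_near_trig_poly:
  fixes f :: "real^'n \<Rightarrow> real"
  assumes f: "continuous_on UNIV f" and K: "\<And>x. \<bar>f x\<bar> \<le> K" and \<epsilon>: "0 < \<epsilon>" and B: "0 \<le> B"
  obtains g where "trig_poly g"
    "\<And>x. \<bar>f x - g x\<bar> \<le> 2 * \<epsilon> + 2 * K * of_bool (B < norm x)"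
proof -
  have "uniformly_continuous_on (cball 0 (B + 1)) f"
    by (intro compact_uniformly_continuous continuous_on_subset[OF f]) auto
  from this[unfolded uniformly_continuous_on_def, rule_format, OF \<epsilon>]
  obtain \<delta>' where \<delta>': "0 < \<delta>'" "\<And>x y. x \<in> cball 0 (B + 1) \<Longrightarrow> y \<in> cball 0 (B + 1) \<Longrightarrow>
      dist y x < \<delta>' \<Longrightarrow> dist (f y) (f x) < \<epsilon>" by blast
  \<comment> \<open>The cap 1 keeps \<open>\<phi> x\<close> in the ball of radius
    \<open>B + 1\<close>, on which uniform continuity was invoked.\<close>
  define \<delta> where "\<delta> = min 1 \<delta>'"
  have \<delta>: "0 < \<delta>" "\<delta> \<le> 1" "\<delta> \<le> \<delta>'" using \<delta>' by (auto simp: \<delta>_def)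
  \<comment> \<open>Each coordinate of \<open>\<phi> x - x\<close> is at most
    \<open>B\<^sup>2 / (2 * L)\<close> on the ball of radius \<open>B\<close>; summed over
    \<open>CARD('n)\<close> coordinates this must stay below \<open>\<delta>\<close>. The summand 1
    keeps \<open>L\<close> positive when \<open>B = 0\<close>.\<close>
  define L where "L = CARD('n) * B\<^sup>2 / \<delta> + 1"
  have L: "1 \<le> L" using \<delta> B by (simp add: L_def)
  define \<phi> :: "real^'n \<Rightarrow> real^'n" where "\<phi> x = (\<chi> i. L * sin (x $ i / L))" for x
  have sin_le: "\<bar>sin t - t\<bar> \<le> t\<^sup>2 / 2" for t :: real
    using Maclaurin_sin_bound[of t 2] by (simp add: sin_coeff_def numeral_2_eq_2)
  have near: "norm (\<phi> x - x) < \<delta>" if x: "norm x \<le> B" for x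
  proof -
    have "\<bar>(\<phi> x - x) $ i\<bar> \<le> B\<^sup>2 / (2 * L)" for i
    proof -
      have "\<bar>(\<phi> x - x) $ i\<bar> = L * \<bar>sin (x $ i / L) - x $ i / L\<bar>"
        using L by (simp add: \<phi>_def abs_mult_pos' right_diff_distrib)
      also have "\<dots> \<le> L * ((x $ i / L)\<^sup>2 / 2)" using L by (intro mult_left_mono sin_le) auto
      also have "\<dots> = (x $ i)\<^sup>2 / (2 * L)" using L by (simp add: power2_eq_square field_simps)
      also have "\<dots> \<le> B\<^sup>2 / (2 * L)"
        using L order_trans[OF component_le_norm_cart x, of i] by (intro divide_right_mono abs_le_square_iff[THEN iffD1]) auto
      finally show ?thesis .
    qed
    then have "norm (\<phi> x - x) \<le> (\<Sum>i\<in>(UNIV::'n set). B\<^sup>2 / (2 * L))"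
      by (intro order_trans[OF norm_le_l1_cart] sum_mono)
    also have "\<dots> = CARD('n) * B\<^sup>2 / 2 / L" by simp
    also have "\<dots> < \<delta>"
    proof -
      have "\<delta> * L = CARD('n) * B\<^sup>2 + \<delta>" using \<delta> by (simp add: L_def field_simps)
      moreover have "0 \<le> CARD('n) * B\<^sup>2" by simp
      ultimately have "CARD('n) * B\<^sup>2 / 2 < \<delta> * L" using \<delta> by linarith
      then show ?thesis using L by (simp add: divide_less_eq)
    qed
    finally show ?thesis .
  qed
  have "\<phi> x \<in> cball 0 (CARD('n) * L)" for x
  proof -
    have "norm (\<phi> x) \<le> (\<Sum>i\<in>(UNIV::'n set). L)"
      using L by (intro order_trans[OF norm_le_l1_cart] sum_mono) (simp add: \<phi>_def abs_mult mult_left_le)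
    then show ?thesis by simp
  qed
  moreover obtain q where q: "real_polynomial_function q"
    "\<And>x. x \<in> cball 0 (CARD('n) * L) \<Longrightarrow> \<bar>f x - q x\<bar> < \<epsilon>"
    by (rule Stone_Weierstrass_real_polynomial_function[OF compact_cball continuous_on_subset[OF f subset_UNIV] \<epsilon>])
      blast
  ultimately have fq: "\<bar>f (\<phi> x) - q (\<phi> x)\<bar> < \<epsilon>" for x by blast
  have ff: "\<bar>f x - f (\<phi> x)\<bar> \<le> \<epsilon> + 2 * K * of_bool (B < norm x)" for x
  proof (cases "B < norm x")
    case True
    then show ?thesis using K[of x] K[of "\<phi> x"] \<epsilon> by auto
  next
    case False
    then have "norm x \<le> B" by simp
    from near[OF this] have n: "norm (\<phi> x - x) < \<delta>" .
    have "norm (\<phi> x) \<le> norm x + norm (\<phi> x - x)" using norm_triangle_sub by blast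
    then have "\<phi> x \<in> cball 0 (B + 1)" "x \<in> cball 0 (B + 1)"
      using n \<delta> \<open>norm x \<le> B\<close> by auto
    then have "dist (f (\<phi> x)) (f x) < \<epsilon>"
      using n \<delta> by (intro \<delta>') (auto simp: dist_norm)
    then show ?thesis using False by (simp add: dist_real_def abs_minus_commute)
  qed
  show ?thesis
  proof (rule that)
    show "trig_poly (\<lambda>x. q (\<phi> x))" unfolding \<phi>_def by (rule trig_poly_polynomial_sin[OF q(1)])
    show "\<bar>f x - q (\<phi> x)\<bar> \<le> 2 * \<epsilon> + 2 * K * of_bool (B < norm x)" for x
      using ff[of x] fq[of x] by linarith
  qed
qed

section \<open>Tightness and the continuity theorem\<close>

lemma (in prob_space) tight_single:
  fixes Z :: "'a \<Rightarrow> real^'n"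
  assumes [measurable]: "Z \<in> borel_measurable M" and "0 < \<epsilon>"
  shows "\<exists>B. prob {\<omega>\<in>space M. B < norm (Z \<omega>)} \<le> \<epsilon>"
proof -
  have "(\<lambda>k::nat. prob {\<omega>\<in>space M. real k < norm (Z \<omega>)})
      \<longlonglongrightarrow> prob (\<Inter>k::nat. {\<omega>\<in>space M. real k < norm (Z \<omega>)})"
    by (intro finite_Lim_measure_decseq) (auto simp: decseq_def)
  also have "(\<Inter>k::nat. {\<omega>\<in>space M. real k < norm (Z \<omega>)}) = {}"
    by auto (meson linorder_not_le real_arch_simple)
  finally have "(\<lambda>k::nat. prob {\<omega>\<in>space M. real k < norm (Z \<omega>)}) \<longlonglongrightarrow> 0" by simp
  from order_tendstoD(2)[OF this \<open>0 < \<epsilon>\<close>] show ?thesis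
    by (auto simp: eventually_sequentially intro: less_imp_le)
qed

lemma (in prob_space) expectation_near_trig_poly:
  fixes Z :: "'a \<Rightarrow> real^'n"
  assumes [measurable]: "Z \<in> borel_measurable M"
    and f: "continuous_on UNIV f" "\<And>x. \<bar>f x\<bar> \<le> K" and g: "trig_poly g"
    and fg: "\<And>x. \<bar>f x - g x\<bar> \<le> 2 * \<epsilon> + 2 * K * of_bool (B < norm x)"
    and B: "prob {\<omega>\<in>space M. B < norm (Z \<omega>)} \<le> \<epsilon>"
  shows "\<bar>expectation (\<lambda>\<omega>. f (Z \<omega>)) - expectation (\<lambda>\<omega>. g (Z \<omega>))\<bar> \<le> 2 * \<epsilon> + 2 * K * \<epsilon>"
proof -
  have K0: "0 \<le> K" using f(2)[of 0] by linarith
  have [measurable]: "f \<in> borel_measurable borel" "g \<in> borel_measurable borel"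
    using f(1) trig_poly_bounded_continuous[OF g] by (auto intro: borel_measurable_continuous_onI)
  obtain C where C: "\<And>x. \<bar>g x\<bar> \<le> C" using trig_poly_bounded_continuous[OF g] by auto
  have int: "integrable M (\<lambda>\<omega>. f (Z \<omega>))" "integrable M (\<lambda>\<omega>. g (Z \<omega>))"
    by (rule integrable_const_bound[of _ K], use f in auto, rule integrable_const_bound[of _ C], use C in auto)
  have "\<bar>expectation (\<lambda>\<omega>. f (Z \<omega>)) - expectation (\<lambda>\<omega>. g (Z \<omega>))\<bar> = \<bar>expectation (\<lambda>\<omega>. f (Z \<omega>) - g (Z \<omega>))\<bar>"
    using int by simp
  also have "\<dots> \<le> expectation (\<lambda>\<omega>. \<bar>f (Z \<omega>) - g (Z \<omega>)\<bar>)" by (rule integral_abs_bound)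
  also have "\<dots> \<le> expectation (\<lambda>\<omega>. 2 * \<epsilon> + 2 * K * indicator {\<omega>\<in>space M. B < norm (Z \<omega>)} \<omega>)"
  proof (rule integral_mono)
    show "\<bar>f (Z \<omega>) - g (Z \<omega>)\<bar> \<le> 2 * \<epsilon> + 2 * K * indicator {\<omega>\<in>space M. B < norm (Z \<omega>)} \<omega>"
      if "\<omega> \<in> space M" for \<omega>
      using fg[of "Z \<omega>"] that by (simp add: indicator_def of_bool_def)
    show "integrable M (\<lambda>\<omega>. 2 * \<epsilon> + 2 * K * indicator {\<omega>\<in>space M. B < norm (Z \<omega>)} \<omega>)"
      by (intro Bochner_Integration.integrable_add integrable_mult_right integrable_real_indicator) (auto simp: emeasure_eq_measure)
  qed (use int in auto)
  also have "\<dots> = 2 * \<epsilon> + 2 * K * prob {\<omega>\<in>space M. B < norm (Z \<omega>)}"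
    by (subst Bochner_Integration.integral_add) (auto simp: prob_space emeasure_eq_measure intro!: integrable_real_indicator)
  also have "\<dots> \<le> 2 * \<epsilon> + 2 * K * \<epsilon>" using B K0 by (intro add_left_mono mult_left_mono) auto
  finally show ?thesis .
qed

text \<open>Levy's continuity theorem with tightness as a hypothesis. A test function is replaced by
  a trigonometric polynomial under the law of \<open>Y n\<close> and under \<open>N\<close>; the
  replacement is accurate on a large ball, and both laws put little mass outside it.\<close>

lemma converges_in_distributionI_cis:
  fixes Y :: "nat \<Rightarrow> 'w \<Rightarrow> real^'n"
  assumes P: "prob_space P" and N: "prob_space N" "sets N = sets borel"
    and Y [measurable]: "\<And>n. Y n \<in> borel_measurable P"
    and cis: "\<And>u. (\<lambda>n. \<integral>\<omega>. cis (u \<bullet> Y n \<omega>) \<partial>P) \<longlonglongrightarrow> (\<integral>y. cis (u \<bullet> y) \<partial>N)"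
    and tight: "\<And>\<epsilon>. 0 < \<epsilon> \<Longrightarrow> \<exists>B. \<forall>\<^sub>F n in sequentially. \<P>(\<omega> in P. B < norm (Y n \<omega>)) \<le> \<epsilon>"
  shows "converges_in_distribution P Y N"
  unfolding converges_in_distribution_def
proof (intro conjI allI impI Y)
  interpret P: prob_space P by fact
  interpret N: prob_space N by fact
  note [measurable_cong] = N(2)
  have intc: "integrable P (\<lambda>\<omega>. cis (u \<bullet> Y n \<omega>))" for u n
    by (rule P.integrable_const_bound[of _ 1]) (auto simp: cis_conv_exp)
  have intcN: "integrable N (\<lambda>y. cis (u \<bullet> y))" for u
    by (rule N.integrable_const_bound[of _ 1]) (auto simp: cis_conv_exp)
  have trig: "trig_poly g \<Longrightarrow> (\<lambda>n. \<integral>\<omega>. g (Y n \<omega>) \<partial>P) \<longlonglongrightarrow> (\<integral>y. g y \<partial>N)" for g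
  proof (induction g rule: trig_poly.induct)
    case (cos c u)
    have "(\<integral>\<omega>. cos (u \<bullet> Y n \<omega>) \<partial>P) = Re (\<integral>\<omega>. cis (u \<bullet> Y n \<omega>) \<partial>P)" for n
      using integral_Re[OF intc[of u n]] by simp
    moreover have "(\<integral>y. cos (u \<bullet> y) \<partial>N) = Re (\<integral>y. cis (u \<bullet> y) \<partial>N)"
      using integral_Re[OF intcN[of u]] by simp
    ultimately show ?case using tendsto_Re[OF cis[of u]] by (auto intro!: tendsto_mult_left)
  next
    case (sin c u)
    have "(\<integral>\<omega>. sin (u \<bullet> Y n \<omega>) \<partial>P) = Im (\<integral>\<omega>. cis (u \<bullet> Y n \<omega>) \<partial>P)" for n
      using integral_Im[OF intc[of u n]] by simp
    moreover have "(\<integral>y. sin (u \<bullet> y) \<partial>N) = Im (\<integral>y. cis (u \<bullet> y) \<partial>N)"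
      using integral_Im[OF intcN[of u]] by simp
    ultimately show ?case using tendsto_Im[OF cis[of u]] by (auto intro!: tendsto_mult_left)
  next
    case (add f g)
    have [measurable]: "f \<in> borel_measurable borel" "g \<in> borel_measurable borel"
      using trig_poly_bounded_continuous[OF add(1)] trig_poly_bounded_continuous[OF add(2)]
      by (auto intro: borel_measurable_continuous_onI)
    obtain B C where BC: "\<And>x. \<bar>f x\<bar> \<le> B" "\<And>x. \<bar>g x\<bar> \<le> C"
      using trig_poly_bounded_continuous[OF add(1)] trig_poly_bounded_continuous[OF add(2)] by auto
    have "integrable P (\<lambda>\<omega>. f (Y n \<omega>))" "integrable P (\<lambda>\<omega>. g (Y n \<omega>))" for n
      by (rule P.integrable_const_bound[of _ B], use BC in auto,
          rule P.integrable_const_bound[of _ C], use BC in auto)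
    moreover have "integrable N f" "integrable N g"
      by (rule N.integrable_const_bound[of _ B], use BC in auto,
          rule N.integrable_const_bound[of _ C], use BC in auto)
    ultimately show ?case using tendsto_add[OF add.IH] by simp
  qed
  fix f :: "real^'n \<Rightarrow> real" assume f: "continuous_on UNIV f \<and> bounded (range f)"
  then obtain K where K: "\<And>x. \<bar>f x\<bar> \<le> K" by (auto simp: bounded_iff)
  have K0: "0 \<le> K" using K[of 0] by linarith
  show "(\<lambda>n. \<integral>\<omega>. f (Y n \<omega>) \<partial>P) \<longlonglongrightarrow> (\<integral>y. f y \<partial>N)"
  proof (rule tendstoI)
    fix e :: real assume e: "0 < e"
    \<comment> \<open>Two replacements cost \<open>2 * \<epsilon> + 2 * K * \<epsilon>\<close> each
      and the convergence for the polynomial costs less than \<open>\<epsilon>\<close>; together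
      they amount to \<open>e\<close>.\<close>
    define \<epsilon> where "\<epsilon> = e / (2 * (2 + 2 * K) + 1)"
    have \<epsilon>: "0 < \<epsilon>" using e K0 by (simp add: \<epsilon>_def)
    have \<epsilon>e: "2 * (2 * \<epsilon> + 2 * K * \<epsilon>) + \<epsilon> = e"
      using K0 by (simp add: \<epsilon>_def divide_simps) (simp add: algebra_simps)
    obtain B1 where B1: "\<forall>\<^sub>F n in sequentially. \<P>(\<omega> in P. B1 < norm (Y n \<omega>)) \<le> \<epsilon>"
      using tight[OF \<epsilon>] by auto
    obtain B2 where B2: "\<P>(y in N. B2 < norm y) \<le> \<epsilon>"
      using N.tight_single[of "\<lambda>y. y" \<epsilon>] \<epsilon> by auto
    define B where "B = max 0 (max B1 B2)"
    have BP: "\<P>(\<omega> in P. B < norm (Y n \<omega>)) \<le> \<P>(\<omega> in P. B1 < norm (Y n \<omega>))" for n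
      by (rule P.finite_measure_mono) (auto simp: B_def)
    have "\<P>(y in N. B < norm y) \<le> \<P>(y in N. B2 < norm y)"
      by (rule N.finite_measure_mono) (auto simp: B_def)
    then have BN: "\<P>(y in N. B < norm y) \<le> \<epsilon>" using B2 by linarith
    obtain g where g: "trig_poly g" "\<And>x. \<bar>f x - g x\<bar> \<le> 2 * \<epsilon> + 2 * K * of_bool (B < norm x)"
      using continuous_near_trig_poly[where B = B and f = f, OF _ K \<epsilon>] f by (auto simp: B_def)
    have fgN: "\<bar>(\<integral>y. f y \<partial>N) - (\<integral>y. g y \<partial>N)\<bar> \<le> 2 * \<epsilon> + 2 * K * \<epsilon>"
      using N.expectation_near_trig_poly[where Z = "\<lambda>y. y", OF _ _ K g BN] f by auto
    have "\<forall>\<^sub>F n in sequentially. dist (\<integral>\<omega>. g (Y n \<omega>) \<partial>P) (\<integral>y. g y \<partial>N) < \<epsilon>"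
      using tendstoD[OF trig[OF g(1)] \<epsilon>] .
    then show "\<forall>\<^sub>F n in sequentially. dist (\<integral>\<omega>. f (Y n \<omega>) \<partial>P) (\<integral>y. f y \<partial>N) < e"
      using B1
    proof (eventually_elim)
      case (elim n)
      have "\<bar>(\<integral>\<omega>. f (Y n \<omega>) \<partial>P) - (\<integral>\<omega>. g (Y n \<omega>) \<partial>P)\<bar> \<le> 2 * \<epsilon> + 2 * K * \<epsilon>"
        using P.expectation_near_trig_poly[where Z = "Y n", OF _ _ K g order_trans[OF BP elim(2)]] f by auto
      with elim(1) \<epsilon>e fgN show ?case unfolding dist_real_def abs_le_iff abs_less_iff by argo
    qed
  qed
qed

text \<open>An isometry of the span of the vectors into \<open>real^'n\<close> yields the square factor of the covariance
  that \<^const>\<open>multivariate_normal\<close> asks for.\<close>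

lemma exists_multivariate_normal:
  fixes v :: "'n::finite \<Rightarrow> 'b::euclidean_space"
  shows "\<exists>N. multivariate_normal 0 (\<chi> s s'. v s \<bullet> v s') N \<and> prob_space N \<and> sets N = sets borel \<and>
    (\<forall>u. (\<integral>y. cis (u \<bullet> y) \<partial>N) = exp (- ((norm (\<Sum>s\<in>UNIV. u $ s *\<^sub>R v s))\<^sup>2) / 2))"
proof -
  \<comment> \<open>The span of at most \<open>CARD('n)\<close> vectors has dimension at most that
    of \<open>real^'n\<close>, whatever the ambient space, so an isometric embedding exists.\<close>
  have "dim (span (range v)) \<le> card (range v)" by (simp add: dim_le_card')
  also have "\<dots> \<le> dim (UNIV :: (real^'n) set)" by (simp add: card_image_le)
  finally obtain f :: "'b \<Rightarrow> real^'n" where f: "linear f"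
    and norm_f: "\<And>x. x \<in> span (range v) \<Longrightarrow> norm (f x) = norm x"
    using isometry_subset_subspace[of "span (range v)" "UNIV :: (real^'n) set"] by (metis subspace_UNIV subspace_span)
  interpret linear f by fact
  \<comment> \<open>Polarisation: preserving the norms of \<open>v s\<close>, \<open>v s'\<close>
    and their sum preserves their inner product.\<close>
  have inner_f: "f (v s) \<bullet> f (v s') = v s \<bullet> v s'" for s s'
    using norm_f[of "v s + v s'"] norm_f[of "v s"] norm_f[of "v s'"]
    by (simp add: span_add span_base add[symmetric] dot_norm)
  define A :: "real^'n^'n" where "A = (\<chi> s. f (v s))"
  have A: "A ** transpose A = (\<chi> s s'. v s \<bullet> v s')"
    by (simp add: A_def vec_eq_iff matrix_matrix_mult_def transpose_def flip: inner_f)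
      (simp add: inner_vec_def)
  interpret std: prob_space std_normal_distribution by (rule prob_space_normal_density) simp
  interpret prod: product_prob_space "\<lambda>i::'n. std_normal_distribution" by unfold_locales
  let ?G = "\<Pi>\<^sub>M i\<in>(UNIV::'n set). std_normal_distribution"
  define N where "N = distr ?G borel (\<lambda>z. 0 + A *v (\<chi> i. z i))"
  have "(\<lambda>z. 0 + A *v (\<chi> i. z i)) \<in> borel_measurable ?G"
    by (rule borel_measurable_vecI) (simp add: matrix_vector_mult_def)
  note meas [measurable] = this
  have pG: "prob_space ?G" by (rule prob_space_PiM) (rule std.prob_space_axioms)
  have "(\<integral>y. cis (u \<bullet> y) \<partial>N) = exp (- ((norm (\<Sum>s\<in>UNIV. u $ s *\<^sub>R v s))\<^sup>2) / 2)" for u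
  proof -
    define w where "w = f (\<Sum>s\<in>UNIV. u $ s *\<^sub>R v s)"
    have w: "w = (\<Sum>s\<in>UNIV. u $ s *\<^sub>R A $ s)" by (simp add: w_def sum scale A_def)
    have nw: "norm w = norm (\<Sum>s\<in>UNIV. u $ s *\<^sub>R v s)"
      unfolding w_def by (intro norm_f span_sum span_scale span_base) auto
    have "u \<bullet> (A *v x) = w \<bullet> x" for x
      by (simp add: w inner_vec_def[of u] matrix_mult_dot inner_sum_left)
    then have "(\<integral>y. cis (u \<bullet> y) \<partial>N) = (\<integral>z. cis (w \<bullet> (\<chi> i. z i)) \<partial>?G)"
      unfolding N_def by (subst integral_distr[OF meas]) (auto simp: cis_conv_exp)
    also have "\<dots> = (\<integral>z. (\<Prod>i\<in>UNIV. cis (w $ i * z i)) \<partial>?G)"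
      by (simp add: inner_vec_def cis_conv_exp exp_sum sum_distrib_left)
    also have "\<dots> = (\<Prod>i\<in>UNIV. \<integral>x. cis (w $ i * x) \<partial>std_normal_distribution)"
      by (intro prod.product_integral_prod std.integrable_const_bound[of _ 1]) (auto simp: cis_conv_exp)
    also have "\<dots> = (\<Prod>i\<in>UNIV. complex_of_real (exp (- ((w $ i)\<^sup>2) / 2)))"
      using char_std_normal_distribution by (simp add: char_def fun_eq_iff cis_conv_exp)
    also have "\<dots> = exp (- ((norm w)\<^sup>2) / 2)"
      by (simp add: norm_vec_def L2_set_def sum_nonneg exp_sum[symmetric] sum_negf sum_divide_distrib exp_of_real
        flip: of_real_prod of_real_exp)
    finally show ?thesis by (simp add: nw)
  qed
  moreover have "multivariate_normal 0 (\<chi> s s'. v s \<bullet> v s') N"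
    unfolding multivariate_normal_def using A N_def by blast
  moreover have "prob_space N" unfolding N_def by (rule prob_space.prob_space_distr[OF pG meas])
  ultimately show ?thesis by (intro exI[of _ N]) (auto simp: N_def)
qed

section \<open>The limiting covariance\<close>

lemma matrix_inv_transpose:
  fixes A :: "real^'n^'n"
  assumes "invertible A"
  shows "matrix_inv (transpose A) = transpose (matrix_inv A)"
proof -
  have inv: "invertible (transpose A)"
    using assms by (simp add: invertible_det_nz det_transpose)
  have "transpose A ** transpose (matrix_inv A) = mat 1"
    by (simp add: matrix_inv_inverse[OF assms] transpose_mat flip: matrix_transpose_mul)
  then have "matrix_inv (transpose A) ** (transpose A ** transpose (matrix_inv A)) = matrix_inv (transpose A)"
    by simp
  then show ?thesis by (simp add: matrix_mul_assoc matrix_inv_inverse[OF inv])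
qed

text \<open>To first order, \<open>n (M_hat - M)\<close> is a sum of one such matrix for each transition from \<open>sl\<close> to \<open>t\<close>.\<close>

definition influence_matrix ::
  "real^'d^('d \<times> 'k) \<Rightarrow> ('d \<times> 'k \<Rightarrow> real) \<Rightarrow> 'd \<times> 'k \<Rightarrow> 'd \<Rightarrow> real^'d::finite^('d \<times> 'k::finite)" where
  "influence_matrix M p sl t = (\<chi> sl' t'. of_bool (sl' = sl) * (of_bool (t' = t) - M $ sl $ t') / p sl)"

text \<open>Centring over the next state; this is what makes the linearised error a martingale under
  every logging policy.\<close>

lemma sum_influence_matrix:
  assumes "\<And>sl. (\<Sum>t\<in>UNIV. M $ sl $ t) = 1"
  shows "(\<Sum>t\<in>UNIV. M $ sl $ t *\<^sub>R influence_matrix M p sl t) = 0"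
proof -
  have "(\<Sum>t\<in>UNIV. M $ sl $ t * (of_bool (sl' = sl) * (of_bool (t' = t) - M $ sl $ t') / p sl)) = 0" for sl' t'
  proof -
    have "(\<Sum>t\<in>UNIV. M $ sl $ t * (of_bool (sl' = sl) * (of_bool (t' = t) - M $ sl $ t') / p sl))
        = of_bool (sl' = sl) / p sl * (\<Sum>t\<in>UNIV. M $ sl $ t * of_bool (t' = t) - M $ sl $ t * M $ sl $ t')"
      by (simp add: sum_distrib_left right_diff_distrib diff_divide_distrib)
    also have "(\<Sum>t\<in>UNIV. M $ sl $ t * of_bool (t' = t) - M $ sl $ t * M $ sl $ t') = 0"
      unfolding sum_subtractf sum_distrib_right[symmetric] assms
      by (simp add: of_bool_def if_distrib cong: if_cong)
    finally show ?thesis by simp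
  qed
  then show ?thesis by (simp add: vec_eq_iff influence_matrix_def)
qed

text \<open>Applied to the value vector, the influence matrix gives a multiple of the basis vector
  at \<open>sl\<close>, so the derivative picks out a single column of the resolvent times the
  policy matrix.\<close>

lemma value_derivative_influence:
  "value_derivative \<alpha> gt M \<pi> (influence_matrix M p sl t) $ s
    = \<alpha> * (matrix_inv (mat 1 - \<alpha> *\<^sub>R (policy_matrix \<pi> ** M)) ** policy_matrix \<pi>) $ s $ sl
      * (value_fun \<alpha> gt M \<pi> $ t - (M *v value_fun \<alpha> gt M \<pi>) $ sl) / p sl"
proof -
  define V where "V = value_fun \<alpha> gt M \<pi>"
  define B where "B = matrix_inv (mat 1 - \<alpha> *\<^sub>R (policy_matrix \<pi> ** M))"
  define x where "x = (V $ t - (M *v V) $ sl) / p sl"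
  have "(\<Sum>t'\<in>UNIV. of_bool (sl' = sl) * (of_bool (t' = t) - M $ sl $ t') / p sl * V $ t')
      = of_bool (sl' = sl) * x" for sl'
  proof -
    have "(\<Sum>t'\<in>UNIV. of_bool (sl' = sl) * (of_bool (t' = t) - M $ sl $ t') / p sl * V $ t')
       = of_bool (sl' = sl) / p sl * (\<Sum>t'\<in>UNIV. of_bool (t' = t) * V $ t' - M $ sl $ t' * V $ t')"
      by (simp add: sum_distrib_left left_diff_distrib)
    also have "(\<Sum>t'\<in>UNIV. of_bool (t' = t) * V $ t' - M $ sl $ t' * V $ t') = V $ t - (M *v V) $ sl"
      unfolding sum_subtractf by (simp add: matrix_vector_mult_def of_bool_def if_distrib[of "\<lambda>x. x * _"] cong: if_cong)
    finally show ?thesis by (simp add: x_def)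
  qed
  then have "influence_matrix M p sl t *v V = axis sl x"
    by (simp add: vec_eq_iff matrix_vector_mult_def influence_matrix_def axis_def)
  then have "value_derivative \<alpha> gt M \<pi> (influence_matrix M p sl t) = \<alpha> *\<^sub>R ((B ** policy_matrix \<pi>) *v axis sl x)"
    by (simp add: value_derivative_def V_def[symmetric] B_def[symmetric] matrix_vector_mul_assoc
        matrix_vector_mult_scaleR)
  then show ?thesis
    by (simp add: x_def V_def B_def matrix_vector_mult_def axis_def if_distrib cong: if_cong)
qed

text \<open>Identifies the Kronecker formula with the covariance delivered by the central limit
  theorem, since \<open>p sl * M $ sl $ t\<close> is the limiting frequency of a transition.
  \<open>Lambda_bar\<close> is block diagonal in the pair, and each block is the covariance of a
  one-step indicator vector divided by \<open>p sl\<close>; contracted with the value it becomes a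
  one-step variance.\<close>

lemma Sigma_V_eq:
  fixes M :: "real^'d::finite^('d \<times> 'k::finite)"
  assumes M: "\<And>sl t. 0 \<le> M $ sl $ t" "\<And>sl. (\<Sum>t\<in>UNIV. M $ sl $ t) = 1"
    and p: "\<And>sl. 0 < p sl" and \<alpha>: "0 \<le> \<alpha>" "\<alpha> < 1"
  shows "Sigma_V \<alpha> gt M p \<pi> = (\<chi> s s'. \<Sum>sl\<in>UNIV. p sl * (\<Sum>t\<in>UNIV. M $ sl $ t *
    (value_derivative \<alpha> gt M \<pi> (influence_matrix M p sl t) $ s *
     value_derivative \<alpha> gt M \<pi> (influence_matrix M p sl t) $ s')))"
proof -
  define V where "V = value_fun \<alpha> gt M \<pi>"
  define Q where "Q = (policy_matrix \<pi> :: real^('d \<times> 'k)^'d)"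
  define B where "B = matrix_inv (mat 1 - \<alpha> *\<^sub>R (Q ** M))"
  define A where "A = B ** Q"
  define m where "m = M *v V"
  have "substochastic M" using M by (simp add: substochastic_def)
  then have inv: "invertible (mat 1 - \<alpha> *\<^sub>R (Q ** M))"
    unfolding Q_def by (intro invertible_discounted substochastic_policy_matrix \<alpha>)
  have "mat 1 - \<alpha> *\<^sub>R (transpose M ** transpose Q) = transpose (mat 1 - \<alpha> *\<^sub>R (Q ** M))"
    by (simp add: matrix_transpose_mul[symmetric]) (simp add: vec_eq_iff transpose_def mat_def)
  then have R: "transpose Q ** matrix_inv (mat 1 - \<alpha> *\<^sub>R (transpose M ** transpose Q)) = transpose A"
    by (simp add: matrix_inv_transpose[OF inv] A_def B_def matrix_transpose_mul)
  \<comment> \<open>Only diagonal blocks survive, where the root is taken of a square and equals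
    \<open>p sl\<close>.\<close>
  have Lam: "Lambda_bar M p $ (sl, t) $ (sl', t')
      = of_bool (sl = sl') * (of_bool (t = t') * M $ sl $ t - M $ sl $ t * M $ sl $ t') / p sl" for sl t sl' t'
    using p[of sl] by (cases "sl = sl'") (simp_all add: Lambda_bar_def)
  have inner: "(\<Sum>t'\<in>UNIV. (\<Sum>t\<in>UNIV. V $ t * (of_bool (t = t') * M $ sl $ t - M $ sl $ t * M $ sl $ t')) * V $ t')
      = (\<Sum>t\<in>UNIV. M $ sl $ t * (V $ t - m $ sl)\<^sup>2)" for sl
  proof -
    have eq: "(\<Sum>t\<in>UNIV. V $ t * (of_bool (t = t') * M $ sl $ t - M $ sl $ t * M $ sl $ t'))
        = V $ t' * M $ sl $ t' - m $ sl * M $ sl $ t'" for t'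
    proof -
      have "(\<Sum>t\<in>UNIV. V $ t * (of_bool (t = t') * M $ sl $ t - M $ sl $ t * M $ sl $ t'))
          = (\<Sum>t\<in>UNIV. of_bool (t = t') * (V $ t * M $ sl $ t)) - (\<Sum>t\<in>UNIV. M $ sl $ t * V $ t) * M $ sl $ t'"
        by (simp add: sum_distrib_left sum_distrib_right sum_subtractf right_diff_distrib mult_ac)
      then show ?thesis
        by (simp add: m_def matrix_vector_mult_def of_bool_def if_distrib[of "\<lambda>x. x * _"] cong: if_cong)
    qed
    have "(\<Sum>t'\<in>UNIV. (\<Sum>t\<in>UNIV. V $ t * (of_bool (t = t') * M $ sl $ t - M $ sl $ t * M $ sl $ t')) * V $ t')
        = (\<Sum>t\<in>UNIV. M $ sl $ t * (V $ t)\<^sup>2) - m $ sl * (\<Sum>t\<in>UNIV. M $ sl $ t * V $ t)"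
      unfolding eq by (simp add: sum_distrib_left sum_subtractf algebra_simps power2_eq_square)
    \<comment> \<open>\<open>m $ sl\<close> is the mean of \<open>V\<close> under the row and the
      row sums to 1, so both expressions are second moment minus squared mean; this one completes
      the square.\<close>
    also have "\<dots> = (\<Sum>t\<in>UNIV. M $ sl $ t * (V $ t)\<^sup>2) - 2 * m $ sl * (\<Sum>t\<in>UNIV. M $ sl $ t * V $ t)
        + (m $ sl)\<^sup>2 * (\<Sum>t\<in>UNIV. M $ sl $ t)"
      by (simp add: M m_def matrix_vector_mult_def power2_eq_square)
    also have "\<dots> = (\<Sum>t\<in>UNIV. M $ sl $ t * (V $ t - m $ sl)\<^sup>2)"
      by (simp add: sum_distrib_left sum_subtractf[symmetric] sum.distrib[symmetric] power2_eq_square algebra_simps)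
    finally show ?thesis .
  qed
  have "Sigma_V \<alpha> gt M p \<pi> $ s $ s' = (\<Sum>sl\<in>UNIV. p sl * (\<Sum>t\<in>UNIV. M $ sl $ t *
    (value_derivative \<alpha> gt M \<pi> (influence_matrix M p sl t) $ s *
     value_derivative \<alpha> gt M \<pi> (influence_matrix M p sl t) $ s')))" for s s'
  proof -
    have "Sigma_V \<alpha> gt M p \<pi> $ s $ s' = \<alpha>\<^sup>2 * (\<Sum>sl'\<in>UNIV. \<Sum>t'\<in>UNIV.
        (\<Sum>sl\<in>UNIV. \<Sum>t\<in>UNIV. A $ s $ sl * V $ t * Lambda_bar M p $ (sl, t) $ (sl', t')) * (A $ s' $ sl' * V $ t'))"
      unfolding Sigma_V_def Let_def Q_def[symmetric] V_def[symmetric] B_def[symmetric] A_def[symmetric] R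
      by (simp add: matrix_matrix_mult_def kronecker_def rowvector_def columnvector_def transpose_def
          sum.cartesian_product flip: UNIV_Times_UNIV)
        (simp add: case_prod_unfold)
    also have "\<dots> = \<alpha>\<^sup>2 * (\<Sum>sl'\<in>UNIV. A $ s $ sl' * A $ s' $ sl' / p sl' * (\<Sum>t'\<in>UNIV.
        (\<Sum>t\<in>UNIV. V $ t * (of_bool (t = t') * M $ sl' $ t - M $ sl' $ t * M $ sl' $ t')) * V $ t'))"
    proof -
      have "(\<Sum>sl\<in>UNIV. \<Sum>t\<in>UNIV. A $ s $ sl * V $ t * Lambda_bar M p $ (sl, t) $ (sl', t'))
        = A $ s $ sl' / p sl' * (\<Sum>t\<in>UNIV. V $ t * (of_bool (t = t') * M $ sl' $ t - M $ sl' $ t * M $ sl' $ t'))" for sl' t'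
      proof -
        have "(\<Sum>t\<in>UNIV. A $ s $ sl * V $ t * Lambda_bar M p $ (sl, t) $ (sl', t'))
            = (if sl = sl' then A $ s $ sl' / p sl' * (\<Sum>t\<in>UNIV. V $ t * (of_bool (t = t') * M $ sl' $ t - M $ sl' $ t * M $ sl' $ t')) else 0)" for sl
          by (auto simp: Lam sum_distrib_left mult_ac)
        then show ?thesis by simp
      qed
      then show ?thesis by (simp add: sum_distrib_left mult_ac)
    qed
    also have "\<dots> = (\<Sum>sl\<in>UNIV. \<alpha>\<^sup>2 * (A $ s $ sl * A $ s' $ sl / p sl * (\<Sum>t\<in>UNIV. M $ sl $ t * (V $ t - m $ sl)\<^sup>2)))"
      unfolding inner by (rule sum_distrib_left)
    also have "\<dots> = (\<Sum>sl\<in>UNIV. p sl * (\<Sum>t\<in>UNIV. M $ sl $ t *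
        ((\<alpha> * A $ s $ sl * (V $ t - m $ sl) / p sl) * (\<alpha> * A $ s' $ sl * (V $ t - m $ sl) / p sl))))"
      unfolding sum_distrib_left
    proof (intro sum.cong refl)
      fix sl t
      show "\<alpha>\<^sup>2 * (A $ s $ sl * A $ s' $ sl / p sl * (M $ sl $ t * (V $ t - m $ sl)\<^sup>2))
        = p sl * (M $ sl $ t * ((\<alpha> * A $ s $ sl * (V $ t - m $ sl) / p sl) * (\<alpha> * A $ s' $ sl * (V $ t - m $ sl) / p sl)))"
        using p[of sl] by (simp add: power2_eq_square field_simps)
    qed
    finally show ?thesis
      unfolding value_derivative_influence V_def[symmetric] Q_def[symmetric] B_def[symmetric] A_def[symmetric] m_def .
  qed
  then show ?thesis by (simp add: vec_eq_iff)
qed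

text \<open>The covariance is the Gram matrix of the vectors \<open>v s\<close>, whose coordinates,
  one for each transition, are derivatives weighted by the root of the limiting transition
  frequency. The squared norm of a combination of them is then the variance in direction
  \<open>u\<close>.\<close>

lemma value_derivative_limit_normal:
  fixes M :: "real^'d::finite^('d \<times> 'k::finite)"
  assumes M: "\<And>sl t. 0 \<le> M $ sl $ t" "\<And>sl. (\<Sum>t\<in>UNIV. M $ sl $ t) = 1"
    and p: "\<And>sl. 0 < p sl" and \<alpha>: "0 \<le> \<alpha>" "\<alpha> < 1"
  shows "\<exists>N. multivariate_normal 0 (Sigma_V \<alpha> gt M p \<pi>) N \<and> prob_space N \<and> sets N = sets borel \<and>
    (\<forall>u. (\<integral>y. cis (u \<bullet> y) \<partial>N) = exp (- (\<Sum>sl\<in>UNIV. p sl * (\<Sum>t\<in>UNIV. M $ sl $ t *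
      (u \<bullet> value_derivative \<alpha> gt M \<pi> (influence_matrix M p sl t))\<^sup>2)) / 2))"
proof -
  let ?D = "\<lambda>sl t. value_derivative \<alpha> gt M \<pi> (influence_matrix M p sl t)"
  define v :: "'d \<Rightarrow> real^(('d \<times> 'k) \<times> 'd)" where
    "v s = (\<chi> z. sqrt (p (fst z) * M $ fst z $ snd z) * ?D (fst z) (snd z) $ s)" for s
  have sq: "sqrt (p sl * M $ sl $ t) * sqrt (p sl * M $ sl $ t) = p sl * M $ sl $ t" for sl t
    using p[of sl] M(1)[of sl t] by simp
  have "v s \<bullet> v s' = Sigma_V \<alpha> gt M p \<pi> $ s $ s'" for s s'
  proof -
    have "v s \<bullet> v s' = (\<Sum>z\<in>UNIV. (sqrt (p (fst z) * M $ fst z $ snd z) * sqrt (p (fst z) * M $ fst z $ snd z))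
        * (?D (fst z) (snd z) $ s * ?D (fst z) (snd z) $ s'))"
      unfolding inner_vec_def v_def by (intro sum.cong) simp_all
    also have "\<dots> = (\<Sum>sl\<in>UNIV. \<Sum>t\<in>UNIV. p sl * M $ sl $ t * (?D sl t $ s * ?D sl t $ s'))"
      unfolding sq UNIV_Times_UNIV[symmetric] sum.cartesian_product by (simp add: case_prod_unfold)
    finally show ?thesis by (simp add: Sigma_V_eq[OF assms] sum_distrib_left mult.assoc)
  qed
  then have S: "(\<chi> s s'. v s \<bullet> v s') = Sigma_V \<alpha> gt M p \<pi>" by (simp add: vec_eq_iff)
  have "(norm (\<Sum>s\<in>UNIV. u $ s *\<^sub>R v s))\<^sup>2 = (\<Sum>sl\<in>UNIV. p sl * (\<Sum>t\<in>UNIV. M $ sl $ t * (u \<bullet> ?D sl t)\<^sup>2))" for u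
  proof -
    have "(\<Sum>s\<in>UNIV. u $ s *\<^sub>R v s) $ z = sqrt (p (fst z) * M $ fst z $ snd z) * (u \<bullet> ?D (fst z) (snd z))" for z
      by (simp add: v_def inner_vec_def sum_distrib_left mult_ac)
    then have "(norm (\<Sum>s\<in>UNIV. u $ s *\<^sub>R v s))\<^sup>2
       = (\<Sum>z\<in>UNIV. (sqrt (p (fst z) * M $ fst z $ snd z) * sqrt (p (fst z) * M $ fst z $ snd z)) * (u \<bullet> ?D (fst z) (snd z))\<^sup>2)"
      unfolding power2_norm_eq_inner inner_vec_def[of "\<Sum>s\<in>UNIV. u $ s *\<^sub>R v s"]
      by (intro sum.cong) (simp_all add: power2_eq_square mult_ac)
    also have "\<dots> = (\<Sum>sl\<in>UNIV. \<Sum>t\<in>UNIV. p sl * M $ sl $ t * (u \<bullet> ?D sl t)\<^sup>2)"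
      unfolding sq UNIV_Times_UNIV[symmetric] sum.cartesian_product by (simp add: case_prod_unfold)
    finally show ?thesis by (simp add: sum_distrib_left mult.assoc)
  qed
  then show ?thesis using exists_multivariate_normal[of v] unfolding S by simp
qed

section \<open>Visit frequencies\<close>

text \<open>Functions of a history take finitely many values; this supplies their integrability and
  turns their expectations into sums.\<close>

lemma (in prob_space) expectation_finite_range:
  fixes F :: "'b \<Rightarrow> 'c::{banach, second_countable_topology}"
  assumes T [measurable]: "T \<in> measurable M (count_space UNIV)" and A: "finite A"
    and TA: "\<And>\<omega>. \<omega> \<in> space M \<Longrightarrow> T \<omega> \<in> A"
  shows "integrable M (\<lambda>\<omega>. F (T \<omega>))"
    and "expectation (\<lambda>\<omega>. F (T \<omega>)) = (\<Sum>h\<in>A. prob {\<omega>\<in>space M. T \<omega> = h} *\<^sub>R F h)"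
proof -
  have eq: "F (T \<omega>) = (\<Sum>h\<in>A. indicator {\<omega>\<in>space M. T \<omega> = h} \<omega> *\<^sub>R F h)" if "\<omega> \<in> space M" for \<omega>
  proof -
    have "(\<Sum>h\<in>A. indicator {\<omega>\<in>space M. T \<omega> = h} \<omega> *\<^sub>R F h) = (\<Sum>h\<in>A. if T \<omega> = h then F h else 0)"
      using that by (intro sum.cong) (auto simp: indicator_def)
    then show ?thesis using A TA[OF that] by simp
  qed
  have int: "integrable M (\<lambda>\<omega>. indicator {\<omega>\<in>space M. T \<omega> = h} \<omega> *\<^sub>R F h)" for h
    by (intro integrable_scaleR_left integrable_real_indicator) (auto simp: emeasure_eq_measure)
  show "integrable M (\<lambda>\<omega>. F (T \<omega>))"
    by (subst Bochner_Integration.integrable_cong[OF refl eq]) (auto intro: int)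
  have "expectation (\<lambda>\<omega>. F (T \<omega>)) = expectation (\<lambda>\<omega>. \<Sum>h\<in>A. indicator {\<omega>\<in>space M. T \<omega> = h} \<omega> *\<^sub>R F h)"
    by (rule Bochner_Integration.integral_cong[OF refl eq])
  also have "\<dots> = (\<Sum>h\<in>A. prob {\<omega>\<in>space M. T \<omega> = h} *\<^sub>R F h)"
    by (subst Bochner_Integration.integral_sum[OF int]) (simp add: emeasure_eq_measure)
  finally show "expectation (\<lambda>\<omega>. F (T \<omega>)) = (\<Sum>h\<in>A. prob {\<omega>\<in>space M. T \<omega> = h} *\<^sub>R F h)" .
qed

section \<open>Histories and the Markov property\<close>

locale controlled_chain =
  fixes P :: "'w measure"
    and X :: "nat \<Rightarrow> 'w \<Rightarrow> 'd::finite"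
    and a :: "nat \<Rightarrow> 'w \<Rightarrow> 'k::finite"
    and M :: "real^'d^('d \<times> 'k)"
  assumes cmc: "controlled_markov_chain P X a M"
begin

sublocale prob_space P
  using cmc by (simp add: controlled_markov_chain_def)

text \<open>The list covers the times below its index, so it is \<open>H (Suc i)\<close> that
  contains the pair at time \<open>i\<close>, on which the law of \<open>X (Suc i)\<close>
  depends.\<close>

abbreviation H :: "nat \<Rightarrow> 'w \<Rightarrow> ('d \<times> 'k) list" where
  "H \<equiv> trajectory X a 0"

abbreviation Hset :: "nat \<Rightarrow> ('d \<times> 'k) list set" where
  "Hset k \<equiv> {h. length h = k}"

lemma measurable_X [measurable]: "X i \<in> measurable P (count_space UNIV)"
  and measurable_a [measurable]: "a i \<in> measurable P (count_space UNIV)"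
  using cmc by (auto simp: controlled_markov_chain_def)

lemma M_nonneg: "0 \<le> M $ sl $ t" and M_sum: "(\<Sum>t\<in>UNIV. M $ sl $ t) = 1"
  using cmc by (cases sl; simp add: controlled_markov_chain_def)+

lemma length_H [simp]: "length (H k \<omega>) = k"
  by (simp add: trajectory_def)

lemma nth_H [simp]: "j < k \<Longrightarrow> H k \<omega> ! j = (X j \<omega>, a j \<omega>)"
  by (simp add: trajectory_def)

lemma H_Suc: "H (Suc k) \<omega> = H k \<omega> @ [(X k \<omega>, a k \<omega>)]"
  by (simp add: trajectory_def)

lemma H_eq_iff: "H k \<omega> = h \<longleftrightarrow> length h = k \<and> (\<forall>j<k. (X j \<omega>, a j \<omega>) = h ! j)"
  by (auto simp: list_eq_iff_nth_eq)

lemma take_H: "i \<le> k \<Longrightarrow> take i (H k \<omega>) = H i \<omega>"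
  by (auto simp: list_eq_iff_nth_eq)

lemma finite_Hset: "finite (Hset k)"
  using finite_lists_length_eq[of "UNIV :: ('d \<times> 'k) set" k] by simp

lemma measurable_H [measurable]: "H k \<in> measurable P (count_space UNIV)"
proof (subst measurable_count_space_eq2_countable, intro conjI ballI)
  fix h :: "('d \<times> 'k) list"
  have "H k -` {h} \<inter> space P = {\<omega>\<in>space P. length h = k \<and> (\<forall>j<k. X j \<omega> = fst (h ! j) \<and> a j \<omega> = snd (h ! j))}"
    by (auto simp: H_eq_iff prod_eq_iff)
  also have "\<dots> \<in> sets P" by measurable
  finally show "H k -` {h} \<inter> space P \<in> sets P" .
qed auto

lemma integrable_H: "integrable P (\<lambda>\<omega>. F (H k \<omega>))"
  for F :: "_ \<Rightarrow> 'c::{banach, second_countable_topology}"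
  by (rule expectation_finite_range[OF measurable_H finite_Hset]) simp

lemma expectation_H: "expectation (\<lambda>\<omega>. F (H k \<omega>)) = (\<Sum>h\<in>Hset k. prob {\<omega>\<in>space P. H k \<omega> = h} *\<^sub>R F h)"
  for F :: "_ \<Rightarrow> 'c::{banach, second_countable_topology}"
  by (rule expectation_finite_range[OF measurable_H finite_Hset]) simp

text \<open>The product form also holds for null histories, where both sides vanish and the
  conditional statement says nothing.\<close>

lemma prob_next_state:
  assumes h: "length h = Suc i"
  shows "prob {\<omega>\<in>space P. H (Suc i) \<omega> = h \<and> X (Suc i) \<omega> = t}
    = prob {\<omega>\<in>space P. H (Suc i) \<omega> = h} * M $ (h ! i) $ t"
proof (cases "prob {\<omega>\<in>space P. H (Suc i) \<omega> = h} = 0")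
  case True
  have "prob {\<omega>\<in>space P. H (Suc i) \<omega> = h \<and> X (Suc i) \<omega> = t} \<le> prob {\<omega>\<in>space P. H (Suc i) \<omega> = h}"
    by (rule finite_measure_mono) auto
  with True show ?thesis by (simp add: measure_le_0_iff)
next
  case False
  let ?s = "\<lambda>j. fst (h ! j)" and ?l = "\<lambda>j. snd (h ! j)"
  have eq: "(\<forall>j\<le>i. X j \<omega> = ?s j \<and> a j \<omega> = ?l j) \<longleftrightarrow> H (Suc i) \<omega> = h" for \<omega>
    using h by (auto simp: H_eq_iff prod_eq_iff less_Suc_eq_le)
  have pos: "0 < \<P>(\<omega> in P. \<forall>j\<le>i. X j \<omega> = ?s j \<and> a j \<omega> = ?l j)"
    unfolding eq using False by (simp add: zero_less_measure_iff)
  have "\<P>(\<omega> in P. X (Suc i) \<omega> = t \<bar> \<forall>j\<le>i. X j \<omega> = ?s j \<and> a j \<omega> = ?l j) = M $ (?s i, ?l i) $ t"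
    using cmc[unfolded controlled_markov_chain_def, THEN conjunct2, THEN conjunct2, THEN conjunct2,
        THEN conjunct2, THEN conjunct2, THEN spec[of _ i], THEN spec[of _ ?s], THEN spec[of _ ?l],
        THEN spec[of _ t], THEN mp, OF pos] by simp
  then show ?thesis using False unfolding eq cond_prob_def by (simp add: field_simps conj_commute)
qed

text \<open>The form in which the Markov property is used later: under an expectation, the next
  state may be averaged out against its row, even when weighted by the whole history.\<close>

lemma expectation_next_state:
  fixes F :: "('d \<times> 'k) list \<Rightarrow> 'd \<Rightarrow> 'c::{banach, second_countable_topology}"
  shows "expectation (\<lambda>\<omega>. F (H (Suc i) \<omega>) (X (Suc i) \<omega>))
    = expectation (\<lambda>\<omega>. \<Sum>t\<in>UNIV. M $ (X i \<omega>, a i \<omega>) $ t *\<^sub>R F (H (Suc i) \<omega>) t)"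
proof -
  let ?T = "\<lambda>\<omega>. (H (Suc i) \<omega>, X (Suc i) \<omega>)"
  have T: "?T \<in> measurable P (count_space UNIV)"
  proof (subst measurable_count_space_eq2_countable, intro conjI ballI)
    fix z :: "('d \<times> 'k) list \<times> 'd"
    have "?T -` {z} \<inter> space P = {\<omega>\<in>space P. H (Suc i) \<omega> = fst z \<and> X (Suc i) \<omega> = snd z}" by auto
    also have "\<dots> \<in> sets P" by measurable
    finally show "?T -` {z} \<inter> space P \<in> sets P" .
  qed auto
  have "expectation (\<lambda>\<omega>. F (H (Suc i) \<omega>) (X (Suc i) \<omega>)) = expectation (\<lambda>\<omega>. case_prod F (?T \<omega>))" by simp
  also have "\<dots> = (\<Sum>(h, t)\<in>Hset (Suc i) \<times> UNIV. prob {\<omega>\<in>space P. ?T \<omega> = (h, t)} *\<^sub>R F h t)"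
    by (subst expectation_finite_range(2)[OF T, of "Hset (Suc i) \<times> UNIV"])
      (auto simp: finite_Hset intro!: sum.cong)
  also have "\<dots> = (\<Sum>h\<in>Hset (Suc i). \<Sum>t\<in>UNIV. prob {\<omega>\<in>space P. H (Suc i) \<omega> = h} *\<^sub>R M $ (h ! i) $ t *\<^sub>R F h t)"
    unfolding sum.cartesian_product[symmetric] by (intro sum.cong) (auto simp: prob_next_state)
  also have "\<dots> = expectation (\<lambda>\<omega>. (\<lambda>h. \<Sum>t\<in>UNIV. M $ (h ! i) $ t *\<^sub>R F h t) (H (Suc i) \<omega>))"
    by (subst expectation_H) (simp add: scaleR_sum_right)
  finally show ?thesis by simp
qed

lemma expectation_martingale_increment:
  fixes G :: "('d \<times> 'k) list \<Rightarrow> real"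
  assumes h: "\<And>sl. (\<Sum>t\<in>UNIV. M $ sl $ t * h sl t) = 0"
  shows "expectation (\<lambda>\<omega>. G (H (Suc i) \<omega>) * h (X i \<omega>, a i \<omega>) (X (Suc i) \<omega>)) = 0"
proof -
  have "expectation (\<lambda>\<omega>. G (H (Suc i) \<omega>) * h (X i \<omega>, a i \<omega>) (X (Suc i) \<omega>))
      = expectation (\<lambda>\<omega>. (\<lambda>hh t. G hh * h (hh ! i) t) (H (Suc i) \<omega>) (X (Suc i) \<omega>))" by simp
  also have "\<dots> = expectation (\<lambda>\<omega>. \<Sum>t\<in>UNIV. M $ (X i \<omega>, a i \<omega>) $ t *\<^sub>R (G (H (Suc i) \<omega>) * h (H (Suc i) \<omega> ! i) t))"
    by (rule expectation_next_state)
  also have "\<dots> = expectation (\<lambda>\<omega>. G (H (Suc i) \<omega>) * (\<Sum>t\<in>UNIV. M $ (X i \<omega>, a i \<omega>) $ t * h (X i \<omega>, a i \<omega>) t))"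
    by (simp add: sum_distrib_left mult_ac)
  finally show ?thesis by (simp add: h)
qed

text \<open>There are finitely many histories of each length, so the null ones together carry no
  mass.\<close>

lemma AE_history_positive: "AE \<omega> in P. 0 < prob {\<omega>'\<in>space P. H k \<omega>' = H k \<omega>}"
proof -
  have "AE \<omega> in P. \<forall>h\<in>Hset k. prob {\<omega>'\<in>space P. H k \<omega>' = h} = 0 \<longrightarrow> H k \<omega> \<noteq> h"
  proof (subst AE_finite_all[OF finite_Hset], intro ballI)
    fix h
    show "AE \<omega> in P. prob {\<omega>'\<in>space P. H k \<omega>' = h} = 0 \<longrightarrow> H k \<omega> \<noteq> h"
      by (cases "prob {\<omega>'\<in>space P. H k \<omega>' = h} = 0") (auto simp: prob_eq_0)
  qed
  then show ?thesis
  proof eventually_elim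
    case (elim \<omega>)
    from bspec[OF this, of "H k \<omega>"] show ?case by (simp add: zero_less_measure_iff)
  qed
qed

text \<open>Elementary conditional expectation given the first \<open>k\<close> pairs; on a null history it is \<open>0\<close>.\<close>

definition cexp :: "nat \<Rightarrow> ('w \<Rightarrow> real) \<Rightarrow> ('d \<times> 'k) list \<Rightarrow> real" where
  "cexp k Z h = expectation (\<lambda>\<omega>. Z \<omega> * of_bool (H k \<omega> = h)) / prob {\<omega>\<in>space P. H k \<omega> = h}"

lemma integrable_restrict_H:
  fixes Z :: "'w \<Rightarrow> real"
  assumes "integrable P Z"
  shows "integrable P (\<lambda>\<omega>. Z \<omega> * of_bool (H k \<omega> = h))"
  by (rule Bochner_Integration.integrable_bound[OF assms]) (use assms in \<open>auto simp: of_bool_def\<close>)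

lemma prob_mult_cexp:
  assumes Z: "integrable P Z"
  shows "prob {\<omega>\<in>space P. H k \<omega> = h} * cexp k Z h = expectation (\<lambda>\<omega>. Z \<omega> * of_bool (H k \<omega> = h))"
proof (cases "prob {\<omega>\<in>space P. H k \<omega> = h} = 0")
  case True
  then have "AE \<omega> in P. H k \<omega> \<noteq> h" by (simp add: prob_eq_0)
  then have "expectation (\<lambda>\<omega>. Z \<omega> * of_bool (H k \<omega> = h)) = expectation (\<lambda>\<omega>. 0)"
    using Z by (intro integral_cong_AE) (auto simp: of_bool_def)
  with True show ?thesis by simp
qed (simp add: cexp_def)

text \<open>The defining property of conditional expectation. For indicators of single histories it
  is \<open>prob_mult_cexp\<close>, and every \<open>G\<close> is a finite combination of
  these.\<close>

lemma expectation_cexp_mult: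
  assumes Z: "integrable P Z"
  shows "expectation (\<lambda>\<omega>. cexp k Z (H k \<omega>) * G (H k \<omega>)) = expectation (\<lambda>\<omega>. Z \<omega> * G (H k \<omega>))"
proof -
  have "expectation (\<lambda>\<omega>. cexp k Z (H k \<omega>) * G (H k \<omega>))
      = (\<Sum>h\<in>Hset k. expectation (\<lambda>\<omega>. Z \<omega> * of_bool (H k \<omega> = h)) * G h)"
    by (subst expectation_H) (auto simp: prob_mult_cexp[OF Z, symmetric] intro!: sum.cong)
  also have "\<dots> = (\<Sum>h\<in>Hset k. expectation (\<lambda>\<omega>. Z \<omega> * of_bool (H k \<omega> = h) * G h))" by simp
  also have "\<dots> = expectation (\<lambda>\<omega>. \<Sum>h\<in>Hset k. Z \<omega> * of_bool (H k \<omega> = h) * G h)"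
    by (rule Bochner_Integration.integral_sum[symmetric]) (intro integrable_mult_left integrable_restrict_H Z)
  also have "\<dots> = expectation (\<lambda>\<omega>. Z \<omega> * G (H k \<omega>))"
  proof (rule Bochner_Integration.integral_cong[OF refl])
    fix \<omega>
    have "(\<Sum>h\<in>Hset k. Z \<omega> * of_bool (H k \<omega> = h) * G h) = (\<Sum>h\<in>Hset k. if H k \<omega> = h then Z \<omega> * G h else 0)"
      by (intro sum.cong) auto
    also have "\<dots> = Z \<omega> * G (H k \<omega>)" using finite_Hset by (subst sum.delta') auto
    finally show "(\<Sum>h\<in>Hset k. Z \<omega> * of_bool (H k \<omega> = h) * G h) = Z \<omega> * G (H k \<omega>)" .
  qed
  finally show ?thesis .
qed

lemma cexp_0: "cexp 0 Z h = (if h = [] then expectation Z else 0)"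
  by (auto simp: cexp_def H_eq_iff prob_space)

lemma cexp_H:
  assumes pos: "0 < prob {\<omega>\<in>space P. H n \<omega> = h}"
  shows "cexp n (\<lambda>\<omega>. F (H n \<omega>)) h = F h"
proof -
  have "expectation (\<lambda>\<omega>. F (H n \<omega>) * of_bool (H n \<omega> = h))
      = expectation (\<lambda>\<omega>. F h * indicator {\<omega>\<in>space P. H n \<omega> = h} \<omega>)"
    by (intro Bochner_Integration.integral_cong refl) (auto simp: of_bool_def indicator_def)
  then show ?thesis using pos by (simp add: cexp_def emeasure_eq_measure)
qed

text \<open>The variance of \<open>Z\<close> is the sum of the second moments of the increments of its Doob martingale.\<close>

lemma variance_le_sum_increments:
  assumes Z: "integrable P Z"
    and bd: "\<And>k. k < n \<Longrightarrow> AE \<omega> in P. \<bar>cexp (Suc k) Z (H (Suc k) \<omega>) - cexp k Z (H k \<omega>)\<bar> \<le> C"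
    and "k \<le> n"
  shows "expectation (\<lambda>\<omega>. (cexp k Z (H k \<omega>) - expectation Z)\<^sup>2) \<le> k * C\<^sup>2"
  using \<open>k \<le> n\<close>
proof (induction k)
  case 0
  then show ?case by (simp add: cexp_0 H_eq_iff trajectory_def)
next
  case (Suc k)
  let ?m = "\<lambda>k \<omega>. cexp k Z (H k \<omega>)"
  define u where "u h = cexp k Z h - expectation Z" for h
  define D where "D h = cexp (Suc k) Z h - cexp k Z (take k h)" for h
  have D: "D (H (Suc k) \<omega>) = ?m (Suc k) \<omega> - ?m k \<omega>" for \<omega>
    by (simp add: D_def take_H)
  have uH: "u (take k (H (Suc k) \<omega>)) = u (H k \<omega>)" for \<omega> by (simp add: take_H)
  \<comment> \<open>Orthogonality of the increment to the past: against a function of the first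
    \<open>k\<close> pairs, both conditional expectations integrate like \<open>Z\<close>
    itself.\<close>
  have "expectation (\<lambda>\<omega>. ?m (Suc k) \<omega> * u (H k \<omega>)) = expectation (\<lambda>\<omega>. Z \<omega> * u (H k \<omega>))"
    using expectation_cexp_mult[OF Z, of "Suc k" "\<lambda>h. u (take k h)"] by (simp add: uH)
  moreover have "expectation (\<lambda>\<omega>. ?m k \<omega> * u (H k \<omega>)) = expectation (\<lambda>\<omega>. Z \<omega> * u (H k \<omega>))"
    by (rule expectation_cexp_mult[OF Z])
  moreover have i1: "integrable P (\<lambda>\<omega>. ?m (Suc k) \<omega> * u (H k \<omega>))"
    using integrable_H[of "\<lambda>h. cexp (Suc k) Z h * u (take k h)" "Suc k"] by (simp add: uH)
  moreover have i2: "integrable P (\<lambda>\<omega>. ?m k \<omega> * u (H k \<omega>))"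
    by (rule integrable_H[of "\<lambda>h. cexp k Z h * u h"])
  ultimately have cross: "expectation (\<lambda>\<omega>. D (H (Suc k) \<omega>) * u (H k \<omega>)) = 0"
    by (simp add: D left_diff_distrib)
  have ix: "integrable P (\<lambda>\<omega>. D (H (Suc k) \<omega>) * u (H k \<omega>))"
    using i1 i2 by (simp add: D left_diff_distrib)
  have iu: "integrable P (\<lambda>\<omega>. (u (H k \<omega>))\<^sup>2)" by (rule integrable_H[of "\<lambda>h. (u h)\<^sup>2"])
  have iD: "integrable P (\<lambda>\<omega>. (D (H (Suc k) \<omega>))\<^sup>2)" by (rule integrable_H[of "\<lambda>h. (D h)\<^sup>2"])
  have "expectation (\<lambda>\<omega>. (?m (Suc k) \<omega> - expectation Z)\<^sup>2)
      = expectation (\<lambda>\<omega>. (u (H k \<omega>))\<^sup>2 + (2 * (D (H (Suc k) \<omega>) * u (H k \<omega>)) + (D (H (Suc k) \<omega>))\<^sup>2))"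
    by (intro Bochner_Integration.integral_cong refl) (simp add: D u_def power2_eq_square algebra_simps)
  also have "\<dots> = expectation (\<lambda>\<omega>. (u (H k \<omega>))\<^sup>2) + expectation (\<lambda>\<omega>. (D (H (Suc k) \<omega>))\<^sup>2)"
    using ix iu iD cross by simp
  also have "expectation (\<lambda>\<omega>. (u (H k \<omega>))\<^sup>2) \<le> k * C\<^sup>2" using Suc by (simp add: u_def)
  also have "expectation (\<lambda>\<omega>. (D (H (Suc k) \<omega>))\<^sup>2) \<le> expectation (\<lambda>\<omega>. C\<^sup>2)"
  proof (rule integral_mono_AE[OF iD])
    show "AE \<omega> in P. (D (H (Suc k) \<omega>))\<^sup>2 \<le> C\<^sup>2"
      using bd[OF Suc_le_lessD[OF Suc.prems]]
    proof eventually_elim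
      case (elim \<omega>)
      from power_mono[OF elim abs_ge_zero, of 2] show ?case by (simp add: D)
    qed
  qed auto
  finally show ?case by (simp add: prob_space algebra_simps)
qed

section \<open>Visit counts and mixing coefficients\<close>

lemma cond_prob_diff_le_eta_bar:
  assumes h: "length h = i" and j: "j \<le> n"
    and T: "T \<subseteq> {xs. length xs = n - j + 1}"
    and pos: "0 < prob {\<omega>\<in>space P. H (Suc i) \<omega> = h @ [x]}" "0 < prob {\<omega>\<in>space P. H (Suc i) \<omega> = h @ [x']}"
  shows "\<bar>\<P>(\<omega> in P. trajectory X a j (Suc n) \<omega> \<in> T \<bar> H (Suc i) \<omega> = h @ [x])
      - \<P>(\<omega> in P. trajectory X a j (Suc n) \<omega> \<in> T \<bar> H (Suc i) \<omega> = h @ [x'])\<bar> \<le> eta_bar P X a n i j"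
proof -
  have cp: "0 \<le> cond_prob P A B \<and> cond_prob P A B \<le> 1" if "Measurable.pred P B" for A B
  proof -
    have "prob {\<omega>\<in>space P. A \<omega> \<and> B \<omega>} \<le> prob {\<omega>\<in>space P. B \<omega>}"
      using that by (intro finite_measure_mono) auto
    then show ?thesis by (auto simp: cond_prob_def divide_le_eq_1 measure_nonneg zero_less_measure_iff)
  qed
  have conv: "H (Suc i) \<omega> = h @ [x] \<longleftrightarrow> X i \<omega> = fst x \<and> a i \<omega> = snd x \<and> H i \<omega> = h" for x \<omega>
    by (cases x) (auto simp: H_Suc)
  show ?thesis
    unfolding eta_bar_def conv
  proof (rule cSup_upper)
    show "\<bar>\<P>(\<omega> in P. trajectory X a j (Suc n) \<omega> \<in> T \<bar> X i \<omega> = fst x \<and> a i \<omega> = snd x \<and> H i \<omega> = h)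
      - \<P>(\<omega> in P. trajectory X a j (Suc n) \<omega> \<in> T \<bar> X i \<omega> = fst x' \<and> a i \<omega> = snd x' \<and> H i \<omega> = h)\<bar>
      \<in> {\<bar>\<P>(\<omega> in P. trajectory X a j (Suc n) \<omega> \<in> T \<bar> X i \<omega> = s1 \<and> a i \<omega> = l1 \<and> H i \<omega> = h)
           - \<P>(\<omega> in P. trajectory X a j (Suc n) \<omega> \<in> T \<bar> X i \<omega> = s2 \<and> a i \<omega> = l2 \<and> H i \<omega> = h)\<bar>
          | T s1 s2 l1 l2 h. T \<subseteq> {xs. length xs = n - j + 1} \<and> length h = i \<and>
            0 < \<P>(\<omega> in P. X i \<omega> = s1 \<and> a i \<omega> = l1 \<and> H i \<omega> = h) \<and>
            0 < \<P>(\<omega> in P. X i \<omega> = s2 \<and> a i \<omega> = l2 \<and> H i \<omega> = h)}"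
      using T h pos unfolding conv mem_Collect_eq by metis
    have "\<bar>\<P>(\<omega> in P. trajectory X a j (Suc n) \<omega> \<in> T \<bar> X i \<omega> = s1 \<and> a i \<omega> = l1 \<and> H i \<omega> = h)
           - \<P>(\<omega> in P. trajectory X a j (Suc n) \<omega> \<in> T \<bar> X i \<omega> = s2 \<and> a i \<omega> = l2 \<and> H i \<omega> = h)\<bar> \<le> 1"
      for T s1 s2 l1 l2 h
      using cp[of "\<lambda>\<omega>. X i \<omega> = s1 \<and> a i \<omega> = l1 \<and> H i \<omega> = h" "\<lambda>\<omega>. trajectory X a j (Suc n) \<omega> \<in> T"]
        cp[of "\<lambda>\<omega>. X i \<omega> = s2 \<and> a i \<omega> = l2 \<and> H i \<omega> = h" "\<lambda>\<omega>. trajectory X a j (Suc n) \<omega> \<in> T"]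
      by (simp add: abs_le_iff)
    \<comment> \<open>Differences of two probabilities lie within 1; this bound is what lets the
      real supremum dominate its members.\<close>
    then show "bdd_above {\<bar>\<P>(\<omega> in P. trajectory X a j (Suc n) \<omega> \<in> T \<bar> X i \<omega> = s1 \<and> a i \<omega> = l1 \<and> H i \<omega> = h)
           - \<P>(\<omega> in P. trajectory X a j (Suc n) \<omega> \<in> T \<bar> X i \<omega> = s2 \<and> a i \<omega> = l2 \<and> H i \<omega> = h)\<bar>
          | T s1 s2 l1 l2 h. T \<subseteq> {xs. length xs = n - j + 1} \<and> length h = i \<and>
            0 < \<P>(\<omega> in P. X i \<omega> = s1 \<and> a i \<omega> = l1 \<and> H i \<omega> = h) \<and>
            0 < \<P>(\<omega> in P. X i \<omega> = s2 \<and> a i \<omega> = l2 \<and> H i \<omega> = h)}"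
      by (intro bdd_aboveI[of _ 1]) (elim CollectE exE conjE, simp only:)
  qed
qed

lemma cexp_visits:
  "cexp k (visits X a n s l) h = (\<Sum>j<n. \<P>(\<omega> in P. X j \<omega> = s \<and> a j \<omega> = l \<bar> H k \<omega> = h))"
proof -
  have "expectation (\<lambda>\<omega>. visits X a n s l \<omega> * of_bool (H k \<omega> = h))
      = expectation (\<lambda>\<omega>. \<Sum>j<n. indicator {\<omega>\<in>space P. (X j \<omega> = s \<and> a j \<omega> = l) \<and> H k \<omega> = h} \<omega>)"
    unfolding visits_def sum_distrib_right
    by (intro Bochner_Integration.integral_cong refl sum.cong) (auto simp: of_bool_def indicator_def)
  also have "\<dots> = (\<Sum>j<n. prob {\<omega>\<in>space P. (X j \<omega> = s \<and> a j \<omega> = l) \<and> H k \<omega> = h})"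
    by (subst Bochner_Integration.integral_sum) (auto simp: emeasure_eq_measure intro!: integrable_real_indicator)
  finally show ?thesis by (simp add: cexp_def cond_prob_def sum_divide_distrib)
qed

text \<open>Visits before time \<open>k\<close> are fixed by the common past \<open>h\<close> and
  cancel, the visit at time \<open>k\<close> differs by at most 1, and at each later time the mixing
  coefficient applies. The total is row \<open>k\<close> of the mixing matrix.\<close>

lemma cexp_visits_diff_le:
  assumes h: "length h = k" and k: "k < n"
    and pos: "0 < prob {\<omega>\<in>space P. H (Suc k) \<omega> = h @ [x]}" "0 < prob {\<omega>\<in>space P. H (Suc k) \<omega> = h @ [x']}"
  shows "\<bar>cexp (Suc k) (visits X a n s l) (h @ [x]) - cexp (Suc k) (visits X a n s l) (h @ [x'])\<bar> \<le> Delta_norm P X a n"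
proof -
  let ?c = "\<lambda>j x. \<P>(\<omega> in P. X j \<omega> = s \<and> a j \<omega> = l \<bar> H (Suc k) \<omega> = h @ [x])"
  let ?b = "\<lambda>j. if j < k then 0 else if j = k then 1 else eta_bar P X a n k j"
  have past: "?c j y = of_bool (h ! j = (s, l))" if "j < k" "0 < prob {\<omega>\<in>space P. H (Suc k) \<omega> = h @ [y]}" for j y
  proof -
    have "(X j \<omega> = s \<and> a j \<omega> = l) \<and> H (Suc k) \<omega> = h @ [y] \<longleftrightarrow> h ! j = (s, l) \<and> H (Suc k) \<omega> = h @ [y]" for \<omega>
    proof -
      have "h ! j = (X j \<omega>, a j \<omega>)" if "H (Suc k) \<omega> = h @ [y]"
      proof -
        from that have "H (Suc k) \<omega> ! j = (h @ [y]) ! j" by simp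
        then show ?thesis using \<open>j < k\<close> h by (simp add: nth_append)
      qed
      then show ?thesis by auto
    qed
    then show ?thesis using that by (simp add: cond_prob_def)
  qed
  have eta: "\<bar>?c j x - ?c j x'\<bar> \<le> eta_bar P X a n k j" if "j \<le> n" for j
  proof -
    \<comment> \<open>A visit at time \<open>j\<close> is an event about the segment starting at
      \<open>j\<close>, namely one about its head, so the coefficient \<open>eta_bar\<close> applies
      to it.\<close>
    have "trajectory X a j (Suc n) \<omega> \<in> {xs. length xs = n - j + 1 \<and> hd xs = (s, l)} \<longleftrightarrow> X j \<omega> = s \<and> a j \<omega> = l" for \<omega>
      using that by (simp add: trajectory_def Suc_diff_le hd_map upt_conv_Cons del: upt_Suc)
    then show ?thesis
      using cond_prob_diff_le_eta_bar[OF h that _ pos, of "{xs. length xs = n - j + 1 \<and> hd xs = (s, l)}"] by auto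
  qed
  have "\<bar>?c j x - ?c j x'\<bar> \<le> ?b j" if "j < n" for j
  proof -
    consider "j < k" | "j = k" | "k < j" by linarith
    then show ?thesis
    proof cases
      case 1
      then show ?thesis using past[of j x] past[of j x'] pos by simp
    next
      case 2
      have "0 \<le> ?c j y \<and> ?c j y \<le> 1" for y
      proof -
        have "prob {\<omega>\<in>space P. (X j \<omega> = s \<and> a j \<omega> = l) \<and> H (Suc k) \<omega> = h @ [y]} \<le> prob {\<omega>\<in>space P. H (Suc k) \<omega> = h @ [y]}"
          by (intro finite_measure_mono) auto
        then show ?thesis by (auto simp: cond_prob_def divide_le_eq_1 measure_nonneg zero_less_measure_iff)
      qed
      from this[of x] this[of x'] 2 show ?thesis by (simp add: abs_le_iff)
    next
      case 3
      then show ?thesis using eta[of j] that by simp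
    qed
  qed
  then have "\<bar>\<Sum>j<n. ?c j x - ?c j x'\<bar> \<le> (\<Sum>j<n. ?b j)"
    by (intro order_trans[OF sum_abs] sum_mono) auto
  \<comment> \<open>Visits are counted up to time \<open>n - 1\<close> but the row runs to
    \<open>n\<close>. The added term is nonnegative, because the coefficient bounds an absolute
    value.\<close>
  also have "\<dots> \<le> (\<Sum>j\<in>{..<k} \<union> {k} \<union> {k + 1..n}. ?b j)"
    using k eta by (intro sum_mono2) (auto intro: order_trans[OF abs_ge_zero])
  also have "\<dots> = 1 + (\<Sum>j = k + 1..n. eta_bar P X a n k j)"
    by (subst sum.union_disjoint, simp, simp, force, subst sum.union_disjoint) auto
  also have "\<dots> \<le> Delta_norm P X a n"
    unfolding Delta_norm_def using k by (intro Max_ge) auto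
  finally show ?thesis by (simp add: cexp_visits sum_subtractf)
qed

lemma visits_H: "visits X a n s l \<omega> = (\<Sum>i<n. of_bool (H n \<omega> ! i = (s, l)))"
  by (simp add: visits_def)

lemma integrable_visits: "integrable P (visits X a n s l)"
  using integrable_H[of "\<lambda>h. \<Sum>i<n. of_bool (h ! i = (s, l)) :: real" n] unfolding visits_H[abs_def] .

text \<open>The coarser conditional expectation is the average of the finer ones over the possible
  pairs \<open>y\<close> at time \<open>k\<close>. The increment is thus an average of differences
  between two continuations of one past; continuations of probability 0 have weight 0.\<close>

lemma visits_increment_le:
  assumes k: "k < n"
  shows "AE \<omega> in P. \<bar>cexp (Suc k) (visits X a n s l) (H (Suc k) \<omega>) - cexp k (visits X a n s l) (H k \<omega>)\<bar>
    \<le> Delta_norm P X a n"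
  using AE_history_positive[of "Suc k"]
proof eventually_elim
  case (elim \<omega>)
  let ?Z = "visits X a n s l" and ?D = "Delta_norm P X a n"
  define h where "h = H k \<omega>"
  define x where "x = (X k \<omega>, a k \<omega>)"
  define c where "c = cexp (Suc k) ?Z (h @ [x])"
  let ?p = "\<lambda>y. prob {\<omega>\<in>space P. H (Suc k) \<omega> = h @ [y]}"
  have h: "length h = k" by (simp add: h_def)
  have Hx: "H (Suc k) \<omega> = h @ [x]" by (simp add: H_Suc h_def x_def)
  have px: "0 < ?p x" using elim by (simp add: Hx)
  have split: "of_bool (H k \<omega>' = h) = (\<Sum>y\<in>UNIV. of_bool (H (Suc k) \<omega>' = h @ [y]) :: real)" for \<omega>'
    by (cases "H k \<omega>' = h") (simp_all add: H_Suc of_bool_def)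
  have ph: "prob {\<omega>\<in>space P. H k \<omega> = h} = (\<Sum>y\<in>UNIV. ?p y)"
  proof -
    have "prob {\<omega>\<in>space P. H k \<omega> = h} = prob (\<Union>y\<in>UNIV. {\<omega>\<in>space P. H (Suc k) \<omega> = h @ [y]})"
      by (rule arg_cong[of _ _ prob]) (auto simp: H_Suc)
    also have "\<dots> = (\<Sum>y\<in>UNIV. ?p y)" by (intro finite_measure_finite_Union) (auto simp: disjoint_family_on_def)
    finally show ?thesis .
  qed
  have eZ: "expectation (\<lambda>\<omega>. ?Z \<omega> * of_bool (H k \<omega> = h)) = (\<Sum>y\<in>UNIV. ?p y * cexp (Suc k) ?Z (h @ [y]))"
    unfolding split sum_distrib_left prob_mult_cexp[OF integrable_visits]
    by (rule Bochner_Integration.integral_sum) (rule integrable_restrict_H[OF integrable_visits])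
  have "?p x \<le> (\<Sum>y\<in>UNIV. ?p y)" by (intro member_le_sum) auto
  then have pos: "0 < prob {\<omega>\<in>space P. H k \<omega> = h}" using px ph by linarith
  have "\<bar>prob {\<omega>\<in>space P. H k \<omega> = h} * c - prob {\<omega>\<in>space P. H k \<omega> = h} * cexp k ?Z h\<bar>
      = \<bar>\<Sum>y\<in>UNIV. ?p y * (c - cexp (Suc k) ?Z (h @ [y]))\<bar>"
    unfolding prob_mult_cexp[OF integrable_visits, of k h] eZ
    by (simp add: ph sum_distrib_right right_diff_distrib sum_subtractf)
  also have "\<dots> \<le> (\<Sum>y\<in>UNIV. ?p y * ?D)"
  proof (intro order_trans[OF sum_abs] sum_mono)
    fix y
    show "\<bar>?p y * (c - cexp (Suc k) ?Z (h @ [y]))\<bar> \<le> ?p y * ?D"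
    proof (cases "?p y = 0")
      case False
      then have "0 < ?p y" by (simp add: zero_less_measure_iff)
      from cexp_visits_diff_le[OF h k px this] show ?thesis by (simp add: c_def abs_mult mult_left_mono)
    qed simp
  qed
  also have "\<dots> = prob {\<omega>\<in>space P. H k \<omega> = h} * ?D" by (simp add: ph sum_distrib_right)
  finally have "prob {\<omega>\<in>space P. H k \<omega> = h} * \<bar>c - cexp k ?Z h\<bar> \<le> prob {\<omega>\<in>space P. H k \<omega> = h} * ?D"
    by (simp add: right_diff_distrib[symmetric] abs_mult)
  then have "\<bar>c - cexp k ?Z h\<bar> \<le> ?D" using pos by simp
  then show ?case unfolding Hx c_def h_def[symmetric] .
qed

text \<open>The visit count is a function of \<open>H n\<close>, so its Doob martingale reaches the
  count itself at time \<open>n\<close> and the sum of squared increments bounds the full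
  variance.\<close>

lemma variance_visits_le:
  "expectation (\<lambda>\<omega>. (visits X a n s l \<omega> - expectation (visits X a n s l))\<^sup>2) \<le> n * (Delta_norm P X a n)\<^sup>2"
proof -
  let ?Z = "visits X a n s l"
  have "AE \<omega> in P. cexp n ?Z (H n \<omega>) = ?Z \<omega>"
    using AE_history_positive[of n]
  proof eventually_elim
    case (elim \<omega>)
    show ?case using cexp_H[OF elim, of "\<lambda>h. \<Sum>i<n. of_bool (h ! i = (s, l))"]
      unfolding visits_H[abs_def] .
  qed
  then have "expectation (\<lambda>\<omega>. (?Z \<omega> - expectation ?Z)\<^sup>2) = expectation (\<lambda>\<omega>. (cexp n ?Z (H n \<omega>) - expectation ?Z)\<^sup>2)"
    using integrable_visits[of n s l, THEN borel_measurable_integrable]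
    by (intro integral_cong_AE) auto
  also have "\<dots> \<le> n * (Delta_norm P X a n)\<^sup>2"
    by (rule variance_le_sum_increments[OF integrable_visits visits_increment_le]) auto
  finally show ?thesis .
qed

end

section \<open>A martingale central limit theorem\<close>

lemma exp_minus_first_order:
  fixes x :: real assumes "0 \<le> x"
  shows "\<bar>exp (- x) - (1 - x)\<bar> \<le> x\<^sup>2"
proof -
  have "exp (- x) \<le> 1 / (1 + x)"
    using exp_ge_add_one_self[of x] assms by (simp add: exp_minus field_simps)
  also have "\<dots> \<le> 1 - x + x\<^sup>2"
    using assms by (simp add: divide_le_eq) (simp add: algebra_simps power2_eq_square)
  finally show ?thesis using exp_ge_add_one_self[of "- x"] by (simp add: abs_le_iff)
qed

lemma abs_exp_minus_diff_le:
  fixes x y :: real assumes "0 \<le> x" "0 \<le> y"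
  shows "\<bar>exp (- x) - exp (- y)\<bar> \<le> \<bar>x - y\<bar>"
proof -
  have *: "exp (- x) - exp (- y) \<le> y - x" if "0 \<le> x" "x \<le> y" for x y :: real
  proof -
    have "exp (- x) - exp (- y) = exp (- x) * (1 - exp (- (y - x)))"
      by (simp add: right_diff_distrib flip: exp_add)
    also have "\<dots> \<le> 1 * (1 - exp (- (y - x)))"
      using that by (intro mult_right_mono) auto
    also have "\<dots> \<le> y - x" using exp_ge_add_one_self[of "- (y - x)"] unfolding mult_1 by linarith
    finally show ?thesis .
  qed
  show ?thesis
    using *[of x y] *[of y x] assms by (cases "x \<le> y") auto
qed

lemma cmod_cis_second_order:
  "cmod (cis x - complex_of_real (1 - x\<^sup>2 / 2) - \<i> * x) \<le> \<bar>x\<bar> ^ 3 / 6"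
  using iexp_approx1[of x 2]
  by (simp add: cis_conv_exp numeral_2_eq_2 fact_numeral numeral_3_eq_3 power2_eq_square algebra_simps
    flip: power_Suc)

section \<open>Martingale sums along the chain\<close>

context controlled_chain
begin

definition martingale_sum :: "('d \<times> 'k \<Rightarrow> 'd \<Rightarrow> real) \<Rightarrow> nat \<Rightarrow> 'w \<Rightarrow> real" where
  "martingale_sum h n \<omega> = (\<Sum>i<n. h (X i \<omega>, a i \<omega>) (X (Suc i) \<omega>))"

text \<open>The martingale sum read off from a list, so that the results on finite ranges apply. The
  last increment looks one state ahead, hence \<open>n\<close> terms require a history of length at
  least \<open>Suc n\<close>.\<close>

definition sum_of_history :: "('d \<times> 'k \<Rightarrow> 'd \<Rightarrow> real) \<Rightarrow> nat \<Rightarrow> ('d \<times> 'k) list \<Rightarrow> real" where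
  "sum_of_history h n hh = (\<Sum>i<n. h (hh ! i) (fst (hh ! Suc i)))"

lemma martingale_sum_H: "n < k \<Longrightarrow> martingale_sum h n \<omega> = sum_of_history h n (H k \<omega>)"
  by (simp add: martingale_sum_def sum_of_history_def)

lemma measurable_martingale_sum: "martingale_sum h n \<in> borel_measurable P"
  using borel_measurable_integrable[OF integrable_H[of "sum_of_history h n" "Suc n"]]
  by (simp flip: martingale_sum_H)

lemma second_moment_martingale_sum_le:
  assumes h: "\<And>sl. (\<Sum>t\<in>UNIV. M $ sl $ t * h sl t) = 0" and B: "\<And>sl t. \<bar>h sl t\<bar> \<le> B"
  shows "expectation (\<lambda>\<omega>. (martingale_sum h n \<omega>)\<^sup>2) \<le> n * B\<^sup>2"
proof (induction n)
  case 0
  then show ?case by (simp add: martingale_sum_def)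
next
  case (Suc n)
  let ?S = "martingale_sum h n" and ?h = "\<lambda>\<omega>. h (X n \<omega>, a n \<omega>) (X (Suc n) \<omega>)"
  have i1: "integrable P (\<lambda>\<omega>. (?S \<omega>)\<^sup>2)"
    using integrable_H[of "\<lambda>hh. (sum_of_history h n hh)\<^sup>2" "Suc n"] by (simp flip: martingale_sum_H)
  have i2: "integrable P (\<lambda>\<omega>. ?S \<omega> * ?h \<omega>)"
    using integrable_H[of "\<lambda>hh. sum_of_history h n hh * h (hh ! n) (fst (hh ! Suc n))" "Suc (Suc n)"]
    by (simp flip: martingale_sum_H)
  have i3: "integrable P (\<lambda>\<omega>. (?h \<omega>)\<^sup>2)"
    using integrable_H[of "\<lambda>hh. (h (hh ! n) (fst (hh ! Suc n)))\<^sup>2" "Suc (Suc n)"] by simp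
  have cross: "expectation (\<lambda>\<omega>. ?S \<omega> * ?h \<omega>) = 0"
    using expectation_martingale_increment[OF h, of "sum_of_history h n" n] by (simp flip: martingale_sum_H)
  have "expectation (\<lambda>\<omega>. (martingale_sum h (Suc n) \<omega>)\<^sup>2)
      = expectation (\<lambda>\<omega>. (?S \<omega>)\<^sup>2 + (2 * (?S \<omega> * ?h \<omega>) + (?h \<omega>)\<^sup>2))"
    by (intro Bochner_Integration.integral_cong refl) (simp add: martingale_sum_def power2_eq_square algebra_simps)
  also have "\<dots> = expectation (\<lambda>\<omega>. (?S \<omega>)\<^sup>2) + expectation (\<lambda>\<omega>. (?h \<omega>)\<^sup>2)"
    using i1 i2 i3 cross by simp
  also have "expectation (\<lambda>\<omega>. (?h \<omega>)\<^sup>2) \<le> expectation (\<lambda>\<omega>. B\<^sup>2)"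
    using power_mono[OF B abs_ge_zero, of _ _ 2] by (intro integral_mono i3) auto
  finally show ?case using Suc by (simp add: prob_space algebra_simps)
qed

text \<open>The variance bound controls the distance of the frequency from its mean, at rate one
  over the square root of \<open>n\<close>; the assumed limit of averaged probabilities controls the
  distance of the mean from \<open>p\<close>.\<close>

lemma visits_frequency_L1:
  assumes mixing: "\<And>n. 1 \<le> n \<Longrightarrow> Delta_norm P X a n \<le> C"
    and freq: "(\<lambda>n. (\<Sum>i<n. \<P>(\<omega> in P. X i \<omega> = s \<and> a i \<omega> = l)) / real n) \<longlonglongrightarrow> p"
  shows "(\<lambda>n. expectation (\<lambda>\<omega>. \<bar>visits X a n s l \<omega> / n - p\<bar>)) \<longlonglongrightarrow> 0"
proof (rule tendsto_sandwich[of "\<lambda>_. 0", rotated])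
  let ?V = "\<lambda>n. visits X a n s l"
  have EV: "expectation (?V n) = (\<Sum>i<n. \<P>(\<omega> in P. X i \<omega> = s \<and> a i \<omega> = l))" for n
  proof -
    have "expectation (?V n) = expectation (\<lambda>\<omega>. \<Sum>i<n. indicator {\<omega>\<in>space P. X i \<omega> = s \<and> a i \<omega> = l} \<omega>)"
      unfolding visits_def
      by (intro Bochner_Integration.integral_cong refl sum.cong) (auto simp: of_bool_def indicator_def)
    also have "\<dots> = (\<Sum>i<n. \<P>(\<omega> in P. X i \<omega> = s \<and> a i \<omega> = l))"
      by (subst Bochner_Integration.integral_sum) (auto simp: emeasure_eq_measure intro!: integrable_real_indicator)
    finally show ?thesis .
  qed
  show "\<forall>\<^sub>F n in sequentially. expectation (\<lambda>\<omega>. \<bar>?V n \<omega> / n - p\<bar>)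
      \<le> (C\<^sup>2 + 1) / 2 / sqrt n + \<bar>(\<Sum>i<n. \<P>(\<omega> in P. X i \<omega> = s \<and> a i \<omega> = l)) / n - p\<bar>"
    using eventually_ge_at_top[of 1]
  proof eventually_elim
    case (elim n)
    then have n: "0 < real n" by simp
    define m where "m = expectation (?V n)"
    \<comment> \<open>Nonnegativity is needed to square the bound by \<open>C\<close>. The row
      \<open>i = n\<close> has an empty sum and contributes exactly 1 to the maximum.\<close>
    have "1 \<le> Delta_norm P X a n"
    proof -
      have "1 + (\<Sum>j = n + 1..n. eta_bar P X a n n j) \<le> Delta_norm P X a n"
        unfolding Delta_norm_def by (rule Max_ge, simp, rule image_eqI[where x = n], simp_all)
      then show ?thesis by simp
    qed
    then have var: "expectation (\<lambda>\<omega>. (?V n \<omega> - m)\<^sup>2) \<le> n * C\<^sup>2"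
      unfolding m_def using mixing[OF elim]
      by (intro order_trans[OF variance_visits_le] mult_left_mono power_mono) auto
    have iV: "integrable P (\<lambda>\<omega>. (?V n \<omega> - m)\<^sup>2)"
      using integrable_H[of "\<lambda>h. ((\<Sum>i<n. of_bool (h ! i = (s, l))) - m)\<^sup>2" n] unfolding visits_H[abs_def] .
    \<comment> \<open>Weighted arithmetic-geometric mean inequality. With weight
      \<open>sqrt n\<close> and a variance of order \<open>n\<close>, both terms are of order
      \<open>sqrt n\<close>.\<close>
    have young: "\<bar>x\<bar> \<le> x\<^sup>2 / (2 * sqrt n) + sqrt n / 2" for x
    proof -
      have "0 \<le> (\<bar>x\<bar> - sqrt n)\<^sup>2" by simp
      then have "2 * sqrt n * \<bar>x\<bar> \<le> x\<^sup>2 + n" using n by (simp add: power2_diff algebra_simps)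
      then have "\<bar>x\<bar> \<le> (x\<^sup>2 + n) / (2 * sqrt n)" using n by (simp add: le_divide_eq mult_ac)
      also have "\<dots> = x\<^sup>2 / (2 * sqrt n) + sqrt n / 2"
        using n by (simp add: add_divide_distrib real_div_sqrt)
      finally show ?thesis .
    qed
    have "expectation (\<lambda>\<omega>. \<bar>?V n \<omega> / n - p\<bar>)
        \<le> expectation (\<lambda>\<omega>. ((?V n \<omega> - m)\<^sup>2 / (2 * sqrt n) + sqrt n / 2) / n + \<bar>m / n - p\<bar>)"
    proof (rule integral_mono)
      show "integrable P (\<lambda>\<omega>. \<bar>?V n \<omega> / n - p\<bar>)"
        using integrable_H[of "\<lambda>h. \<bar>(\<Sum>i<n. of_bool (h ! i = (s, l))) / n - p\<bar>" n] unfolding visits_H[abs_def] .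
      show "integrable P (\<lambda>\<omega>. ((?V n \<omega> - m)\<^sup>2 / (2 * sqrt n) + sqrt n / 2) / n + \<bar>m / n - p\<bar>)"
        using iV by simp
      fix \<omega>
      have "\<bar>?V n \<omega> / n - p\<bar> \<le> \<bar>?V n \<omega> - m\<bar> / n + \<bar>m / n - p\<bar>"
        using abs_triangle_ineq[of "(?V n \<omega> - m) / n" "m / n - p"] n
        by (simp only: abs_div_pos[OF n]) (simp add: diff_divide_distrib del: abs_divide)
      also have "\<dots> \<le> ((?V n \<omega> - m)\<^sup>2 / (2 * sqrt n) + sqrt n / 2) / n + \<bar>m / n - p\<bar>"
        using n by (intro add_right_mono divide_right_mono young) auto
      finally show "\<bar>?V n \<omega> / n - p\<bar> \<le> ((?V n \<omega> - m)\<^sup>2 / (2 * sqrt n) + sqrt n / 2) / n + \<bar>m / n - p\<bar>" .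
    qed
    also have "\<dots> = (expectation (\<lambda>\<omega>. (?V n \<omega> - m)\<^sup>2) / (2 * sqrt n) + sqrt n / 2) / n + \<bar>m / n - p\<bar>"
      using iV by (simp add: prob_space)
    also have "\<dots> \<le> (n * C\<^sup>2 / (2 * sqrt n) + sqrt n / 2) / n + \<bar>m / n - p\<bar>"
      using n by (intro add_right_mono divide_right_mono var) auto
    also have "(n * C\<^sup>2 / (2 * sqrt n) + sqrt n / 2) / n = (C\<^sup>2 + 1) / 2 / sqrt n"
      using n by (simp add: field_simps)
    finally show ?case by (simp add: m_def EV)
  qed
  have "(\<lambda>n. (C\<^sup>2 + 1) / 2 / sqrt (real n)) \<longlonglongrightarrow> 0" by real_asymp
  from tendsto_add[OF this tendsto_rabs[OF LIM_zero[OF freq]]]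
  show "(\<lambda>n. (C\<^sup>2 + 1) / 2 / sqrt (real n)
      + \<bar>(\<Sum>i<n. \<P>(\<omega> in P. X i \<omega> = s \<and> a i \<omega> = l)) / n - p\<bar>) \<longlonglongrightarrow> 0" by simp
qed auto

lemma sum_visits: "(\<Sum>i<n. v (X i \<omega>, a i \<omega>)) = (\<Sum>sl\<in>UNIV. v sl * visits X a n (fst sl) (snd sl) \<omega>)"
  for v :: "_ \<Rightarrow> real"
proof -
  have "(\<Sum>sl\<in>UNIV. v sl * visits X a n (fst sl) (snd sl) \<omega>)
      = (\<Sum>i<n. \<Sum>sl\<in>UNIV. v sl * of_bool (sl = (X i \<omega>, a i \<omega>)))"
    unfolding visits_def sum_distrib_left
    by (subst sum.swap) (auto intro!: sum.cong simp: of_bool_def prod_eq_iff)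
  also have "\<dots> = (\<Sum>i<n. v (X i \<omega>, a i \<omega>))"
    by (intro sum.cong refl) (simp add: of_bool_def if_distrib cong: if_cong)
  finally show ?thesis by simp
qed

text \<open>The proof multiplies the exponential of the partial sum by the exponential of half its accumulated
  conditional variance. The expectation of this product changes by \<open>O(n powr (- 3 / 2))\<close> in each
  step, and the accumulated conditional variance is a function of visit frequencies.\<close>

theorem martingale_sum_clt:
  fixes h :: "'d \<times> 'k \<Rightarrow> 'd \<Rightarrow> real" and p :: "'d \<times> 'k \<Rightarrow> real"
  assumes h: "\<And>sl. (\<Sum>t\<in>UNIV. M $ sl $ t * h sl t) = 0"
    and freq: "\<And>s l. (\<lambda>n. expectation (\<lambda>\<omega>. \<bar>visits X a n s l \<omega> / n - p (s, l)\<bar>)) \<longlonglongrightarrow> 0"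
    and p: "\<And>sl. 0 \<le> p sl"
  shows "(\<lambda>n. expectation (\<lambda>\<omega>. cis (martingale_sum h n \<omega> / sqrt n)))
    \<longlonglongrightarrow> exp (- (\<Sum>sl\<in>UNIV. p sl * (\<Sum>t\<in>UNIV. M $ sl $ t * (h sl t)\<^sup>2)) / 2)"
proof -
  define v where "v sl = (\<Sum>t\<in>UNIV. M $ sl $ t * (h sl t)\<^sup>2)" for sl
  define B where "B = Max (range (\<lambda>(sl, t). \<bar>h sl t\<bar>))"
  have hB: "\<bar>h sl t\<bar> \<le> B" for sl t
    unfolding B_def by (intro Max_ge) (auto intro!: image_eqI[of _ _ "(sl, t)"])
  have B0: "0 \<le> B" using hB[of undefined undefined] by linarith
  have v0: "0 \<le> v sl" for sl unfolding v_def by (intro sum_nonneg mult_nonneg_nonneg M_nonneg) auto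
  have vB: "v sl \<le> B\<^sup>2" for sl
  proof -
    have "v sl \<le> (\<Sum>t\<in>UNIV. M $ sl $ t * B\<^sup>2)"
      unfolding v_def using power_mono[OF hB abs_ge_zero, of _ _ 2] by (intro sum_mono mult_left_mono M_nonneg) auto
    then show ?thesis by (simp add: M_sum flip: sum_distrib_right)
  qed
  \<comment> \<open>Bounds every exponential of accumulated half-variances: at most \<open>n\<close>
    summands, each at most \<open>B\<^sup>2 / (2 * n)\<close>.\<close>
  define K where "K = exp (B\<^sup>2 / 2)"
  have K1: "1 \<le> K" by (simp add: K_def)
  define L where "L = (\<Sum>sl\<in>UNIV. p sl * v sl) / 2"
  have L0: "0 \<le> L" unfolding L_def by (auto intro!: sum_nonneg mult_nonneg_nonneg p v0)
  \<comment> \<open>The first term is the third-order Taylor error of \<open>cis\<close> at an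
    argument of size \<open>B / sqrt n\<close>, the second the square of the bound
    \<open>B\<^sup>2 / (2 * n)\<close> from replacing \<open>1 - w\<close> by
    \<open>exp (- w)\<close>.\<close>
  define \<epsilon> where "\<epsilon> n = K * (B ^ 3 / (6 * sqrt (real n) ^ 3) + B ^ 4 / (4 * (real n)\<^sup>2))" for n
  define \<delta> where "\<delta> n = (\<Sum>sl\<in>UNIV. v sl / 2 * expectation (\<lambda>\<omega>. \<bar>visits X a n (fst sl) (snd sl) \<omega> / n - p sl\<bar>))" for n
  have main: "cmod (expectation (\<lambda>\<omega>. cis (martingale_sum h n \<omega> / sqrt n)) - exp (- L))
      \<le> K * \<delta> n + n * (K * \<epsilon> n)" if n: "1 \<le> n" for n
  proof -
    define r where "r = 1 / sqrt n"
    have r0: "0 \<le> r" by (simp add: r_def)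
    have r2: "r\<^sup>2 = 1 / n" by (simp add: r_def power_divide)
    have r3: "r ^ 3 = 1 / sqrt n ^ 3" by (simp add: r_def power_divide)
    define w where "w sl = v sl / (2 * n)" for sl
    have w0: "0 \<le> w sl" for sl by (simp add: w_def v0)
    have wB: "w sl \<le> B\<^sup>2 / 2 / n" for sl using vB[of sl] n by (simp add: w_def divide_right_mono)
    define Q where "Q k hh = (\<Sum>i<k. w (hh ! i))" for k and hh :: "('d \<times> 'k) list"
    define Z where "Z k hh = of_real (exp (Q k hh)) * cis (r * sum_of_history h k hh)" for k hh
    \<comment> \<open>The conditional characteristic function of one scaled increment. It is close
      to \<open>1 - w sl\<close>, so the factor \<open>exp (w sl)\<close> cancels it up to
      \<open>\<epsilon> n\<close>.\<close>
    define \<psi> where "\<psi> sl = (\<Sum>t\<in>UNIV. M $ sl $ t *\<^sub>R cis (r * h sl t))" for sl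
    have QK: "0 \<le> Q k hh" "exp (Q k hh) \<le> K" if "k \<le> n" for k hh
    proof -
      show "0 \<le> Q k hh" unfolding Q_def by (intro sum_nonneg w0)
      have "Q k hh \<le> (\<Sum>i<k. B\<^sup>2 / 2 / n)" unfolding Q_def by (intro sum_mono wB)
      also have "\<dots> = (k / n) * (B\<^sup>2 / 2)" by simp
      also have "\<dots> \<le> 1 * (B\<^sup>2 / 2)" using that n by (intro mult_right_mono) auto
      finally show "exp (Q k hh) \<le> K" by (simp add: K_def)
    qed
    have ZK: "cmod (Z k hh) \<le> K" if "k \<le> n" for k hh
      using QK[OF that] by (simp add: Z_def norm_mult)
    have \<psi>: "cmod (exp (w sl) * \<psi> sl - 1) \<le> \<epsilon> n" for sl
    proof -
      have lin: "(\<Sum>t\<in>UNIV. M $ sl $ t *\<^sub>R (complex_of_real (1 - (r * h sl t)\<^sup>2 / 2) + \<i> * (r * h sl t))) = of_real (1 - w sl)"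
      proof -
        have "M $ sl $ t *\<^sub>R (complex_of_real (1 - (r * h sl t)\<^sup>2 / 2) + \<i> * (r * h sl t))
            = complex_of_real (M $ sl $ t - r\<^sup>2 / 2 * (M $ sl $ t * (h sl t)\<^sup>2))
              + \<i> * complex_of_real (r * (M $ sl $ t * h sl t))" for t
          by (simp add: scaleR_conv_of_real algebra_simps power_mult_distrib)
        then have "(\<Sum>t\<in>UNIV. M $ sl $ t *\<^sub>R (complex_of_real (1 - (r * h sl t)\<^sup>2 / 2) + \<i> * (r * h sl t)))
            = complex_of_real (\<Sum>t\<in>UNIV. M $ sl $ t - r\<^sup>2 / 2 * (M $ sl $ t * (h sl t)\<^sup>2))
              + \<i> * complex_of_real (\<Sum>t\<in>UNIV. r * (M $ sl $ t * h sl t))"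
          by (simp add: sum.distrib sum_distrib_left)
        also have "(\<Sum>t\<in>UNIV. M $ sl $ t - r\<^sup>2 / 2 * (M $ sl $ t * (h sl t)\<^sup>2)) = 1 - w sl"
          unfolding sum_subtractf sum_distrib_left[symmetric] by (simp add: M_sum r2 w_def v_def)
        also have "(\<Sum>t\<in>UNIV. r * (M $ sl $ t * h sl t)) = 0"
          by (simp add: h flip: sum_distrib_left)
        finally show ?thesis by simp
      qed
      have "cmod (\<psi> sl - of_real (1 - w sl))
          = cmod (\<Sum>t\<in>UNIV. M $ sl $ t *\<^sub>R (cis (r * h sl t) - complex_of_real (1 - (r * h sl t)\<^sup>2 / 2) - \<i> * (r * h sl t)))"
        unfolding lin[symmetric] \<psi>_def by (simp add: sum_subtractf[symmetric] algebra_simps)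
      also have "\<dots> \<le> (\<Sum>t\<in>UNIV. M $ sl $ t * (B ^ 3 * r ^ 3 / 6))"
      proof (intro order_trans[OF norm_sum] sum_mono)
        fix t
        have "cmod (cis (r * h sl t) - complex_of_real (1 - (r * h sl t)\<^sup>2 / 2) - \<i> * (r * h sl t)) \<le> \<bar>r * h sl t\<bar> ^ 3 / 6"
          using cmod_cis_second_order[of "r * h sl t"] by simp
        also have "\<dots> \<le> B ^ 3 * r ^ 3 / 6"
          using mult_right_mono[OF power_mono[OF hB abs_ge_zero, of sl t 3], of "r ^ 3"] r0
          by (simp add: abs_mult power_mult_distrib mult.commute)
        finally show "cmod (M $ sl $ t *\<^sub>R (cis (r * h sl t) - complex_of_real (1 - (r * h sl t)\<^sup>2 / 2) - \<i> * (r * h sl t)))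
            \<le> M $ sl $ t * (B ^ 3 * r ^ 3 / 6)"
          unfolding norm_scaleR abs_of_nonneg[OF M_nonneg] by (rule mult_left_mono[OF _ M_nonneg])
      qed
      also have "\<dots> = B ^ 3 * r ^ 3 / 6" unfolding sum_distrib_right[symmetric] M_sum by simp
      finally have 1: "cmod (\<psi> sl - of_real (1 - w sl)) \<le> B ^ 3 * r ^ 3 / 6" .
      have "\<bar>exp (- w sl) - (1 - w sl)\<bar> \<le> (B\<^sup>2 / 2 / n)\<^sup>2"
        by (intro order_trans[OF exp_minus_first_order[OF w0]] power_mono wB w0)
      then have 2: "cmod (of_real (1 - w sl) - of_real (exp (- w sl))) \<le> B ^ 4 / (4 * (real n)\<^sup>2)"
        unfolding of_real_diff[symmetric] norm_of_real
        by (simp add: abs_minus_commute power_divide power_mult_distrib flip: power_mult)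
      have "exp (w sl) * \<psi> sl - 1 = exp (w sl) * (\<psi> sl - of_real (exp (- w sl)))"
        by (simp add: right_diff_distrib flip: of_real_mult exp_add)
      then have "cmod (exp (w sl) * \<psi> sl - 1) = exp (w sl) * cmod (\<psi> sl - of_real (exp (- w sl)))"
        by (simp add: norm_mult)
      also have "\<dots> \<le> K * (B ^ 3 * r ^ 3 / 6 + B ^ 4 / (4 * (real n)\<^sup>2))"
      proof (intro mult_mono)
        have "B\<^sup>2 / 2 / n \<le> B\<^sup>2 / 2" using n mult_left_mono[of 1 "real n" "B\<^sup>2 / 2"] by (simp add: divide_le_eq)
        from order_trans[OF wB this] show "exp (w sl) \<le> K" by (simp add: K_def)
        show "cmod (\<psi> sl - of_real (exp (- w sl))) \<le> B ^ 3 * r ^ 3 / 6 + B ^ 4 / (4 * (real n)\<^sup>2)"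
          using norm_triangle_ineq[of "\<psi> sl - of_real (1 - w sl)" "of_real (1 - w sl) - of_real (exp (- w sl))"] 1 2
          by simp
      qed (use K1 in auto)
      finally show ?thesis by (simp add: \<epsilon>_def r3 mult.commute)
    qed
    have step: "cmod (expectation (\<lambda>\<omega>. Z (Suc k) (H (Suc (Suc k)) \<omega>)) - expectation (\<lambda>\<omega>. Z k (H (Suc k) \<omega>))) \<le> K * \<epsilon> n"
      if k: "k < n" for k
    proof -
      \<comment> \<open>The only entry used beyond \<open>H (Suc k)\<close> is the new state, so
        averaging over its row replaces the last \<open>cis\<close> factor by
        \<open>\<psi>\<close>.\<close>
      have ZSuc: "Z (Suc k) (H (Suc (Suc k)) \<omega>) =
          (\<lambda>hh t. Z k hh * exp (w (hh ! k)) * cis (r * h (hh ! k) t)) (H (Suc k) \<omega>) (X (Suc k) \<omega>)" for \<omega>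
        by (simp add: Z_def Q_def sum_of_history_def exp_add distrib_left cis_mult[symmetric] mult_ac)
      have "expectation (\<lambda>\<omega>. Z (Suc k) (H (Suc (Suc k)) \<omega>))
          = expectation (\<lambda>\<omega>. Z k (H (Suc k) \<omega>) * (exp (w (X k \<omega>, a k \<omega>)) * \<psi> (X k \<omega>, a k \<omega>)))"
        unfolding ZSuc by (subst expectation_next_state)
          (simp add: \<psi>_def sum_distrib_left scaleR_conv_of_real mult_ac)
      then have "expectation (\<lambda>\<omega>. Z (Suc k) (H (Suc (Suc k)) \<omega>)) - expectation (\<lambda>\<omega>. Z k (H (Suc k) \<omega>))
          = expectation (\<lambda>\<omega>. (\<lambda>hh. Z k hh * (exp (w (hh ! k)) * \<psi> (hh ! k) - 1)) (H (Suc k) \<omega>))"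
        using integrable_H[of "\<lambda>hh. Z k hh * (exp (w (hh ! k)) * \<psi> (hh ! k))" "Suc k"] integrable_H[of "Z k" "Suc k"]
        by (simp add: right_diff_distrib)
      also have "cmod \<dots> \<le> expectation (\<lambda>\<omega>. K * \<epsilon> n)"
      proof (intro order_trans[OF integral_norm_bound] integral_mono)
        show "integrable P (\<lambda>\<omega>. cmod ((\<lambda>hh. Z k hh * (exp (w (hh ! k)) * \<psi> (hh ! k) - 1)) (H (Suc k) \<omega>)))"
          by (rule integrable_norm) (rule integrable_H)
        show "cmod ((\<lambda>hh. Z k hh * (exp (w (hh ! k)) * \<psi> (hh ! k) - 1)) (H (Suc k) \<omega>)) \<le> K * \<epsilon> n" for \<omega>
          using k K1 unfolding norm_mult by (intro mult_mono ZK \<psi>) auto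
      qed auto
      finally show ?thesis by (simp add: prob_space)
    qed
    have "cmod (expectation (\<lambda>\<omega>. Z k (H (Suc k) \<omega>)) - 1) \<le> k * (K * \<epsilon> n)" if "k \<le> n" for k
      using that
    proof (induction k)
      case 0
      then show ?case by (simp add: Z_def Q_def sum_of_history_def prob_space)
    next
      case (Suc k)
      have "cmod (expectation (\<lambda>\<omega>. Z (Suc k) (H (Suc (Suc k)) \<omega>)) - 1)
          \<le> cmod (expectation (\<lambda>\<omega>. Z (Suc k) (H (Suc (Suc k)) \<omega>)) - expectation (\<lambda>\<omega>. Z k (H (Suc k) \<omega>)))
            + cmod (expectation (\<lambda>\<omega>. Z k (H (Suc k) \<omega>)) - 1)"
        by (rule norm_diff_triangle_le[OF order_refl order_refl])
      also have "\<dots> \<le> K * \<epsilon> n + k * (K * \<epsilon> n)" using Suc step[of k] by (intro add_mono) auto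
      finally show ?case by (simp add: algebra_simps)
    qed
    from this[of n] have EZ: "cmod (expectation (\<lambda>\<omega>. Z n (H (Suc n) \<omega>)) - 1) \<le> n * (K * \<epsilon> n)" by simp
    \<comment> \<open>Removing the compensating exponential leaves the random factor
      \<open>exp (- Q n)\<close>. It is then replaced by its limit \<open>exp (- L)\<close>, at a
      cost bounded by visit frequencies because this exponential is 1-Lipschitz on nonnegative
      arguments.\<close>
    have cis_eq: "cis (martingale_sum h n \<omega> / sqrt n) = Z n (H (Suc n) \<omega>) * of_real (exp (- Q n (H (Suc n) \<omega>)))" for \<omega>
      by (simp add: Z_def r_def martingale_sum_H[of n "Suc n"] exp_minus)
    have Qdiff: "\<bar>Q n (H (Suc n) \<omega>) - L\<bar> \<le> (\<Sum>sl\<in>UNIV. v sl / 2 * \<bar>visits X a n (fst sl) (snd sl) \<omega> / n - p sl\<bar>)" for \<omega>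
    proof -
      have "Q n (H (Suc n) \<omega>) = (\<Sum>sl\<in>UNIV. w sl * visits X a n (fst sl) (snd sl) \<omega>)"
        unfolding Q_def by (subst sum_visits[symmetric]) simp
      then have "Q n (H (Suc n) \<omega>) - L = (\<Sum>sl\<in>UNIV. v sl / 2 * (visits X a n (fst sl) (snd sl) \<omega> / n - p sl))"
        by (simp add: L_def w_def sum_subtractf sum_divide_distrib algebra_simps)
      then show ?thesis
        using v0 by (auto intro!: order_trans[OF sum_abs] sum_mono simp: abs_mult)
    qed
    have iv: "integrable P (\<lambda>\<omega>. \<bar>visits X a n (fst sl) (snd sl) \<omega> / n - p sl\<bar>)" for sl
      using integrable_H[of "\<lambda>h. \<bar>(\<Sum>i<n. of_bool (h ! i = (fst sl, snd sl))) / n - p sl\<bar>" n]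
      unfolding visits_H[abs_def] .
    let ?F = "\<lambda>hh. Z n hh * of_real (exp (- Q n hh) - exp (- L))"
    have "expectation (\<lambda>\<omega>. cis (martingale_sum h n \<omega> / sqrt n)) - exp (- L) * expectation (\<lambda>\<omega>. Z n (H (Suc n) \<omega>))
        = expectation (\<lambda>\<omega>. ?F (H (Suc n) \<omega>))"
      unfolding cis_eq
      using integrable_H[of "\<lambda>hh. Z n hh * of_real (exp (- Q n hh))" "Suc n"] integrable_H[of "Z n" "Suc n"]
      by (simp add: right_diff_distrib mult.commute)
    also have "cmod \<dots> \<le> expectation (\<lambda>\<omega>. K * (\<Sum>sl\<in>UNIV. v sl / 2 * \<bar>visits X a n (fst sl) (snd sl) \<omega> / n - p sl\<bar>))"
    proof (intro order_trans[OF integral_norm_bound] integral_mono)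
      show "integrable P (\<lambda>\<omega>. cmod (?F (H (Suc n) \<omega>)))" by (rule integrable_norm) (rule integrable_H)
      show "integrable P (\<lambda>\<omega>. K * (\<Sum>sl\<in>UNIV. v sl / 2 * \<bar>visits X a n (fst sl) (snd sl) \<omega> / n - p sl\<bar>))"
        by (intro integrable_mult_right Bochner_Integration.integrable_sum iv)
      show "cmod (?F (H (Suc n) \<omega>)) \<le> K * (\<Sum>sl\<in>UNIV. v sl / 2 * \<bar>visits X a n (fst sl) (snd sl) \<omega> / n - p sl\<bar>)" for \<omega>
        unfolding norm_mult norm_of_real using K1 QK(1)[of n] L0
        by (intro mult_mono ZK order_trans[OF abs_exp_minus_diff_le Qdiff]) auto
    qed
    also have "\<dots> = K * \<delta> n"
      by (simp only: \<delta>_def integral_mult_right_zero Bochner_Integration.integral_sum integrable_mult_right iv)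
    finally have A: "cmod (expectation (\<lambda>\<omega>. cis (martingale_sum h n \<omega> / sqrt n))
        - exp (- L) * expectation (\<lambda>\<omega>. Z n (H (Suc n) \<omega>))) \<le> K * \<delta> n" .
    have "exp (- L) * expectation (\<lambda>\<omega>. Z n (H (Suc n) \<omega>)) - complex_of_real (exp (- L))
        = exp (- L) * (expectation (\<lambda>\<omega>. Z n (H (Suc n) \<omega>)) - 1)"
      by (simp add: right_diff_distrib)
    then have "cmod (exp (- L) * expectation (\<lambda>\<omega>. Z n (H (Suc n) \<omega>)) - exp (- L))
        = exp (- L) * cmod (expectation (\<lambda>\<omega>. Z n (H (Suc n) \<omega>)) - 1)"
      by (simp only: norm_mult norm_of_real abs_exp_cancel)
    also have "\<dots> \<le> 1 * (n * (K * \<epsilon> n))" using L0 EZ by (intro mult_mono) auto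
    finally show ?thesis using norm_diff_triangle_le[OF A] by simp
  qed
  have "\<delta> \<longlonglongrightarrow> (\<Sum>sl\<in>UNIV. v sl / 2 * 0)"
    unfolding \<delta>_def using freq by (intro tendsto_sum tendsto_mult tendsto_const) (auto simp: split_paired_all)
  then have "\<delta> \<longlonglongrightarrow> 0" by simp
  moreover have "(\<lambda>n. n * (K * \<epsilon> n)) \<longlonglongrightarrow> 0"
    unfolding \<epsilon>_def by real_asymp
  ultimately have "(\<lambda>n. K * \<delta> n + n * (K * \<epsilon> n)) \<longlonglongrightarrow> K * 0 + 0" by (intro tendsto_intros)
  note lim = this
  have "(\<lambda>n. cmod (expectation (\<lambda>\<omega>. cis (martingale_sum h n \<omega> / sqrt n)) - exp (- L))) \<longlonglongrightarrow> 0"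
  proof (rule tendsto_sandwich[OF _ _ tendsto_const])
    show "(\<lambda>n. K * \<delta> n + n * (K * \<epsilon> n)) \<longlonglongrightarrow> 0" using lim by simp
    show "\<forall>\<^sub>F n in sequentially. cmod (expectation (\<lambda>\<omega>. cis (martingale_sum h n \<omega> / sqrt n)) - exp (- L))
        \<le> K * \<delta> n + n * (K * \<epsilon> n)"
      using eventually_ge_at_top[of 1] by eventually_elim (rule main)
  qed simp
  from LIM_zero_cancel[OF tendsto_norm_zero_cancel[OF this]]
  show ?thesis by (simp add: L_def v_def)
qed

end

section \<open>Stochastic boundedness and convergence in probability\<close>

lemma cmod_cis_diff_le: "cmod (cis x - cis y) \<le> \<bar>x - y\<bar>"
proof -
  have "cis x - cis y = cis y * (cis (x - y) - 1)" by (simp add: right_diff_distrib cis_mult)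
  then have "cmod (cis x - cis y) = cmod (cis (x - y) - 1)" by (simp add: norm_mult)
  also have "\<dots> \<le> \<bar>x - y\<bar>" using iexp_approx1[of "x - y" 0] by (simp add: cis_conv_exp)
  finally show ?thesis .
qed

context prob_space
begin

text \<open>Only the upper tail is constrained: for norms and absolute values this is convergence to
  0 in probability.\<close>

definition null_in_prob :: "(nat \<Rightarrow> 'a \<Rightarrow> real) \<Rightarrow> bool" where
  "null_in_prob Z \<longleftrightarrow> (\<forall>n. Z n \<in> borel_measurable M) \<and>
     (\<forall>\<epsilon>>0. (\<lambda>n. prob {\<omega>\<in>space M. \<epsilon> < Z n \<omega>}) \<longlonglongrightarrow> 0)"

definition tight_in_prob :: "(nat \<Rightarrow> 'a \<Rightarrow> real) \<Rightarrow> bool" where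
  "tight_in_prob Z \<longleftrightarrow> (\<forall>n. Z n \<in> borel_measurable M) \<and>
     (\<forall>\<epsilon>>0. \<exists>B. \<forall>\<^sub>F n in sequentially. prob {\<omega>\<in>space M. B < Z n \<omega>} \<le> \<epsilon>)"

lemma null_in_probD:
  "null_in_prob Z \<Longrightarrow> Z n \<in> borel_measurable M"
  "null_in_prob Z \<Longrightarrow> 0 < \<epsilon> \<Longrightarrow> (\<lambda>n. prob {\<omega>\<in>space M. \<epsilon> < Z n \<omega>}) \<longlonglongrightarrow> 0"
  by (auto simp: null_in_prob_def)

lemma tight_in_probD:
  "tight_in_prob Z \<Longrightarrow> Z n \<in> borel_measurable M"
  "tight_in_prob Z \<Longrightarrow> 0 < \<epsilon> \<Longrightarrow> \<exists>B. \<forall>\<^sub>F n in sequentially. prob {\<omega>\<in>space M. B < Z n \<omega>} \<le> \<epsilon>"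
  by (auto simp: tight_in_prob_def)

lemma prob_le_add:
  assumes "A \<subseteq> B \<union> C" "B \<in> events" "C \<in> events"
  shows "prob A \<le> prob B + prob C"
  using finite_measure_mono[OF assms(1)] measure_Un_le[OF assms(2,3)] assms(2,3)
  by (meson order_trans sets.Un)

text \<open>Domination is required only where \<open>D n\<close> is small, an event whose complement
  has vanishing probability. This suits the linearisation, which is controlled only when visit
  frequencies are near their limits.\<close>

lemma null_in_prob_dominated:
  assumes Z [measurable]: "\<And>n. Z n \<in> borel_measurable M"
    and D: "null_in_prob D" "0 < \<delta>" and W: "null_in_prob W"
    and le: "\<forall>\<^sub>F n in sequentially. \<forall>\<omega>\<in>space M. D n \<omega> \<le> \<delta> \<longrightarrow> Z n \<omega> \<le> W n \<omega>"
  shows "null_in_prob Z"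
  unfolding null_in_prob_def
proof (intro conjI allI impI Z)
  fix \<epsilon> :: real assume \<epsilon>: "0 < \<epsilon>"
  note [measurable] = null_in_probD(1)[OF D(1)] null_in_probD(1)[OF W]
  show "(\<lambda>n. prob {\<omega>\<in>space M. \<epsilon> < Z n \<omega>}) \<longlonglongrightarrow> 0"
  proof (rule tendsto_sandwich[OF _ _ tendsto_const])
    show "(\<lambda>n. prob {\<omega>\<in>space M. \<delta> < D n \<omega>} + prob {\<omega>\<in>space M. \<epsilon> < W n \<omega>}) \<longlonglongrightarrow> 0"
      using tendsto_add[OF null_in_probD(2)[OF D] null_in_probD(2)[OF W \<epsilon>]] by simp
    show "\<forall>\<^sub>F n in sequentially. prob {\<omega>\<in>space M. \<epsilon> < Z n \<omega>}
        \<le> prob {\<omega>\<in>space M. \<delta> < D n \<omega>} + prob {\<omega>\<in>space M. \<epsilon> < W n \<omega>}"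
      using le
    proof eventually_elim
      case (elim n)
      show ?case
      proof (rule prob_le_add)
        show "{\<omega>\<in>space M. \<epsilon> < Z n \<omega>} \<subseteq> {\<omega>\<in>space M. \<delta> < D n \<omega>} \<union> {\<omega>\<in>space M. \<epsilon> < W n \<omega>}"
          using elim by (force simp: not_less)
      qed measurable
    qed
  qed simp
qed

lemma null_in_prob_const:
  assumes "c \<longlonglongrightarrow> 0" shows "null_in_prob (\<lambda>n \<omega>. c n)"
  unfolding null_in_prob_def
proof (intro conjI allI impI)
  fix \<epsilon> :: real assume "0 < \<epsilon>"
  from order_tendstoD(2)[OF assms this]
  have "\<forall>\<^sub>F n in sequentially. prob {\<omega>\<in>space M. \<epsilon> < c n} = 0"
    by eventually_elim simp
  then show "(\<lambda>n. prob {\<omega>\<in>space M. \<epsilon> < c n}) \<longlonglongrightarrow> 0" by (rule tendsto_eventually)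
qed simp

lemma null_in_prob_mono:
  assumes "\<And>n. Z n \<in> borel_measurable M" "null_in_prob W"
    and "\<And>n \<omega>. \<omega> \<in> space M \<Longrightarrow> Z n \<omega> \<le> W n \<omega>"
  shows "null_in_prob Z"
  by (rule null_in_prob_dominated[OF assms(1) null_in_prob_const[OF tendsto_const] zero_less_one assms(2)])
    (use assms(3) in auto)

lemma null_in_prob_add:
  assumes Z: "null_in_prob Z" and W: "null_in_prob W"
  shows "null_in_prob (\<lambda>n \<omega>. Z n \<omega> + W n \<omega>)"
  unfolding null_in_prob_def
proof (intro conjI allI impI)
  note [measurable] = null_in_probD(1)[OF Z] null_in_probD(1)[OF W]
  show "(\<lambda>\<omega>. Z n \<omega> + W n \<omega>) \<in> borel_measurable M" for n by measurable
  fix \<epsilon> :: real assume \<epsilon>: "0 < \<epsilon>"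
  show "(\<lambda>n. prob {\<omega>\<in>space M. \<epsilon> < Z n \<omega> + W n \<omega>}) \<longlonglongrightarrow> 0"
  proof (rule tendsto_sandwich[OF _ _ tendsto_const])
    show "(\<lambda>n. prob {\<omega>\<in>space M. \<epsilon> / 2 < Z n \<omega>} + prob {\<omega>\<in>space M. \<epsilon> / 2 < W n \<omega>}) \<longlonglongrightarrow> 0"
      using tendsto_add[OF null_in_probD(2)[OF Z, of "\<epsilon> / 2"] null_in_probD(2)[OF W, of "\<epsilon> / 2"]] \<epsilon> by simp
    show "\<forall>\<^sub>F n in sequentially. prob {\<omega>\<in>space M. \<epsilon> < Z n \<omega> + W n \<omega>}
        \<le> prob {\<omega>\<in>space M. \<epsilon> / 2 < Z n \<omega>} + prob {\<omega>\<in>space M. \<epsilon> / 2 < W n \<omega>}"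
      by (intro always_eventually allI prob_le_add) auto
  qed simp
qed

lemma null_in_prob_sum:
  assumes "finite I" "\<And>i. i \<in> I \<Longrightarrow> null_in_prob (Z i)"
  shows "null_in_prob (\<lambda>n \<omega>. \<Sum>i\<in>I. Z i n \<omega>)"
  using assms
  by (induction I rule: finite_induct) (auto intro: null_in_prob_add null_in_prob_const)

text \<open>A product above \<open>\<epsilon>\<close> forces either \<open>Z n\<close> to exceed a
  bound \<open>B\<close> or \<open>W n\<close> to exceed \<open>\<epsilon> / B\<close>.\<close>

lemma null_in_prob_mult_tight:
  assumes Z: "tight_in_prob Z" and W: "null_in_prob W"
    and Z0: "\<And>n \<omega>. 0 \<le> Z n \<omega>" and W0: "\<And>n \<omega>. 0 \<le> W n \<omega>"
  shows "null_in_prob (\<lambda>n \<omega>. Z n \<omega> * W n \<omega>)"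
  unfolding null_in_prob_def
proof (intro conjI allI impI)
  note [measurable] = tight_in_probD(1)[OF Z] null_in_probD(1)[OF W]
  show "(\<lambda>\<omega>. Z n \<omega> * W n \<omega>) \<in> borel_measurable M" for n by measurable
  fix \<epsilon> :: real assume \<epsilon>: "0 < \<epsilon>"
  show "(\<lambda>n. prob {\<omega>\<in>space M. \<epsilon> < Z n \<omega> * W n \<omega>}) \<longlonglongrightarrow> 0"
  proof (rule tendstoI)
    fix \<eta> :: real assume \<eta>: "0 < \<eta>"
    obtain B' where B': "\<forall>\<^sub>F n in sequentially. prob {\<omega>\<in>space M. B' < Z n \<omega>} \<le> \<eta> / 2"
      using tight_in_probD(2)[OF Z, of "\<eta> / 2"] \<eta> by auto
    \<comment> \<open>Raised to at least 1 so that it can be divided by, whatever bound tightness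
      supplies.\<close>
    define B where "B = max 1 B'"
    have B: "0 < B" "B' \<le> B" by (auto simp: B_def)
    have "0 < \<epsilon> / B" using \<epsilon> B by simp
    from order_tendstoD(2)[OF null_in_probD(2)[OF W this], of "\<eta> / 2"]
    have "\<forall>\<^sub>F n in sequentially. prob {\<omega>\<in>space M. \<epsilon> / B < W n \<omega>} < \<eta> / 2" using \<eta> by simp
    with B' show "\<forall>\<^sub>F n in sequentially. dist (prob {\<omega>\<in>space M. \<epsilon> < Z n \<omega> * W n \<omega>}) 0 < \<eta>"
    proof eventually_elim
      case (elim n)
      have "prob {\<omega>\<in>space M. \<epsilon> < Z n \<omega> * W n \<omega>}
          \<le> prob {\<omega>\<in>space M. B' < Z n \<omega>} + prob {\<omega>\<in>space M. \<epsilon> / B < W n \<omega>}"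
      proof (rule prob_le_add)
        have "B' < Z n \<omega> \<or> \<epsilon> / B < W n \<omega>" if "\<epsilon> < Z n \<omega> * W n \<omega>" for \<omega>
        proof (rule ccontr)
          assume "\<not> ?thesis"
          then have "Z n \<omega> * W n \<omega> \<le> B * (\<epsilon> / B)" using B Z0 W0 by (intro mult_mono) auto
          with that B show False by simp
        qed
        then show "{\<omega>\<in>space M. \<epsilon> < Z n \<omega> * W n \<omega>} \<subseteq> {\<omega>\<in>space M. B' < Z n \<omega>} \<union> {\<omega>\<in>space M. \<epsilon> / B < W n \<omega>}"
          by auto
      qed measurable
      with elim show ?case by simp
    qed
  qed
qed

lemma null_in_prob_L1:
  assumes int: "\<And>n. integrable M (Z n)" and L1: "(\<lambda>n. expectation (\<lambda>\<omega>. \<bar>Z n \<omega>\<bar>)) \<longlonglongrightarrow> 0"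
  shows "null_in_prob (\<lambda>n \<omega>. \<bar>Z n \<omega>\<bar>)"
  unfolding null_in_prob_def
proof (intro conjI allI impI)
  note [measurable] = borel_measurable_integrable[OF int]
  show "(\<lambda>\<omega>. \<bar>Z n \<omega>\<bar>) \<in> borel_measurable M" for n by measurable
  fix \<epsilon> :: real assume \<epsilon>: "0 < \<epsilon>"
  show "(\<lambda>n. prob {\<omega>\<in>space M. \<epsilon> < \<bar>Z n \<omega>\<bar>}) \<longlonglongrightarrow> 0"
  proof (rule tendsto_sandwich[OF _ _ tendsto_const])
    show "(\<lambda>n. expectation (\<lambda>\<omega>. \<bar>Z n \<omega>\<bar>) / \<epsilon>) \<longlonglongrightarrow> 0" using tendsto_divide[OF L1 tendsto_const[of \<epsilon>]] \<epsilon> by simp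
    have "prob {\<omega>\<in>space M. \<epsilon> < \<bar>Z n \<omega>\<bar>} \<le> prob {\<omega>\<in>space M. \<epsilon> \<le> \<bar>Z n \<omega>\<bar>}" for n
      by (rule finite_measure_mono) auto
    also have "prob {\<omega>\<in>space M. \<epsilon> \<le> \<bar>Z n \<omega>\<bar>} \<le> expectation (\<lambda>\<omega>. \<bar>Z n \<omega>\<bar>) / \<epsilon>" for n
      using int \<epsilon> by (intro integral_Markov_inequality_measure[OF _ sets.top]) auto
    finally show "\<forall>\<^sub>F n in sequentially. prob {\<omega>\<in>space M. \<epsilon> < \<bar>Z n \<omega>\<bar>} \<le> expectation (\<lambda>\<omega>. \<bar>Z n \<omega>\<bar>) / \<epsilon>" by simp
  qed simp
qed

lemma tight_in_prob_L2:
  assumes Z [measurable]: "\<And>n. Z n \<in> borel_measurable M"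
    and int: "\<And>n. integrable M (\<lambda>\<omega>. (Z n \<omega>)\<^sup>2)"
    and K: "\<And>n. expectation (\<lambda>\<omega>. (Z n \<omega>)\<^sup>2) \<le> K"
  shows "tight_in_prob (\<lambda>n \<omega>. \<bar>Z n \<omega>\<bar>)"
  unfolding tight_in_prob_def
proof (intro conjI allI impI)
  show "(\<lambda>\<omega>. \<bar>Z n \<omega>\<bar>) \<in> borel_measurable M" for n by measurable
  fix \<epsilon> :: real assume \<epsilon>: "0 < \<epsilon>"
  have "0 \<le> expectation (\<lambda>\<omega>. (Z 0 \<omega>)\<^sup>2)" by (rule Bochner_Integration.integral_nonneg) simp
  then have K0: "0 \<le> K" using K[of 0] by linarith
  \<comment> \<open>Chosen so that Chebyshev's bound \<open>(K + 1) / B\<^sup>2\<close> equals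
    \<open>\<epsilon>\<close>; the added 1 keeps \<open>B\<close> positive when
    \<open>K = 0\<close>.\<close>
  define B where "B = sqrt ((K + 1) / \<epsilon>)"
  have B: "0 < B" "B\<^sup>2 = (K + 1) / \<epsilon>" using K0 \<epsilon> by (auto simp: B_def)
  have "prob {\<omega>\<in>space M. B < \<bar>Z n \<omega>\<bar>} \<le> \<epsilon>" for n
  proof -
    have "prob {\<omega>\<in>space M. B < \<bar>Z n \<omega>\<bar>} \<le> prob {\<omega>\<in>space M. B\<^sup>2 \<le> (Z n \<omega>)\<^sup>2}"
    proof (rule finite_measure_mono)
      show "{\<omega>\<in>space M. B < \<bar>Z n \<omega>\<bar>} \<subseteq> {\<omega>\<in>space M. B\<^sup>2 \<le> (Z n \<omega>)\<^sup>2}"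
        using B(1) by (auto simp flip: abs_le_square_iff)
    qed measurable
    also have "\<dots> \<le> expectation (\<lambda>\<omega>. (Z n \<omega>)\<^sup>2) / B\<^sup>2"
      using int B(1) by (intro integral_Markov_inequality_measure[OF _ sets.top]) auto
    also have "\<dots> \<le> (K + 1) / B\<^sup>2" using K[of n] by (intro divide_right_mono) auto
    also have "\<dots> = \<epsilon>" using K0 \<epsilon> by (simp add: B(2))
    finally show ?thesis .
  qed
  then show "\<exists>B. \<forall>\<^sub>F n in sequentially. prob {\<omega>\<in>space M. B < \<bar>Z n \<omega>\<bar>} \<le> \<epsilon>"
    by (intro exI[of _ B] always_eventually allI)
qed

lemma null_imp_tight_in_prob:
  assumes "null_in_prob Z" shows "tight_in_prob Z"
  unfolding tight_in_prob_def
proof (intro conjI allI impI null_in_probD(1)[OF assms])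
  fix \<epsilon> :: real assume "0 < \<epsilon>"
  from order_tendstoD(2)[OF null_in_probD(2)[OF assms zero_less_one] this]
  have "\<forall>\<^sub>F n in sequentially. prob {\<omega>\<in>space M. 1 < Z n \<omega>} \<le> \<epsilon>"
    by eventually_elim simp
  then show "\<exists>B. \<forall>\<^sub>F n in sequentially. prob {\<omega>\<in>space M. B < Z n \<omega>} \<le> \<epsilon>" ..
qed

lemma tight_in_prob_const: "tight_in_prob (\<lambda>n \<omega>. c)"
  unfolding tight_in_prob_def by (auto intro!: exI[of _ c])

lemma tight_in_prob_mult_const:
  assumes Z: "tight_in_prob Z" and c: "0 \<le> c"
  shows "tight_in_prob (\<lambda>n \<omega>. Z n \<omega> * c)"
  unfolding tight_in_prob_def
proof (intro conjI allI impI)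
  note [measurable] = tight_in_probD(1)[OF Z]
  show "(\<lambda>\<omega>. Z n \<omega> * c) \<in> borel_measurable M" for n by measurable
  fix \<epsilon> :: real assume "0 < \<epsilon>"
  from tight_in_probD(2)[OF Z this]
  obtain B where "\<forall>\<^sub>F n in sequentially. prob {\<omega>\<in>space M. B < Z n \<omega>} \<le> \<epsilon>" by auto
  then have "\<forall>\<^sub>F n in sequentially. prob {\<omega>\<in>space M. B * c < Z n \<omega> * c} \<le> \<epsilon>"
  proof eventually_elim
    case (elim n)
    have "prob {\<omega>\<in>space M. B * c < Z n \<omega> * c} \<le> prob {\<omega>\<in>space M. B < Z n \<omega>}"
      using c by (intro finite_measure_mono) (auto simp: mult_less_cancel_right)
    with elim show ?case by simp
  qed
  then show "\<exists>B. \<forall>\<^sub>F n in sequentially. prob {\<omega>\<in>space M. B < Z n \<omega> * c} \<le> \<epsilon>" ..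
qed

lemma tight_in_prob_add:
  assumes Z: "tight_in_prob Z" and W: "tight_in_prob W"
  shows "tight_in_prob (\<lambda>n \<omega>. Z n \<omega> + W n \<omega>)"
  unfolding tight_in_prob_def
proof (intro conjI allI impI)
  note [measurable] = tight_in_probD(1)[OF Z] tight_in_probD(1)[OF W]
  show "(\<lambda>\<omega>. Z n \<omega> + W n \<omega>) \<in> borel_measurable M" for n by measurable
  fix \<epsilon> :: real assume \<epsilon>: "0 < \<epsilon>"
  obtain B C where "\<forall>\<^sub>F n in sequentially. prob {\<omega>\<in>space M. B < Z n \<omega>} \<le> \<epsilon> / 2"
    and "\<forall>\<^sub>F n in sequentially. prob {\<omega>\<in>space M. C < W n \<omega>} \<le> \<epsilon> / 2"
    using tight_in_probD(2)[OF Z, of "\<epsilon> / 2"] tight_in_probD(2)[OF W, of "\<epsilon> / 2"] \<epsilon> by auto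
  then have "\<forall>\<^sub>F n in sequentially. prob {\<omega>\<in>space M. B + C < Z n \<omega> + W n \<omega>} \<le> \<epsilon>"
  proof eventually_elim
    case (elim n)
    have "prob {\<omega>\<in>space M. B + C < Z n \<omega> + W n \<omega>} \<le> prob {\<omega>\<in>space M. B < Z n \<omega>} + prob {\<omega>\<in>space M. C < W n \<omega>}"
      by (rule prob_le_add) auto
    with elim show ?case by simp
  qed
  then show "\<exists>B. \<forall>\<^sub>F n in sequentially. prob {\<omega>\<in>space M. B < Z n \<omega> + W n \<omega>} \<le> \<epsilon>" ..
qed

lemma tight_in_prob_sum:
  assumes "finite I" "\<And>i. i \<in> I \<Longrightarrow> tight_in_prob (Z i)"
  shows "tight_in_prob (\<lambda>n \<omega>. \<Sum>i\<in>I. Z i n \<omega>)"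
  using assms
  by (induction I rule: finite_induct)
    (auto intro: tight_in_prob_add null_imp_tight_in_prob[OF null_in_prob_const[OF tendsto_const]])

lemma tight_in_prob_mono:
  assumes Z: "\<And>n. Z n \<in> borel_measurable M" and W: "tight_in_prob W"
    and le: "\<And>n \<omega>. \<omega> \<in> space M \<Longrightarrow> Z n \<omega> \<le> W n \<omega>"
  shows "tight_in_prob Z"
  unfolding tight_in_prob_def
proof (intro conjI allI impI Z)
  note [measurable] = tight_in_probD(1)[OF W] Z
  fix \<epsilon> :: real assume \<epsilon>: "0 < \<epsilon>"
  from tight_in_probD(2)[OF W this]
  obtain B where "\<forall>\<^sub>F n in sequentially. prob {\<omega>\<in>space M. B < W n \<omega>} \<le> \<epsilon>" by auto
  then have "\<forall>\<^sub>F n in sequentially. prob {\<omega>\<in>space M. B < Z n \<omega>} \<le> \<epsilon>"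
  proof eventually_elim
    case (elim n)
    have "prob {\<omega>\<in>space M. B < Z n \<omega>} \<le> prob {\<omega>\<in>space M. B < W n \<omega>}"
      by (rule finite_measure_mono) (auto dest: le intro: less_le_trans)
    with elim show ?case by simp
  qed
  then show "\<exists>B. \<forall>\<^sub>F n in sequentially. prob {\<omega>\<in>space M. B < Z n \<omega>} \<le> \<epsilon>" ..
qed

text \<open>Slutsky's theorem for characteristic functions: \<open>cis\<close> is 1-Lipschitz, which
  handles the event where the two sequences are close, and differences of its values are at most 2
  on the rare complement.\<close>

lemma expectation_cis_slutsky:
  fixes Y Y' :: "nat \<Rightarrow> 'a \<Rightarrow> 'b::euclidean_space"
  assumes Y [measurable]: "\<And>n. Y n \<in> borel_measurable M" "\<And>n. Y' n \<in> borel_measurable M"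
    and null: "null_in_prob (\<lambda>n \<omega>. norm (Y n \<omega> - Y' n \<omega>))"
    and lim: "(\<lambda>n. expectation (\<lambda>\<omega>. cis (u \<bullet> Y' n \<omega>))) \<longlonglongrightarrow> c"
  shows "(\<lambda>n. expectation (\<lambda>\<omega>. cis (u \<bullet> Y n \<omega>))) \<longlonglongrightarrow> c"
proof -
  have int: "integrable M (\<lambda>\<omega>. cis (u \<bullet> Y n \<omega>))" "integrable M (\<lambda>\<omega>. cis (u \<bullet> Y' n \<omega>))" for n
    by (rule integrable_const_bound[of _ 1]; simp add: cis_conv_exp)+
  have "(\<lambda>n. expectation (\<lambda>\<omega>. cis (u \<bullet> Y n \<omega>)) - expectation (\<lambda>\<omega>. cis (u \<bullet> Y' n \<omega>))) \<longlonglongrightarrow> 0"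
  proof (rule tendstoI)
    fix \<epsilon> :: real assume \<epsilon>: "0 < \<epsilon>"
    \<comment> \<open>Makes the Lipschitz part at most \<open>\<epsilon> / 2\<close>, also for
      \<open>u = 0\<close>; the rare event of probability below \<open>\<epsilon> / 4\<close>
      contributes less than the other half.\<close>
    define \<delta> where "\<delta> = \<epsilon> / 2 / (norm u + 1)"
    have nu: "0 < norm u + 1" using norm_ge_zero[of u] by linarith
    have \<delta>: "0 < \<delta>" using \<epsilon> nu by (simp add: \<delta>_def)
    have "norm u * \<delta> \<le> (norm u + 1) * \<delta>" using \<delta> by (intro mult_right_mono) auto
    also have "\<dots> = \<epsilon> / 2" unfolding \<delta>_def using nu by (metis less_irrefl nonzero_eq_divide_eq mult.commute)
    finally have u\<delta>: "norm u * \<delta> \<le> \<epsilon> / 2" .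
    from order_tendstoD(2)[OF null_in_probD(2)[OF null \<delta>], of "\<epsilon> / 4"] \<epsilon>
    have "\<forall>\<^sub>F n in sequentially. prob {\<omega>\<in>space M. \<delta> < norm (Y n \<omega> - Y' n \<omega>)} < \<epsilon> / 4" by simp
    then show "\<forall>\<^sub>F n in sequentially.
        dist (expectation (\<lambda>\<omega>. cis (u \<bullet> Y n \<omega>)) - expectation (\<lambda>\<omega>. cis (u \<bullet> Y' n \<omega>))) 0 < \<epsilon>"
    proof eventually_elim
      case (elim n)
      let ?A = "{\<omega>\<in>space M. \<delta> < norm (Y n \<omega> - Y' n \<omega>)}"
      have A [measurable]: "?A \<in> events" by measurable
      have "cmod (expectation (\<lambda>\<omega>. cis (u \<bullet> Y n \<omega>)) - expectation (\<lambda>\<omega>. cis (u \<bullet> Y' n \<omega>)))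
          = cmod (expectation (\<lambda>\<omega>. cis (u \<bullet> Y n \<omega>) - cis (u \<bullet> Y' n \<omega>)))" using int by simp
      also have "\<dots> \<le> expectation (\<lambda>\<omega>. norm u * \<delta> + 2 * indicator ?A \<omega>)"
      proof (intro order_trans[OF integral_norm_bound] integral_mono)
        show "integrable M (\<lambda>\<omega>. cmod (cis (u \<bullet> Y n \<omega>) - cis (u \<bullet> Y' n \<omega>)))" using int by simp
        show "integrable M (\<lambda>\<omega>. norm u * \<delta> + 2 * indicator ?A \<omega>)"
          by (intro Bochner_Integration.integrable_add integrable_mult_right integrable_real_indicator)
            (auto simp: emeasure_eq_measure)
        fix \<omega> assume \<omega>: "\<omega> \<in> space M"
        show "cmod (cis (u \<bullet> Y n \<omega>) - cis (u \<bullet> Y' n \<omega>)) \<le> norm u * \<delta> + 2 * indicator ?A \<omega>"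
        proof (cases "\<omega> \<in> ?A")
          case True
          have "cmod (cis (u \<bullet> Y n \<omega>) - cis (u \<bullet> Y' n \<omega>)) \<le> 1 + 1"
            by (rule order_trans[OF norm_triangle_ineq4]) simp
          moreover have "0 \<le> norm u * \<delta>" using \<delta> by simp
          ultimately show ?thesis using True by simp
        next
          case False
          have "cmod (cis (u \<bullet> Y n \<omega>) - cis (u \<bullet> Y' n \<omega>)) \<le> \<bar>u \<bullet> (Y n \<omega> - Y' n \<omega>)\<bar>"
            using cmod_cis_diff_le by (simp add: inner_diff_right)
          also have "\<dots> \<le> norm u * norm (Y n \<omega> - Y' n \<omega>)" by (rule Cauchy_Schwarz_ineq2)
          also have "\<dots> \<le> norm u * \<delta>" using False \<omega> by (intro mult_left_mono) auto
          finally show ?thesis using False by simp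
        qed
      qed
      also have "\<dots> = norm u * \<delta> + 2 * prob ?A"
        by (subst Bochner_Integration.integral_add)
          (auto simp: prob_space emeasure_eq_measure intro!: integrable_real_indicator)
      also have "\<dots> < \<epsilon>" using u\<delta> elim by linarith
      finally show ?case by simp
    qed
  qed
  from tendsto_add[OF this lim] show ?thesis by simp
qed

end

section \<open>Plug-in estimation of the optimal value\<close>

context controlled_chain
begin

section \<open>The estimated transition matrix and its linearisation\<close>

lemma measurable_visits [measurable]: "visits X a n s l \<in> borel_measurable P"
  using integrable_visits by (rule borel_measurable_integrable)

lemma measurable_transitions [measurable]: "transitions X a n s l t \<in> borel_measurable P"
  unfolding transitions_def[abs_def] by measurable

lemma M_hat_nth: "M_hat X a n \<omega> $ (s, l) $ t = transitions X a n s l t \<omega> / visits X a n s l \<omega>"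
  by (simp add: M_hat_def)

lemma measurable_M_hat: "M_hat X a n \<in> borel_measurable P"
proof (intro borel_measurable_vecI)
  fix sl t
  show "(\<lambda>\<omega>. M_hat X a n \<omega> $ sl $ t) \<in> borel_measurable P"
    unfolding M_hat_def by simp
qed

text \<open>The transition counts of a pair add up to its visit count, so the row sum is
  \<open>x / x\<close>, which is 1 for a visited pair and 0 otherwise.\<close>

lemma substochastic_M_hat: "substochastic (M_hat X a n \<omega>)"
  unfolding substochastic_def
proof (intro conjI allI)
  fix sl t
  show "0 \<le> M_hat X a n \<omega> $ sl $ t"
    by (simp add: M_hat_def transitions_def visits_def sum_nonneg)
  have "(\<Sum>t\<in>UNIV. of_bool (A \<and> x = t \<and> B)) = (of_bool (A \<and> B) :: real)" for A B and x :: 'd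
  proof -
    have "(\<Sum>t\<in>UNIV. of_bool (A \<and> x = t \<and> B)) = (\<Sum>t\<in>UNIV. if x = t then of_bool (A \<and> B) else (0 :: real))"
      by (intro sum.cong) auto
    then show ?thesis by simp
  qed
  then have "(\<Sum>t\<in>UNIV. transitions X a n (fst sl) (snd sl) t \<omega>) = visits X a n (fst sl) (snd sl) \<omega>"
    unfolding transitions_def visits_def by (subst sum.swap) presburger
  then show "(\<Sum>t\<in>UNIV. M_hat X a n \<omega> $ sl $ t) \<le> 1"
    by (simp add: M_hat_def flip: sum_divide_distrib)
qed

lemma substochastic_M: "substochastic M"
  by (simp add: substochastic_def M_nonneg M_sum)

text \<open>The leading term of \<open>sqrt n *\<^sub>R (M_hat X a n \<omega> - M)\<close>: the
  random visit count in the denominator is replaced by \<open>n\<close> times its limiting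
  frequency.\<close>

definition linear_error :: "('d \<times> 'k \<Rightarrow> real) \<Rightarrow> nat \<Rightarrow> 'w \<Rightarrow> real^'d^('d \<times> 'k)" where
  "linear_error p n \<omega> = (1 / sqrt n) *\<^sub>R (\<Sum>i<n. influence_matrix M p (X i \<omega>, a i \<omega>) (X (Suc i) \<omega>))"

text \<open>The Cramer-Wold reduction: coordinates serve for tightness, directions \<open>u\<close>
  composed with the value derivative for the limit law.\<close>

lemma linear_functional_linear_error:
  fixes f :: "real^'d^('d \<times> 'k) \<Rightarrow> real"
  assumes "linear f"
  shows "f (linear_error p n \<omega>) = martingale_sum (\<lambda>sl t. f (influence_matrix M p sl t)) n \<omega> / sqrt n"
proof -
  interpret linear f by fact
  show ?thesis by (simp add: linear_error_def martingale_sum_def scaleR sum)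
qed

lemma mean_zero_influence:
  fixes f :: "real^'d^('d \<times> 'k) \<Rightarrow> real"
  assumes "linear f"
  shows "(\<Sum>t\<in>UNIV. M $ sl $ t * f (influence_matrix M p sl t)) = 0"
proof -
  interpret linear f by fact
  have "(\<Sum>t\<in>UNIV. M $ sl $ t * f (influence_matrix M p sl t)) = f (\<Sum>t\<in>UNIV. M $ sl $ t *\<^sub>R influence_matrix M p sl t)"
    by (simp add: scaleR sum)
  then show ?thesis by (simp add: sum_influence_matrix[OF M_sum] zero)
qed

lemma linear_nth_nth: "linear (\<lambda>D :: real^'d^('d \<times> 'k). D $ sl $ t)"
  by (rule linearI) simp_all

lemma linear_error_nth:
  "linear_error p n \<omega> $ (s, l) $ t
    = (transitions X a n s l t \<omega> - visits X a n s l \<omega> * M $ (s, l) $ t) / p (s, l) / sqrt n"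
proof -
  have "linear_error p n \<omega> $ (s, l) $ t
      = (\<Sum>i<n. influence_matrix M p (X i \<omega>, a i \<omega>) (X (Suc i) \<omega>) $ (s, l) $ t) / sqrt n"
    by (simp add: linear_functional_linear_error[OF linear_nth_nth] martingale_sum_def)
  also have "(\<Sum>i<n. influence_matrix M p (X i \<omega>, a i \<omega>) (X (Suc i) \<omega>) $ (s, l) $ t)
      = (transitions X a n s l t \<omega> - visits X a n s l \<omega> * M $ (s, l) $ t) / p (s, l)"
    unfolding transitions_def visits_def sum_distrib_right sum_subtractf[symmetric] sum_divide_distrib
    by (intro sum.cong refl) (auto simp: influence_matrix_def)
  finally show ?thesis by simp
qed

lemma measurable_linear_error: "linear_error p n \<in> borel_measurable P"
proof (intro borel_measurable_vecI)
  fix sl t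
  show "(\<lambda>\<omega>. linear_error p n \<omega> $ sl $ t) \<in> borel_measurable P"
    using measurable_martingale_sum by (simp add: linear_functional_linear_error[OF linear_nth_nth])
qed

lemma norm_matrix_le_sum: "norm D \<le> (\<Sum>sl\<in>UNIV. \<Sum>t\<in>UNIV. \<bar>D $ sl $ t\<bar>)" for D :: "real^'d^('d \<times> 'k)"
proof -
  have "norm D \<le> (\<Sum>sl\<in>UNIV. norm (D $ sl))" by (simp add: norm_vec_def L2_set_le_sum)
  also have "\<dots> \<le> (\<Sum>sl\<in>UNIV. \<Sum>t\<in>UNIV. \<bar>D $ sl $ t\<bar>)" by (intro sum_mono norm_le_l1_cart)
  finally show ?thesis .
qed

lemma integrable_martingale_sum_power2: "integrable P (\<lambda>\<omega>. (martingale_sum h n \<omega> / c)\<^sup>2)"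
  using integrable_H[of "\<lambda>hh. (sum_of_history h n hh / c)\<^sup>2" "Suc n"] by (simp flip: martingale_sum_H)

lemma tight_linear_error_nth: "tight_in_prob (\<lambda>n \<omega>. \<bar>linear_error p n \<omega> $ sl $ t\<bar>)"
proof -
  let ?h = "\<lambda>sl' t'. influence_matrix M p sl' t' $ sl $ t"
  define B where "B = Max (range (\<lambda>(sl', t'). \<bar>?h sl' t'\<bar>))"
  have B: "\<bar>?h sl' t'\<bar> \<le> B" for sl' t'
    unfolding B_def by (intro Max_ge) (auto intro!: image_eqI[of _ _ "(sl', t')"])
  show ?thesis
    unfolding linear_functional_linear_error[OF linear_nth_nth]
  proof (rule tight_in_prob_L2)
    show "(\<lambda>\<omega>. martingale_sum ?h n \<omega> / sqrt n) \<in> borel_measurable P" for n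
      using measurable_martingale_sum by simp
    show "expectation (\<lambda>\<omega>. (martingale_sum ?h n \<omega> / sqrt n)\<^sup>2) \<le> B\<^sup>2" for n
    proof -
      have "expectation (\<lambda>\<omega>. (martingale_sum ?h n \<omega> / sqrt n)\<^sup>2) = expectation (\<lambda>\<omega>. (martingale_sum ?h n \<omega>)\<^sup>2) / n"
        by (simp add: power_divide)
      also have "\<dots> \<le> n * B\<^sup>2 / n"
        by (intro divide_right_mono second_moment_martingale_sum_le B mean_zero_influence linear_nth_nth) simp
      also have "\<dots> \<le> B\<^sup>2" by simp
      finally show ?thesis .
    qed
  qed (rule integrable_martingale_sum_power2)
qed

lemma tight_linear_error: "tight_in_prob (\<lambda>n \<omega>. norm (linear_error p n \<omega>))"
proof (rule tight_in_prob_mono)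
  show "tight_in_prob (\<lambda>n \<omega>. \<Sum>sl\<in>UNIV. \<Sum>t\<in>UNIV. \<bar>linear_error p n \<omega> $ sl $ t\<bar>)"
    by (intro tight_in_prob_sum tight_linear_error_nth) simp_all
  show "(\<lambda>\<omega>. norm (linear_error p n \<omega>)) \<in> borel_measurable P" for n
    using measurable_linear_error by simp
qed (rule norm_matrix_le_sum)

text \<open>With \<open>f\<close> the visit frequency, the scaled error is exactly the linear one
  times \<open>p (s, l) / f\<close>. The relative difference is therefore
  \<open>(p (s, l) - f) / f\<close>, and closeness keeps \<open>f\<close> above half of
  \<open>p (s, l)\<close>.\<close>

lemma scaled_error_nth_approx:
  assumes n: "1 \<le> n" and p: "0 < p (s, l)"
    and close: "\<bar>visits X a n s l \<omega> / n - p (s, l)\<bar> \<le> p (s, l) / 2"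
  shows "\<bar>sqrt n * (M_hat X a n \<omega> $ (s, l) $ t - M $ (s, l) $ t) - linear_error p n \<omega> $ (s, l) $ t\<bar>
    \<le> \<bar>linear_error p n \<omega> $ (s, l) $ t\<bar> * (2 / p (s, l) * \<bar>visits X a n s l \<omega> / n - p (s, l)\<bar>)"
proof -
  define q where "q = p (s, l)"
  define f where "f = visits X a n s l \<omega> / n"
  define S where "S = transitions X a n s l t \<omega> - visits X a n s l \<omega> * M $ (s, l) $ t"
  define w where "w = linear_error p n \<omega> $ (s, l) $ t"
  have q: "0 < q" using p by (simp add: q_def)
  have fq: "q / 2 \<le> f" using close unfolding abs_le_iff f_def q_def by linarith
  have f0: "0 < f" using fq q by linarith
  have n0: "0 < real n" using n by simp
  have vf: "visits X a n s l \<omega> = f * n" using n0 by (simp add: f_def)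
  have w: "w = S / q / sqrt n" by (simp add: w_def linear_error_nth S_def q_def)
  have "sqrt n * (M_hat X a n \<omega> $ (s, l) $ t - M $ (s, l) $ t) = sqrt n * (S / (f * n))"
    using f0 n0 by (simp add: M_hat_nth S_def vf field_simps)
  also have "\<dots> = S / f / sqrt n"
    using n0 f0 real_sqrt_mult_self[of "real n"] by (simp add: field_simps)
  finally have eq: "sqrt n * (M_hat X a n \<omega> $ (s, l) $ t - M $ (s, l) $ t) = S / f / sqrt n" .
  have "sqrt n * (M_hat X a n \<omega> $ (s, l) $ t - M $ (s, l) $ t) - w = w * ((q - f) / f)"
    unfolding eq using q f0 n0 by (simp add: w field_simps)
  also have "\<bar>\<dots>\<bar> = \<bar>w\<bar> * (\<bar>f - q\<bar> / f)" using f0 by (simp add: abs_mult abs_minus_commute)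
  also have "\<dots> \<le> \<bar>w\<bar> * (2 / q * \<bar>f - q\<bar>)"
  proof (intro mult_left_mono)
    have "\<bar>f - q\<bar> / f \<le> \<bar>f - q\<bar> / (q / 2)" using fq q by (intro divide_left_mono) auto
    then show "\<bar>f - q\<bar> / f \<le> 2 / q * \<bar>f - q\<bar>" by (simp add: field_simps)
  qed simp
  finally show ?thesis by (simp add: w_def f_def q_def)
qed

text \<open>Entry by entry, the difference is dominated by a tight sequence times the deviation of
  the visit frequency, outside an event of vanishing probability.\<close>

lemma scaled_error_approx:
  assumes p: "\<And>sl. 0 < p sl"
    and freq: "\<And>s l. (\<lambda>n. expectation (\<lambda>\<omega>. \<bar>visits X a n s l \<omega> / n - p (s, l)\<bar>)) \<longlonglongrightarrow> 0"
  shows "null_in_prob (\<lambda>n \<omega>. norm (sqrt n *\<^sub>R (M_hat X a n \<omega> - M) - linear_error p n \<omega>))"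
proof (rule null_in_prob_mono)
  show "(\<lambda>\<omega>. norm (sqrt n *\<^sub>R (M_hat X a n \<omega> - M) - linear_error p n \<omega>)) \<in> borel_measurable P" for n
    using measurable_M_hat[of n] measurable_linear_error[of p n] by measurable
  show "norm (sqrt n *\<^sub>R (M_hat X a n \<omega> - M) - linear_error p n \<omega>)
      \<le> (\<Sum>sl\<in>UNIV. \<Sum>t\<in>UNIV. \<bar>(sqrt n *\<^sub>R (M_hat X a n \<omega> - M) - linear_error p n \<omega>) $ sl $ t\<bar>)" for n \<omega>
    by (rule norm_matrix_le_sum)
  have "null_in_prob (\<lambda>n \<omega>. \<bar>(sqrt n *\<^sub>R (M_hat X a n \<omega> - M) - linear_error p n \<omega>) $ (s, l) $ t\<bar>)" for s l t
  proof (rule null_in_prob_dominated)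
    let ?D = "\<lambda>n \<omega>. \<bar>visits X a n s l \<omega> / n - p (s, l)\<bar>"
    let ?W = "\<lambda>n \<omega>. \<bar>linear_error p n \<omega> $ (s, l) $ t\<bar>"
    show D: "null_in_prob ?D"
      using integrable_visits by (intro null_in_prob_L1 freq) simp
    have "null_in_prob (\<lambda>n \<omega>. 2 / p (s, l) * ?D n \<omega>)"
      by (rule null_in_prob_mult_tight[OF tight_in_prob_const D])
        (use p[of "(s, l)"] in auto)
    show "(\<lambda>\<omega>. \<bar>(sqrt n *\<^sub>R (M_hat X a n \<omega> - M) - linear_error p n \<omega>) $ (s, l) $ t\<bar>) \<in> borel_measurable P" for n
      using borel_measurable_matrix_nth[OF measurable_M_hat[of n]]
        borel_measurable_matrix_nth[OF measurable_linear_error[of p n]] by simp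
    show "null_in_prob (\<lambda>n \<omega>. ?W n \<omega> * (2 / p (s, l) * ?D n \<omega>))"
      using p[of "(s, l)"]
      by (intro null_in_prob_mult_tight tight_linear_error_nth \<open>null_in_prob (\<lambda>n \<omega>. 2 / p (s, l) * ?D n \<omega>)\<close>) auto
    show "0 < p (s, l) / 2" using p[of "(s, l)"] by simp
    show "\<forall>\<^sub>F n in sequentially. \<forall>\<omega>\<in>space P. ?D n \<omega> \<le> p (s, l) / 2 \<longrightarrow>
        \<bar>(sqrt n *\<^sub>R (M_hat X a n \<omega> - M) - linear_error p n \<omega>) $ (s, l) $ t\<bar> \<le> ?W n \<omega> * (2 / p (s, l) * ?D n \<omega>)"
      using eventually_ge_at_top[of 1]
    proof eventually_elim
      case (elim n)
      from scaled_error_nth_approx[where p = p, OF elim p, of s l _ t] show ?case by simp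
    qed
  qed
  then show "null_in_prob (\<lambda>n \<omega>. \<Sum>sl\<in>UNIV. \<Sum>t\<in>UNIV. \<bar>(sqrt n *\<^sub>R (M_hat X a n \<omega> - M) - linear_error p n \<omega>) $ sl $ t\<bar>)"
    by (intro null_in_prob_sum) (auto simp: split_paired_all)
qed

end

theorem theorem12:
  fixes P :: "'w measure"
    and X :: "nat \<Rightarrow> 'w \<Rightarrow> 'd::finite"
    and a :: "nat \<Rightarrow> 'w \<Rightarrow> 'k::finite"
    and M :: "real^'d^('d \<times> 'k)"
    and p :: "'d \<times> 'k \<Rightarrow> real"
    and \<alpha> :: real
    and gt :: "real^('d \<times> 'k)"
    and \<pi>_opt :: "'d \<Rightarrow> 'k pmf"
    and \<pi>_hat :: "nat \<Rightarrow> 'w \<Rightarrow> 'd \<Rightarrow> 'k pmf"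
  assumes cmc: "controlled_markov_chain P X a M"
    and return_times:
      "\<forall>s l. \<exists>\<beta> T. 0 < \<beta> \<and> \<beta> < 1 \<and> T \<in> O(\<lambda>i. real i powr \<beta>) \<and>
         (\<forall>i\<ge>1. AE \<omega> in P.
            nn_cond_exp P (return_sigma P X a s l i)
              (\<lambda>\<omega>. ennreal_of_enat (return_time X a s l i \<omega>)) \<omega> \<le> ennreal (T i))"
    and mixing: "\<exists>C>1. \<forall>n\<ge>1. Delta_norm P X a n \<le> C"
    and frequencies:
      "\<forall>s l. (\<lambda>n. (\<Sum>i<n. \<P>(\<omega> in P. X i \<omega> = s \<and> a i \<omega> = l)) / real n) \<longlonglongrightarrow> p (s, l)"
      "0 < (MIN sl. p sl)"
    and discount: "0 < \<alpha>" "\<alpha> < 1"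
    and opt: "optimal_policy \<alpha> gt M \<pi>_opt"
    and opt_hat: "\<forall>n. \<forall>\<omega>\<in>space P. optimal_policy \<alpha> gt (M_hat X a n \<omega>) (\<pi>_hat n \<omega>)"
    and opt_hat_measurable: "\<forall>n. (\<lambda>\<omega>. policy_matrix (\<pi>_hat n \<omega>)) \<in> borel_measurable P"
    and separation:
      "\<forall>\<epsilon>>0. \<forall>\<pi>'. \<epsilon> < infnorm (policy_matrix \<pi>_opt - policy_matrix \<pi>') \<longrightarrow>
         0 < (INF s. value_fun \<alpha> gt M \<pi>_opt $ s - value_fun \<alpha> gt M \<pi>' $ s)"
  shows "converges_in_prob P (\<lambda>n \<omega>. policy_matrix (\<pi>_hat n \<omega>)) (policy_matrix \<pi>_opt) \<and>
    (\<exists>N. multivariate_normal 0 (Sigma_V \<alpha> gt M p \<pi>_opt) N \<and>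
       converges_in_distribution P
         (\<lambda>n \<omega>. sqrt (real n) *\<^sub>R
            (value_fun \<alpha> gt (M_hat X a n \<omega>) (\<pi>_hat n \<omega>) - value_fun \<alpha> gt M \<pi>_opt)) N)"
proof -
  interpret controlled_chain P X a M by unfold_locales (rule cmc)
  have \<alpha>: "0 \<le> \<alpha>" "\<alpha> < 1" using discount by auto
  have p: "0 < p sl" for sl
    using frequencies(2) by (cases sl) (simp add: Min_gr_iff)
  obtain C where C: "\<And>n. 1 \<le> n \<Longrightarrow> Delta_norm P X a n \<le> C" using mixing by auto
  have freq: "(\<lambda>n. expectation (\<lambda>\<omega>. \<bar>visits X a n s l \<omega> / n - p (s, l)\<bar>)) \<longlonglongrightarrow> 0" for s l
    using visits_frequency_L1[OF C] frequencies(1) by blast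
  have strict: "value_fun \<alpha> gt M \<pi>' $ s < value_fun \<alpha> gt M \<pi>_opt $ s"
    if "policy_matrix \<pi>' \<noteq> policy_matrix \<pi>_opt" for \<pi>' s
  proof -
    have "0 < infnorm (policy_matrix \<pi>_opt - policy_matrix \<pi>')"
      using that by (simp add: infnorm_pos_lt)
    \<comment> \<open>Separation requires a distance strictly above its threshold, so half the
      distance serves as the threshold.\<close>
    then have "0 < (INF s. value_fun \<alpha> gt M \<pi>_opt $ s - value_fun \<alpha> gt M \<pi>' $ s)"
      using separation[rule_format, of "infnorm (policy_matrix \<pi>_opt - policy_matrix \<pi>') / 2" \<pi>'] by simp
    also have "\<dots> \<le> value_fun \<alpha> gt M \<pi>_opt $ s - value_fun \<alpha> gt M \<pi>' $ s"
      by (rule cINF_lower) (auto intro: bdd_below_finite)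
    finally show ?thesis by simp
  qed

  let ?W = "linear_error p"
  let ?R = "\<lambda>n \<omega>. sqrt n *\<^sub>R (M_hat X a n \<omega> - M)"
  let ?L = "value_derivative \<alpha> gt M \<pi>_opt"
  let ?Y = "\<lambda>n \<omega>. sqrt n *\<^sub>R (value_fun \<alpha> gt (M_hat X a n \<omega>) (\<pi>_hat n \<omega>) - value_fun \<alpha> gt M \<pi>_opt)"
  let ?Q = "\<lambda>n \<omega>. norm (policy_matrix (\<pi>_hat n \<omega>) - policy_matrix \<pi>_opt :: real^('d \<times> 'k)^'d)"
  note [measurable] = measurable_M_hat measurable_linear_error[of p] opt_hat_measurable[rule_format]
  interpret L: linear ?L by (rule linear_value_derivative)
  have bl: "bounded_linear ?L" using linear_value_derivative by (simp add: linear_conv_bounded_linear)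
  then have contL: "continuous_on UNIV ?L" by (rule linear_continuous_on)
  have [measurable]: "(\<lambda>\<omega>. ?L (?W n \<omega>)) \<in> borel_measurable P" for n
    using measurable_compose[OF measurable_linear_error borel_measurable_continuous_onI[OF contL]] .
  have Ymeas [measurable]: "?Y n \<in> borel_measurable P" for n
    using borel_measurable_value_fun[where gt = gt, OF opt_hat_measurable[rule_format, of n]
        measurable_M_hat[of n] substochastic_M_hat \<alpha>]
    by simp

  have RW: "null_in_prob (\<lambda>n \<omega>. norm (?R n \<omega> - ?W n \<omega>))" by (rule scaled_error_approx[OF p freq])
  have tightR: "tight_in_prob (\<lambda>n \<omega>. norm (?R n \<omega>))"
  proof (rule tight_in_prob_mono)
    show "tight_in_prob (\<lambda>n \<omega>. norm (?R n \<omega> - ?W n \<omega>) + norm (?W n \<omega>))"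
      by (intro tight_in_prob_add null_imp_tight_in_prob RW tight_linear_error)
    show "norm (?R n \<omega>) \<le> norm (?R n \<omega> - ?W n \<omega>) + norm (?W n \<omega>)" for n \<omega>
      using norm_triangle_ineq[of "?R n \<omega> - ?W n \<omega>" "?W n \<omega>"] by simp
  qed measurable
  \<comment> \<open>The error is \<open>?R\<close> divided by \<open>sqrt n\<close>, a tight
    sequence times a null one. At \<open>n = 0\<close> the dominating side is 0, so the domination
    is claimed only eventually.\<close>
  have nullM: "null_in_prob (\<lambda>n \<omega>. norm (M_hat X a n \<omega> - M))"
  proof (rule null_in_prob_dominated[where D = "\<lambda>n \<omega>. 0" and \<delta> = 1])
    have "(\<lambda>n. 1 / sqrt (real n)) \<longlonglongrightarrow> 0" by real_asymp
    then show "null_in_prob (\<lambda>n \<omega>. norm (?R n \<omega>) * (1 / sqrt n))"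
      by (intro null_in_prob_mult_tight tightR null_in_prob_const) auto
    show "null_in_prob (\<lambda>n \<omega>. 0)" by (rule null_in_prob_const) simp
    show "(\<lambda>\<omega>. norm (M_hat X a n \<omega> - M)) \<in> borel_measurable P" for n by measurable
    show "\<forall>\<^sub>F n in sequentially. \<forall>\<omega>\<in>space P. (0::real) \<le> 1 \<longrightarrow> norm (M_hat X a n \<omega> - M) \<le> norm (?R n \<omega>) * (1 / sqrt n)"
      using eventually_gt_at_top[of 0] by eventually_elim simp
  qed auto

  have Qnull: "null_in_prob ?Q"
    unfolding null_in_prob_def
  proof (intro conjI allI impI)
    show "?Q n \<in> borel_measurable P" for n by measurable
    fix \<epsilon> :: real assume \<epsilon>: "0 < \<epsilon>"
    obtain \<delta> where \<delta>: "0 < \<delta>" "\<And>M' \<pi>'. substochastic M' \<Longrightarrow> optimal_policy \<alpha> gt M' \<pi>' \<Longrightarrow> norm (M' - M) \<le> \<delta> \<Longrightarrow>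
        norm (policy_matrix \<pi>' - policy_matrix \<pi>_opt :: real^('d \<times> 'k)^'d) < \<epsilon>"
      using optimal_policy_stable[OF \<alpha> substochastic_M strict \<epsilon>] by blast
    show "(\<lambda>n. prob {\<omega>\<in>space P. \<epsilon> < ?Q n \<omega>}) \<longlonglongrightarrow> 0"
    proof (rule tendsto_sandwich[OF _ _ tendsto_const null_in_probD(2)[OF nullM \<delta>(1)]])
      show "\<forall>\<^sub>F n in sequentially. prob {\<omega>\<in>space P. \<epsilon> < ?Q n \<omega>} \<le> prob {\<omega>\<in>space P. \<delta> < norm (M_hat X a n \<omega> - M)}"
      proof (intro always_eventually allI finite_measure_mono subsetI)
        fix n \<omega> assume "\<omega> \<in> {\<omega>\<in>space P. \<epsilon> < ?Q n \<omega>}"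
        then have \<omega>: "\<omega> \<in> space P" "\<epsilon> < ?Q n \<omega>" by auto
        have "\<not> norm (M_hat X a n \<omega> - M) \<le> \<delta>"
          using \<delta>(2)[OF substochastic_M_hat, of n \<omega> "\<pi>_hat n \<omega>"] opt_hat \<omega> by fastforce
        then show "\<omega> \<in> {\<omega>\<in>space P. \<delta> < norm (M_hat X a n \<omega> - M)}" using \<omega> by simp
      qed measurable
    qed simp
  qed
  then have "converges_in_prob P (\<lambda>n \<omega>. policy_matrix (\<pi>_hat n \<omega>)) (policy_matrix \<pi>_opt)"
    using opt_hat_measurable by (simp add: converges_in_prob_def null_in_prob_def dist_norm)

  moreover have YW: "null_in_prob (\<lambda>n \<omega>. norm (?Y n \<omega> - ?L (?W n \<omega>)))"
  proof -
    obtain K where K: "0 \<le> K" "\<And>M' \<pi>'. substochastic M' \<Longrightarrow> optimal_policy \<alpha> gt M' \<pi>' \<Longrightarrow>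
        norm (value_fun \<alpha> gt M' \<pi>' - value_fun \<alpha> gt M \<pi>_opt - ?L (M' - M))
        \<le> K * norm (M' - M) * (norm (policy_matrix \<pi>' - policy_matrix \<pi>_opt :: real^('d \<times> 'k)^'d) + norm (M' - M))"
      using value_fun_optimal_expansion[OF \<alpha> substochastic_M opt] by blast
    obtain K' where K': "0 \<le> K'" "\<And>D. norm (?L D) \<le> norm D * K'"
      using bounded_linear.nonneg_bounded[OF bl] by blast
    \<comment> \<open>The factor \<open>sqrt n\<close> of the scaled remainder is absorbed by one
      factor \<open>norm ?D\<close>, giving the tight \<open>norm (?R n \<omega>)\<close>; the
      bracket tends to 0 in probability.\<close>
    let ?E = "\<lambda>n \<omega>. norm (?R n \<omega>) * (?Q n \<omega> + norm (M_hat X a n \<omega> - M))"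
    show ?thesis
    proof (rule null_in_prob_mono)
      show "null_in_prob (\<lambda>n \<omega>. K * ?E n \<omega> + K' * norm (?R n \<omega> - ?W n \<omega>))"
        by (intro null_in_prob_add null_in_prob_mult_tight tight_in_prob_const tightR Qnull nullM RW)
          (use K(1) K'(1) in auto)
      show "(\<lambda>\<omega>. norm (?Y n \<omega> - ?L (?W n \<omega>))) \<in> borel_measurable P" for n by measurable
      fix n \<omega> assume \<omega>: "\<omega> \<in> space P"
      let ?D = "M_hat X a n \<omega> - M"
      let ?e = "value_fun \<alpha> gt (M_hat X a n \<omega>) (\<pi>_hat n \<omega>) - value_fun \<alpha> gt M \<pi>_opt - ?L ?D"
      \<comment> \<open>Two sources of error: the nonlinear remainder of the value, and the
        derivative applied to the linearisation error of the transition matrix.\<close>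
      have "?Y n \<omega> - ?L (?W n \<omega>) = sqrt n *\<^sub>R ?e + ?L (?R n \<omega> - ?W n \<omega>)"
        by (simp add: L.diff L.scale scaleR_diff_right)
      also have "norm \<dots> \<le> sqrt n * norm ?e + norm (?R n \<omega> - ?W n \<omega>) * K'"
        by (rule order_trans[OF norm_triangle_ineq]) (simp add: K'(2))
      also have "sqrt n * norm ?e \<le> sqrt n * (K * norm ?D * (?Q n \<omega> + norm ?D))"
        using K(2)[OF substochastic_M_hat, of n \<omega> "\<pi>_hat n \<omega>"] opt_hat \<omega> by (intro mult_left_mono) auto
      also have "\<dots> = K * ?E n \<omega>" by simp
      finally show "norm (?Y n \<omega> - ?L (?W n \<omega>)) \<le> K * ?E n \<omega> + K' * norm (?R n \<omega> - ?W n \<omega>)"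
        by (simp add: mult.commute)
    qed
  qed

  moreover obtain N where N: "multivariate_normal 0 (Sigma_V \<alpha> gt M p \<pi>_opt) N" "prob_space N" "sets N = sets borel"
    and cisN: "\<And>u. (\<integral>y. cis (u \<bullet> y) \<partial>N) = exp (- (\<Sum>sl\<in>UNIV. p sl * (\<Sum>t\<in>UNIV. M $ sl $ t *
      (u \<bullet> ?L (influence_matrix M p sl t))\<^sup>2)) / 2)"
    using value_derivative_limit_normal[where p = p and gt = gt and \<pi> = \<pi>_opt, OF M_nonneg M_sum p \<alpha>] by blast

  moreover have "converges_in_distribution P ?Y N"
  proof (rule converges_in_distributionI_cis[OF prob_space_axioms N(2,3) Ymeas])
    fix u :: "real^'d"
    have lin: "linear (\<lambda>D. u \<bullet> ?L D)"
      by (rule linearI) (simp_all add: L.add L.scale inner_add_right)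
    have "(\<lambda>n. expectation (\<lambda>\<omega>. cis (u \<bullet> ?L (?W n \<omega>)))) \<longlonglongrightarrow> (\<integral>y. cis (u \<bullet> y) \<partial>N)"
      unfolding linear_functional_linear_error[OF lin] cisN
      by (rule martingale_sum_clt[OF mean_zero_influence[OF lin] freq]) (rule less_imp_le[OF p])
    then show "(\<lambda>n. expectation (\<lambda>\<omega>. cis (u \<bullet> ?Y n \<omega>))) \<longlonglongrightarrow> (\<integral>y. cis (u \<bullet> y) \<partial>N)"
      by (rule expectation_cis_slutsky[OF Ymeas _ YW, rotated]) measurable
  next
    fix \<epsilon> :: real assume \<epsilon>: "0 < \<epsilon>"
    obtain K' where K': "0 \<le> K'" "\<And>D. norm (?L D) \<le> norm D * K'"
      using bounded_linear.nonneg_bounded[OF bl] by blast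
    \<comment> \<open>Tightness passes from the linear error, where it rests on second moments,
      through the bounded derivative and the vanishing difference \<open>YW\<close>.\<close>
    have "tight_in_prob (\<lambda>n \<omega>. norm (?Y n \<omega>))"
    proof (rule tight_in_prob_mono)
      show "tight_in_prob (\<lambda>n \<omega>. norm (?Y n \<omega> - ?L (?W n \<omega>)) + norm (?W n \<omega>) * K')"
        by (intro tight_in_prob_add null_imp_tight_in_prob YW tight_in_prob_mult_const tight_linear_error K'(1))
      show "norm (?Y n \<omega>) \<le> norm (?Y n \<omega> - ?L (?W n \<omega>)) + norm (?W n \<omega>) * K'" for n \<omega>
        using norm_triangle_ineq[of "?Y n \<omega> - ?L (?W n \<omega>)" "?L (?W n \<omega>)"] K'(2)[of "?W n \<omega>"] by simp
    qed measurable
    from tight_in_probD(2)[OF this \<epsilon>]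
    show "\<exists>B. \<forall>\<^sub>F n in sequentially. \<P>(\<omega> in P. B < norm (?Y n \<omega>)) \<le> \<epsilon>" .
  qed
  ultimately show ?thesis by blast
qed

end
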